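(* (Conditional strong stability.) Let $p=0$ and $s=1$. Let $K_h$ be the kernel of $A_h+A_h^t+M_1:V_h^{\mathtt v}\to V_h^{\mathtt v}$ and $K_h^\perp$ its $L^{\mathtt v}$-orthogonal complement in $V_h^{\mathtt v}$, and set $$\kappa=\sup_{0\le\tau\le1}\ \sup_{0\ne v\in K_h^\perp}\frac{\|M(\tau)^{-1}(A_h+M_1)v\|_{M(\tau)}^2}{|v|_d^2}.$$ Then $\kappa\lesssim1$. For all $\tau\in[0,1]$ with $0\le\tau\le1/\kappa$ and all $v\in V_h^{\mathtt v}$, $$\|R^{\rm sat}_{h1}(\tau)v\|_{M(\tau)}\le\|v\|_{M_0}.$$ Furthermore, if $r\ge\kappa$ subtents are used ($r\geq 1$ an integer), then for all $v\in V_h^{\mathtt v}$ $$\|R^{\rm sat}_{rh1}v\|_{M(1)}\le\|v\|_{M_0}.$$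
   Context: **Coefficients.** $\Omega\subset\mathbb R^N$ is open and bounded, with a conforming simplicial mesh $\Omega_h$ from a shape regular family. $\mathcal L^{(j)}$ ($1\le j\le N$) and $\mathcal G$ are bounded symmetric $\mathbb R^{L\times L}$-valued functions on $\Omega$, constant on each mesh element, $\mathcal G$ uniformly positive definite, and $\sum_j\partial_j\mathcal L^{(j)}=0$ in the sense of distributions. $\mathcal D^{(\nu)}=\sum_j\nu_j\mathcal L^{(j)}$, and $\mathcal D=\mathcal D^{(n)}$ with $n$ the outward unit normal on the boundary considered. $c$ is the largest $|\lambda|$ with $\mathcal D^{(\nu)}(x)e=\lambda\mathcal G(x)e$, $e\ne0$, over all $x$ and unit $\nu$; $\hat c>c$ is fixed. **Tent.** For a mesh vertex $\mathtt v$, $\Omega^{\mathtt v}$ is the vertex patch, $\Omega_h^{\mathtt v}$ its set of elements. A tent is $T^{\mathtt v}=\{(x,t):x\in\Omega^{\mathtt v},\varphi_{\rm bot}(x)\le t\le\varphi_{\rm top}(x)\}$, with $\varphi_{\rm bot}\le\varphi_{\rm top}$ continuous on $\Omega^{\mathtt v}$, linear on each element, equal at all vertices of the patch other than $\mathtt v$. It is causal: $\|\operatorname{grad}_x\varphi_{\rm bot}\|_2,\|\operatorname{grad}_x\varphi_{\rm top}\|_2\le1/\hat c$. $\delta=\varphi_{\rm top}-\varphi_{\rm bot}$ vanishes on $\partial\Omega^{\mathtt v}\setminus\partial\Omega$. **Spaces and operators.** $L^{\mathtt v}=L^2(\Omega^{\mathtt v})^L$ with inner product $(\cdot,\cdot)_{\mathtt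 v}$; $V_h^{\mathtt v}=\{v:v|_K\in P_p(K)^L,\ K\in\Omega_h^{\mathtt v}\}$ (here $p=0$: piecewise constants). $M_0w=\mathcal Gw-\sum_j(\partial_j\varphi_{\rm bot})\mathcal L^{(j)}w$, $M_1w=\sum_j(\partial_j\delta)\mathcal L^{(j)}w$, $M(\tau)=M_0-\tau M_1$ (these leave $V_h^{\mathtt v}$ invariant, and $M(\tau)$ is selfadjoint positive definite for $0\le\tau\le1$); $\|z\|_{M(\tau)}=(M(\tau)z,z)_{\mathtt v}^{1/2}$, $\|\cdot\|_{M_0}=\|\cdot\|_{M(0)}$. **DG form.** $a(w,v)=\sum_{K\in\Omega_h^{\mathtt v}}\big[\sum_j(\delta\mathcal L^{(j)}w,\partial_jv)_K-(\delta\hat F^n_w,v)_{\partial K}\big]$, with $\hat F_w^n=\mathcal D\{w\}+S[\![w]\!]$ on $\partial K\setminus\partial\Omega$ and $\hat F_w^n=\frac12(\mathcal D+B)w$ on $\partial K\cap\partial\Omega$, where $\{w\}=\frac12(w+w_o)$, $[\![w]\!]=w-w_o$, $w_o$ being the value from the neighboring element (facets in $\partial\Omega^{\mathtt v}\setminus\partial\Omega$ contribute nothing since $\delta=0$ there). With $|y|_S^2=Sy\cdot y$, $|y|_B^2=By\cdot y$, the single-valued $S$ on interior facets and $B$ on $\partial\Omega$ satisfy: $B+B^t\ge0$, $\|B\|_2\lesssim1$, $(\mathcal D+B)y\cdot z\lesssim\|y\|_2|z|_B$ on $\partial\Omega$; $S+S^t\ge0$, $\|S\|_2\lesssim1$,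 $Sy\cdot z\lesssim|y|_S|z|_S$, $\mathcal Dy\cdot z\lesssim\|y\|_2|z|_S$ on interior facets, for all $y,z\in\mathbb R^L$. $A_h:V_h^{\mathtt v}\to V_h^{\mathtt v}$ is defined by $(A_hw,v)_{\mathtt v}=a(w,v)$, and $A_h^t$ is its adjoint in $(\cdot,\cdot)_{\mathtt v}$. $d(w,v)=-[a(w,v)+a(v,w)+(M_1w,v)_{\mathtt v}]$ is positive semidefinite and $|v|_d=d(v,v)^{1/2}$. **SAT propagators, $s=1$.** $R^{\rm sat}_{h1}(\tau)=I+\tau M(\tau)^{-1}(A_h+M_1)$. With $r$ subtents and $\hat t^{[\ell]}=(\ell-1)/r$, $R^{\rm sat}_{[\ell],h1}(1)=I+\frac1rM(\hat t^{[\ell+1]})^{-1}(A_h+M_1)$ for $\ell=1,\dots,r$, and $R^{\rm sat}_{rh1}=R^{\rm sat}_{[r],h1}(1)\circ\cdots\circ R^{\rm sat}_{[1],h1}(1)$. **Conventions.** $a\lesssim b$ means $a\le Cb$ with $C>0$ independent of the mesh within the shape regular family, of the tent, and of the functions involved ($C$ may depend on $c,\hat c$, the coefficients, the constants in the DG conditions, $N$, $L$, $\Omega$, shape regularity). If $\kappa=0$ (or $K_h^\perp=\{0\}$, with $\kappa$ read as $0$), $1/\kappa$ is read as $+\infty$. *)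

theory Defs
  imports "HOL-Analysis.Analysis"
begin

section \<open>Derivatives and test functions\<close>

definition partial_deriv :: "'n \<Rightarrow> (real^'n \<Rightarrow> 'b::real_normed_vector) \<Rightarrow> real^'n \<Rightarrow> 'b"
  where "partial_deriv j f x = frechet_derivative f (at x) (axis j 1)"

definition grad :: "(real^'n \<Rightarrow> real) \<Rightarrow> real^'n \<Rightarrow> real^'n"
  where "grad f x = (\<chi> j. partial_deriv j f x)"

text \<open>If every iterated partial derivative is differentiable, all of them are continuous, so
  this is exactly \<open>C\<^sup>\<infinity>\<close>.\<close>

definition smooth :: "(real^'n \<Rightarrow> real) \<Rightarrow> bool"
  where "smooth f \<longleftrightarrow> (\<forall>js x. foldr partial_deriv js f differentiable (at x))"

definition test_function :: "(real^'n) set \<Rightarrow> (real^'n \<Rightarrow> real) \<Rightarrow> bool"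
  where "test_function \<Omega> \<psi> \<longleftrightarrow>
    smooth \<psi> \<and> (\<exists>C. compact C \<and> C \<subseteq> \<Omega> \<and> (\<forall>x. x \<notin> C \<longrightarrow> \<psi> x = 0))"


section \<open>Coefficients\<close>

definition normal_matrix ::
    "('n \<Rightarrow> real^'n \<Rightarrow> real^'l^'l) \<Rightarrow> real^'n \<Rightarrow> real^'n \<Rightarrow> real^'l^'l"
  where "normal_matrix \<L> \<nu> x = (\<Sum>j\<in>UNIV. (\<nu> $ j) *\<^sub>R \<L> j x)"

definition admissible_coefficients ::
    "(real^'n) set \<Rightarrow> ('n \<Rightarrow> real^'n \<Rightarrow> real^'l^'l) \<Rightarrow> (real^'n \<Rightarrow> real^'l^'l) \<Rightarrow> bool"
  where "admissible_coefficients \<Omega> \<L> \<G> \<longleftrightarrow>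
    (\<forall>j. bounded (\<L> j ` \<Omega>)) \<and> bounded (\<G> ` \<Omega>) \<and>
    (\<forall>j. \<forall>x\<in>\<Omega>. transpose (\<L> j x) = \<L> j x) \<and>
    (\<forall>x\<in>\<Omega>. transpose (\<G> x) = \<G> x) \<and>
    (\<exists>g>0. \<forall>x\<in>\<Omega>. \<forall>e. (\<G> x *v e) \<bullet> e \<ge> g * (norm e)\<^sup>2) \<and>
    (\<forall>\<psi>. test_function \<Omega> \<psi> \<longrightarrow>
       (\<Sum>j\<in>UNIV. LINT x:\<Omega>|lebesgue. partial_deriv j \<psi> x *\<^sub>R \<L> j x) = 0)"

definition wave_speed ::
    "(real^'n) set \<Rightarrow> ('n \<Rightarrow> real^'n \<Rightarrow> real^'l^'l) \<Rightarrow> (real^'n \<Rightarrow> real^'l^'l) \<Rightarrow> real"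
  where "wave_speed \<Omega> \<L> \<G> = Sup {\<bar>\<mu>\<bar> | \<mu>. \<exists>x\<in>\<Omega>. \<exists>\<nu> e. norm \<nu> = 1 \<and> e \<noteq> 0 \<and>
    normal_matrix \<L> \<nu> x *v e = \<mu> *\<^sub>R (\<G> x *v e)}"


section \<open>Meshes\<close>

text \<open>Elements are closed simplices. The last condition says that the facets resolve the
  boundary of \<open>\<Omega>\<close>: each facet is a boundary facet or an interior one.\<close>

definition conforming_mesh :: "(real^'n) set \<Rightarrow> (real^'n) set set \<Rightarrow> bool"
  where "conforming_mesh \<Omega> \<T> \<longleftrightarrow>
    triangulation \<T> \<and> (\<forall>K\<in>\<T>. int CARD('n) simplex K) \<and>
    \<Union>\<T> = closure \<Omega> \<and> (\<forall>K\<in>\<T>. interior K \<subseteq> \<Omega>) \<and>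
    (\<forall>K\<in>\<T>. \<forall>F. F facet_of K \<longrightarrow> F \<subseteq> frontier \<Omega> \<or> rel_interior F \<subseteq> \<Omega>)"

definition inradius :: "(real^'n) set \<Rightarrow> real"
  where "inradius K = Sup {\<rho>. \<exists>x. cball x \<rho> \<subseteq> K}"

definition shape_regular :: "real \<Rightarrow> (real^'n) set set \<Rightarrow> bool"
  where "shape_regular \<sigma> \<T> \<longleftrightarrow> (\<forall>K\<in>\<T>. diameter K \<le> \<sigma> * inradius K)"

definition mesh_vertex :: "(real^'n) set set \<Rightarrow> real^'n \<Rightarrow> bool"
  where "mesh_vertex \<T> x \<longleftrightarrow> (\<exists>K\<in>\<T>. x extreme_point_of K)"

definition elementwise_constant :: "(real^'n) set set \<Rightarrow> (real^'n \<Rightarrow> 'b) \<Rightarrow> bool"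
  where "elementwise_constant \<T> f \<longleftrightarrow> (\<forall>K\<in>\<T>. f constant_on interior K)"

definition patch :: "(real^'n) set set \<Rightarrow> real^'n \<Rightarrow> (real^'n) set set"
  where "patch \<T> vtx = {K \<in> \<T>. vtx extreme_point_of K}"


section \<open>Traces and integrals over facets\<close>

definition element_trace :: "(real^'n) set \<Rightarrow> (real^'n \<Rightarrow> 'b::t2_space) \<Rightarrow> real^'n \<Rightarrow> 'b"
  where "element_trace K f x = Lim (at x within interior K) f"

definition outward_normal :: "(real^'n) set \<Rightarrow> (real^'n) set \<Rightarrow> real^'n"
  where "outward_normal K F = (THE \<nu>. norm \<nu> = 1 \<and>
    (\<exists>b. (\<forall>x\<in>K. \<nu> \<bullet> x \<le> b) \<and> F = {x\<in>K. \<nu> \<bullet> x = b}))"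

text \<open>The \<open>(N-1)\<close>-dimensional Lebesgue measure on the hyperplane through \<open>p\<close> with unit
  normal \<open>\<nu>\<close>: the measure of a subset of the hyperplane is the \<open>N\<close>-dimensional Lebesgue measure
  of the right cylinder of height one over it. For \<open>N = 1\<close> this is the unit point mass at \<open>p\<close>.\<close>

definition hyperplane_measure :: "real^'n \<Rightarrow> real^'n \<Rightarrow> (real^'n) measure"
  where "hyperplane_measure \<nu> p =
    distr (restrict_space lborel {x. 0 \<le> \<nu> \<bullet> (x - p) \<and> \<nu> \<bullet> (x - p) \<le> 1}) borel
      (\<lambda>x. x - (\<nu> \<bullet> (x - p)) *\<^sub>R \<nu>)"

definition facet_integral ::
    "(real^'n) set \<Rightarrow> (real^'n) set \<Rightarrow> (real^'n \<Rightarrow> real) \<Rightarrow> real"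
  where "facet_integral K F f =
    (LINT x:F|hyperplane_measure (outward_normal K F) (SOME p. p \<in> F). f x)"


section \<open>Tents\<close>

definition causal_tent ::
    "real \<Rightarrow> (real^'n) set set \<Rightarrow> real^'n \<Rightarrow> (real^'n \<Rightarrow> real) \<Rightarrow> (real^'n \<Rightarrow> real) \<Rightarrow> bool"
  where "causal_tent c' \<T> vtx \<phi>b \<phi>t \<longleftrightarrow>
    (\<forall>x \<in> \<Union>(patch \<T> vtx). \<phi>b x \<le> \<phi>t x) \<and>
    (\<forall>\<phi>\<in>{\<phi>b, \<phi>t}.
       continuous_on (\<Union>(patch \<T> vtx)) \<phi> \<and>
       (\<forall>K\<in>patch \<T> vtx. \<exists>g b. \<forall>x\<in>K. \<phi> x = g \<bullet> x + b) \<and>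
       (\<forall>K\<in>patch \<T> vtx. \<forall>x\<in>interior K. norm (grad \<phi> x) \<le> 1 / c')) \<and>
    (\<forall>K\<in>patch \<T> vtx. \<forall>x. x extreme_point_of K \<and> x \<noteq> vtx \<longrightarrow> \<phi>b x = \<phi>t x)"


section \<open>Numerical flux parameters\<close>

definition form_seminorm :: "real^'l^'l \<Rightarrow> real^'l \<Rightarrow> real"
  where "form_seminorm A y = sqrt ((A *v y) \<bullet> y)"

text \<open>The flux parameters carry the facet as an argument, so that no compatibility is imposed at
  points belonging to several facets; they do not depend on the side from which the facet is
  seen. Measurability is what makes the facet integrals meaningful. The single constant
  \<open>\<Gamma>\<close> majorizes all constants hidden in the inequalities.\<close>

definition flux_conditions ::
    "real \<Rightarrow> (real^'n) set \<Rightarrow> ('n \<Rightarrow> real^'n \<Rightarrow> real^'l^'l) \<Rightarrow> (real^'n) set set \<Rightarrow>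
     ((real^'n) set \<Rightarrow> real^'n \<Rightarrow> real^'l^'l) \<Rightarrow>
     ((real^'n) set \<Rightarrow> real^'n \<Rightarrow> real^'l^'l) \<Rightarrow> bool"
  where "flux_conditions \<Gamma> \<Omega> \<L> \<T> S B \<longleftrightarrow>
    (\<forall>K\<in>\<T>. \<forall>F. F facet_of K \<and> F \<subseteq> frontier \<Omega> \<longrightarrow>
       set_borel_measurable borel F (B F) \<and>
       (\<forall>x\<in>F. let D = element_trace K (normal_matrix \<L> (outward_normal K F)) x; b = B F x in
          (\<forall>y. ((b + transpose b) *v y) \<bullet> y \<ge> 0) \<and>
          onorm ((*v) b) \<le> \<Gamma> \<and>
          (\<forall>y z. ((D + b) *v y) \<bullet> z \<le> \<Gamma> * (norm y * form_seminorm b z)))) \<and>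
    (\<forall>K\<in>\<T>. \<forall>F. F facet_of K \<and> \<not> F \<subseteq> frontier \<Omega> \<longrightarrow>
       set_borel_measurable borel F (S F) \<and>
       (\<forall>x\<in>F. let D = element_trace K (normal_matrix \<L> (outward_normal K F)) x; s = S F x in
          (\<forall>y. ((s + transpose s) *v y) \<bullet> y \<ge> 0) \<and>
          onorm ((*v) s) \<le> \<Gamma> \<and>
          (\<forall>y z. (s *v y) \<bullet> z \<le> \<Gamma> * (form_seminorm s y * form_seminorm s z)) \<and>
          (\<forall>y z. (D *v y) \<bullet> z \<le> \<Gamma> * (norm y * form_seminorm s z))))"


section \<open>Discretization on one tent\<close>

text \<open>Elements of \<open>V\<^sub>h\<close> are represented by functions on \<open>\<real>\<^sup>N\<close>; the representative of an
  \<open>L\<^sup>2\<close> class is made unique by letting it vanish outside the open elements of the patch, so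
  that equality in \<open>V\<^sub>h\<close> is equality of functions.\<close>

locale tent_dg =
  fixes \<Omega> :: "(real^'n) set"
    and \<L> :: "'n \<Rightarrow> real^'n \<Rightarrow> real^'l^'l"
    and \<G> :: "real^'n \<Rightarrow> real^'l^'l"
    and \<T> :: "(real^'n) set set"
    and vtx :: "real^'n"
    and \<phi>b \<phi>t :: "real^'n \<Rightarrow> real"
    and S B :: "(real^'n) set \<Rightarrow> real^'n \<Rightarrow> real^'l^'l"
begin

definition \<delta> :: "real^'n \<Rightarrow> real"
  where "\<delta> x = \<phi>t x - \<phi>b x"

definition inner_patch :: "(real^'n \<Rightarrow> real^'l) \<Rightarrow> (real^'n \<Rightarrow> real^'l) \<Rightarrow> real"
  where "inner_patch w v = (LINT x:\<Union>(patch \<T> vtx)|lebesgue. w x \<bullet> v x)"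

definition V\<^sub>h :: "(real^'n \<Rightarrow> real^'l) set"
  where "V\<^sub>h = {v. elementwise_constant (patch \<T> vtx) v \<and>
    (\<forall>x. x \<notin> \<Union>(interior ` patch \<T> vtx) \<longrightarrow> v x = 0)}"

definition M\<^sub>0 :: "(real^'n \<Rightarrow> real^'l) \<Rightarrow> real^'n \<Rightarrow> real^'l"
  where "M\<^sub>0 w x = \<G> x *v w x - (\<Sum>j\<in>UNIV. partial_deriv j \<phi>b x *\<^sub>R (\<L> j x *v w x))"

definition M\<^sub>1 :: "(real^'n \<Rightarrow> real^'l) \<Rightarrow> real^'n \<Rightarrow> real^'l"
  where "M\<^sub>1 w x = (\<Sum>j\<in>UNIV. partial_deriv j \<delta> x *\<^sub>R (\<L> j x *v w x))"

definition M :: "real \<Rightarrow> (real^'n \<Rightarrow> real^'l) \<Rightarrow> real^'n \<Rightarrow> real^'l"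
  where "M \<tau> w x = M\<^sub>0 w x - \<tau> *\<^sub>R M\<^sub>1 w x"

definition M_inv :: "real \<Rightarrow> (real^'n \<Rightarrow> real^'l) \<Rightarrow> real^'n \<Rightarrow> real^'l"
  where "M_inv \<tau> = inv_into V\<^sub>h (M \<tau>)"

definition M_norm :: "real \<Rightarrow> (real^'n \<Rightarrow> real^'l) \<Rightarrow> real"
  where "M_norm \<tau> z = sqrt (inner_patch (M \<tau> z) z)"

text \<open>On a facet without a neighbor in the patch \<open>neighbor\<close> is unspecified, but such a facet
  either lies in \<open>\<partial>\<Omega>\<close> or is one on which \<open>\<delta>\<close> vanishes.\<close>

definition neighbor :: "(real^'n) set \<Rightarrow> (real^'n) set \<Rightarrow> (real^'n) set"
  where "neighbor K F = (THE K'. K' \<in> patch \<T> vtx \<and> K' \<noteq> K \<and> F facet_of K')"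

definition flux ::
    "(real^'n) set \<Rightarrow> (real^'n) set \<Rightarrow> (real^'n \<Rightarrow> real^'l) \<Rightarrow> real^'n \<Rightarrow> real^'l"
  where "flux K F w x =
    (let D = element_trace K (normal_matrix \<L> (outward_normal K F)) x;
         w\<^sub>i = element_trace K w x;
         w\<^sub>o = element_trace (neighbor K F) w x
     in if F \<subseteq> frontier \<Omega> then (1/2) *\<^sub>R ((D + B F x) *v w\<^sub>i)
        else D *v ((1/2) *\<^sub>R (w\<^sub>i + w\<^sub>o)) + S F x *v (w\<^sub>i - w\<^sub>o))"

definition a :: "(real^'n \<Rightarrow> real^'l) \<Rightarrow> (real^'n \<Rightarrow> real^'l) \<Rightarrow> real"
  where "a w v = (\<Sum>K\<in>patch \<T> vtx.
    (\<Sum>j\<in>UNIV. LINT x:interior K|lebesgue. (\<delta> x *\<^sub>R (\<L> j x *v w x)) \<bullet> partial_deriv j v x)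
    - (\<Sum>F\<in>{F. F facet_of K}.
         facet_integral K F (\<lambda>x. (\<delta> x *\<^sub>R flux K F w x) \<bullet> element_trace K v x)))"

definition A\<^sub>h :: "(real^'n \<Rightarrow> real^'l) \<Rightarrow> real^'n \<Rightarrow> real^'l"
  where "A\<^sub>h w = (THE u. u \<in> V\<^sub>h \<and> (\<forall>v\<in>V\<^sub>h. inner_patch u v = a w v))"

definition A\<^sub>h_adjoint :: "(real^'n \<Rightarrow> real^'l) \<Rightarrow> real^'n \<Rightarrow> real^'l"
  where "A\<^sub>h_adjoint w = (THE u. u \<in> V\<^sub>h \<and> (\<forall>v\<in>V\<^sub>h. inner_patch u v = inner_patch w (A\<^sub>h v)))"

definition d :: "(real^'n \<Rightarrow> real^'l) \<Rightarrow> (real^'n \<Rightarrow> real^'l) \<Rightarrow> real"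
  where "d w v = - (a w v + a v w + inner_patch (M\<^sub>1 w) v)"

definition d_seminorm :: "(real^'n \<Rightarrow> real^'l) \<Rightarrow> real"
  where "d_seminorm v = sqrt (d v v)"

definition K\<^sub>h :: "(real^'n \<Rightarrow> real^'l) set"
  where "K\<^sub>h = {v \<in> V\<^sub>h. \<forall>x. A\<^sub>h v x + A\<^sub>h_adjoint v x + M\<^sub>1 v x = 0}"

definition K\<^sub>h_perp :: "(real^'n \<Rightarrow> real^'l) set"
  where "K\<^sub>h_perp = {v \<in> V\<^sub>h. \<forall>w\<in>K\<^sub>h. inner_patch v w = 0}"

definition increment :: "real \<Rightarrow> (real^'n \<Rightarrow> real^'l) \<Rightarrow> real^'n \<Rightarrow> real^'l"
  where "increment \<tau> v = M_inv \<tau> (\<lambda>x. A\<^sub>h v x + M\<^sub>1 v x)"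

text \<open>With values in \<open>[0,\<infinity>]\<close> the empty supremum is \<open>0\<close>, \<open>1 / 0 = \<infinity>\<close>, and a nonzero
  increment over a vanishing denominator would count as \<open>\<infinity>\<close>.\<close>

definition \<kappa> :: ennreal
  where "\<kappa> = (SUP \<tau>\<in>{0..1}. SUP v\<in>K\<^sub>h_perp - {\<lambda>x. 0}.
    ennreal ((M_norm \<tau> (increment \<tau> v))\<^sup>2) / ennreal ((d_seminorm v)\<^sup>2))"

definition R_sat :: "real \<Rightarrow> (real^'n \<Rightarrow> real^'l) \<Rightarrow> real^'n \<Rightarrow> real^'l"
  where "R_sat \<tau> v x = v x + \<tau> *\<^sub>R increment \<tau> v x"

definition subtent_time :: "nat \<Rightarrow> nat \<Rightarrow> real"
  where "subtent_time r l = (real l - 1) / real r"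

definition R_sat_subtent :: "nat \<Rightarrow> nat \<Rightarrow> (real^'n \<Rightarrow> real^'l) \<Rightarrow> real^'n \<Rightarrow> real^'l"
  where "R_sat_subtent r l v x = v x + (1 / real r) *\<^sub>R increment (subtent_time r (l + 1)) v x"

definition R_sat_iterated :: "nat \<Rightarrow> (real^'n \<Rightarrow> real^'l) \<Rightarrow> real^'n \<Rightarrow> real^'l"
  where "R_sat_iterated r = fold (R_sat_subtent r) [1..<r+1]"

end

end

theory Submission
  imports Defs
begin

text \<open>Write \<open>u = M(\<tau>)\<^sup>-\<^sup>1 (A\<^sub>h + M\<^sub>1) v\<close>. Since \<open>M\<close> is affine in \<open>\<tau>\<close>, expanding the square gives
  \<open>\<parallel>v + h u\<parallel>\<^sup>2 = \<parallel>v\<parallel>\<^sup>2 - h |v|\<^sub>d\<^sup>2 + h\<^sup>2 \<parallel>u\<parallel>\<^sup>2\<close>, with the norms of \<open>M(\<tau>)\<close>, \<open>M(\<tau> - h)\<close> and \<open>M(\<tau>)\<close>, so a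
  step of size \<open>h\<close> does not increase the energy if \<open>h \<parallel>u\<parallel>\<^sup>2 \<le> |v|\<^sub>d\<^sup>2\<close>. This holds for \<open>h \<kappa> \<le> 1\<close>, because
  neither \<open>u\<close> nor \<open>|v|\<^sub>d\<close> changes when the component of \<open>v\<close> in \<open>K\<^sub>h\<close> is removed.
  For the bound on \<open>\<kappa>\<close>, the divergence theorem on each simplex and the continuity of the normal component
  of the piecewise constant fields \<open>\<L>\<close> turn both \<open>|v|\<^sub>d\<^sup>2\<close> and \<open>\<parallel>u\<parallel>\<^sup>2 = a(v, u) + (M\<^sub>1 v, u)\<close> into sums of
  facet integrals weighted by \<open>\<delta>\<close>. Those of \<open>|v|\<^sub>d\<^sup>2\<close> contain exactly the jump and boundary seminorms that control
  those of \<open>\<parallel>u\<parallel>\<^sup>2\<close> through the flux conditions, up to \<open>\<Sum>\<^sub>F \<integral>\<^sub>F \<delta> |u|\<^sup>2\<close>, which causality and shape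
  regularity bound by \<open>\<integral>\<^sub>K |u|\<^sup>2\<close>.\<close>

section \<open>Symmetric forms and the wave speed\<close>

text \<open>The flux parameters vary over a facet while traces of piecewise constants do not, so a
  facet enters only through the scalar \<open>\<delta>_int\<close> and the averaged matrix
  \<open>Q\<close>. The bounds assumed on \<open>S\<close> and \<open>B\<close> involve square roots
  of forms and are not linear in these matrices, so they cannot be averaged as they stand. Young's
  inequality with a free \<epsilon> turns them pointwise into inequalities affine in the flux
  matrix, which integrate against the weight \<delta>. The same \<epsilon> is fixed to bound
  \<kappa>, and sent to 0 to show that \<open>A\<^sub>h + M\<^sub>1\<close> vanishes on all of
  \<open>K\<^sub>h\<close>. No mesh size may survive: a facet integral of \<delta> is the tent
  height divided by a height of the simplex, times its volume, and the two heights are compared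
  through the diameter. Facet areas never appear, because barycentric coordinates and the cylinder
  definition of the facet measure express these integrals as volumes. The divergence constraint is
  only distributional; it is localized at a facet by a smooth radial function built from the flat
  exponential.\<close>

lemma symmetric_form_swap:
  fixes A :: "real^'l^'l"
  assumes "transpose A = A"
  shows "(A *v x) \<bullet> y = (A *v y) \<bullet> x"
proof -
  have "(A *v x) \<bullet> y = y \<bullet> (A *v x)" by (rule inner_commute)
  also have "\<dots> = (transpose A *v y) \<bullet> x" by (simp add: dot_lmul_matrix)
  finally show ?thesis using assms by simp
qed

lemma transpose_form: "(transpose A *v x) \<bullet> y = (A *v y) \<bullet> (x::real^'l)"
  by (metis dot_lmul_matrix inner_commute transpose_matrix_vector)

text \<open>Along the line e + t A e the form is 2 t |A e|^2 + t^2 s, which is negative for small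
  negative t unless A e = 0.\<close>

lemma psd_form_zero:
  fixes A :: "real^'l^'l"
  assumes sym: "transpose A = A" and psd: "\<And>x. 0 \<le> (A *v x) \<bullet> x" and z: "(A *v e) \<bullet> e = 0"
  shows "A *v e = 0"
proof (rule ccontr)
  assume ne: "A *v e \<noteq> 0"
  define y where "y = A *v e"
  define q where "q = y \<bullet> y"
  define s where "s = (A *v y) \<bullet> y"
  \<comment> \<open>The minimizer would be - q / s; the shifted denominator also covers s =
    0.\<close>
  define t where "t = - q / (s + 1)"
  have q: "q > 0" and s: "s \<ge> 0" using ne psd by (auto simp: q_def y_def s_def)
  have "(A *v (e + t *\<^sub>R y)) \<bullet> (e + t *\<^sub>R y) = 2 * t * q + t\<^sup>2 * s"
    using z symmetric_form_swap[OF sym, of e y]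
    by (simp add: matrix_vector_right_distrib matrix_vector_mult_scaleR inner_add_left inner_add_right
        q_def s_def power2_eq_square y_def algebra_simps)
  also have "\<dots> = - ((q / (s + 1))\<^sup>2 * (s + 2))"
  proof -
    have "q = q / (s + 1) * (s + 1)" using s by simp
    moreover have "2 * - k * (k * (s + 1)) + (- k)\<^sup>2 * s = - (k\<^sup>2 * (s + 2))" for k :: real
      by (simp add: power2_eq_square algebra_simps)
    ultimately show ?thesis unfolding t_def by (metis minus_divide_left)
  qed
  also have "\<dots> < 0" using q s by simp
  finally show False using psd[of "e + t *\<^sub>R y"] by linarith
qed

text \<open>The Rayleigh quotient attains its maximum \<mu> on the unit sphere at some e. There the
  positive semidefinite form of \<mu> G - D vanishes, and \<open>psd_form_zero\<close> turns this
  into the eigenvalue equation.\<close>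

lemma largest_generalized_eigenvalue:
  fixes D G :: "real^'l^'l"
  assumes D: "transpose D = D" and G: "transpose G = G"
    and pos: "\<And>x. x \<noteq> 0 \<Longrightarrow> 0 < (G *v x) \<bullet> x"
  obtains \<mu> e where "e \<noteq> 0" "D *v e = \<mu> *\<^sub>R (G *v e)" "\<And>x. (D *v x) \<bullet> x \<le> \<mu> * ((G *v x) \<bullet> x)"
proof -
  define f where "f x = ((D *v x) \<bullet> x) / ((G *v x) \<bullet> x)" for x
  have lin: "bounded_linear ((*v) A)" for A :: "real^'l^'l"
    by (rule matrix_vector_mul_bounded_linear)
  have "(G *v x) \<bullet> x \<noteq> 0" if "x \<in> sphere 0 1" for x
  proof -
    from that have "x \<noteq> 0" by auto
    then show ?thesis using pos by (metis less_irrefl)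
  qed
  then have "continuous_on (sphere 0 1) f"
    unfolding f_def
    by (intro continuous_intros bounded_linear.continuous_on[OF lin]) auto
  moreover have "(sphere 0 1 :: (real^'l) set) \<noteq> {}" by simp
  ultimately obtain e where e: "e \<in> sphere 0 1" "\<And>y. y \<in> sphere 0 1 \<Longrightarrow> f y \<le> f e"
    using continuous_attains_sup[OF compact_sphere] by metis
  define \<mu> where "\<mu> = f e"
  have e0: "e \<noteq> 0" using e(1) by auto
  have le: "(D *v x) \<bullet> x \<le> \<mu> * ((G *v x) \<bullet> x)" for x
  proof (cases "x = 0")
    case False
    have "f (x /\<^sub>R norm x) \<le> \<mu>" unfolding \<mu>_def using False by (intro e(2)) simp
    moreover have "f (x /\<^sub>R norm x) = f x"
      using False unfolding f_def matrix_vector_mult_scaleR by simp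
    ultimately have "f x \<le> \<mu>" by simp
    then show ?thesis using pos[OF False] unfolding f_def by (simp only: pos_divide_le_eq)
  qed simp
  have "(\<mu> *\<^sub>R G - D) *v e = 0"
  proof (rule psd_form_zero)
    show "transpose (\<mu> *\<^sub>R G - D) = \<mu> *\<^sub>R G - D"
      using D G by (simp add: transpose_def vec_eq_iff)
    show "0 \<le> ((\<mu> *\<^sub>R G - D) *v x) \<bullet> x" for x
      using le by (simp add: matrix_vector_mult_diff_rdistrib scaleR_matrix_vector_assoc[symmetric] inner_diff_left)
    show "((\<mu> *\<^sub>R G - D) *v e) \<bullet> e = 0"
      using pos[OF e0] by (simp add: matrix_vector_mult_diff_rdistrib scaleR_matrix_vector_assoc[symmetric] inner_diff_left \<mu>_def f_def)
  qed
  then have "D *v e = \<mu> *\<^sub>R (G *v e)"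
    by (simp add: matrix_vector_mult_diff_rdistrib scaleR_matrix_vector_assoc[symmetric])
  from e0 this le show thesis by (rule that)
qed

lemma bounded_matrix_form:
  fixes S :: "(real^'l^'l) set"
  assumes "bounded S"
  obtains b where "b \<ge> 0" "\<And>A x. A \<in> S \<Longrightarrow> \<bar>(A *v x) \<bullet> x\<bar> \<le> b * (norm x)\<^sup>2"
proof -
  obtain c where c: "\<And>A. A \<in> S \<Longrightarrow> norm A \<le> c" "c > 0" using assms bounded_pos by metis
  have "\<bar>(A *v x) \<bullet> x\<bar> \<le> (real CARD('l) * (real CARD('l) * c)) * (norm x)\<^sup>2" if "A \<in> S" for A x
  proof -
    have comp: "\<bar>A $ i $ j\<bar> \<le> c" for i j
      using c(1)[OF that] Finite_Cartesian_Product.norm_nth_le[of A i] Finite_Cartesian_Product.norm_nth_le[of "A $ i" j] by auto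
    have "norm (A *v x) \<le> onorm ((*v) A) * norm x"
      using onorm[OF matrix_vector_mul_bounded_linear] .
    also have "onorm ((*v) A) \<le> (\<Sum>i\<in>UNIV. \<Sum>j\<in>UNIV. \<bar>A $ i $ j\<bar>)" by (rule onorm_le_matrix_component_sum)
    also have "\<dots> \<le> (\<Sum>i\<in>(UNIV::'l set). \<Sum>j\<in>(UNIV::'l set). c)" by (intro sum_mono comp)
    finally have "norm (A *v x) \<le> real CARD('l) * (real CARD('l) * c) * norm x"
      by (simp add: mult_right_mono)
    then have "norm (A *v x) * norm x \<le> real CARD('l) * (real CARD('l) * c) * norm x * norm x"
      by (rule mult_right_mono) simp
    with Cauchy_Schwarz_ineq2[of "A *v x" x] show ?thesis by (simp add: power2_eq_square)
  qed
  with c(2) show thesis by (intro that[of "real CARD('l) * (real CARD('l) * c)"]) auto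
qed

lemma transpose_normal_matrix:
  assumes "\<And>j. transpose (\<L> j x) = \<L> j x"
  shows "transpose (normal_matrix \<L> \<nu> x) = normal_matrix \<L> \<nu> x"
proof -
  have "\<L> j x $ i $ k = \<L> j x $ k $ i" for j i k
    using arg_cong[OF assms[of j], of "\<lambda>A. A $ i $ k"] by (simp add: transpose_def)
  then show ?thesis
    by (simp add: normal_matrix_def transpose_def vec_eq_iff sum_component)
qed

lemma normal_matrix_mult_vec:
  "normal_matrix \<L> \<nu> x *v w = (\<Sum>j\<in>UNIV. (\<nu> $ j) *\<^sub>R (\<L> j x *v w))"
proof -
  have "(\<Sum>j\<in>J. (\<nu> $ j) *\<^sub>R \<L> j x) *v w = (\<Sum>j\<in>J. (\<nu> $ j) *\<^sub>R (\<L> j x *v w))" if "finite J" for J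
    using that by induction (auto simp: matrix_vector_mult_add_rdistrib scaleR_matrix_vector_assoc)
  then show ?thesis by (simp add: normal_matrix_def)
qed

text \<open>\<open>wave_speed\<close> is a real supremum, so it dominates its members only after the
  set has been shown bounded: coercivity of \<G> and boundedness of the \<open>\<L> j\<close> bound
  every |\<mu>|. The largest generalized eigenvalue at x is then such a member. Under causality this
  inequality makes M positive.\<close>

lemma wave_speed_bound:
  fixes \<L> :: "'n::finite \<Rightarrow> real^'n \<Rightarrow> real^'l^'l"
  assumes adm: "admissible_coefficients \<Omega> \<L> \<G>" and x: "x \<in> \<Omega>" and \<nu>: "norm \<nu> = 1"
  shows "(normal_matrix \<L> \<nu> x *v w) \<bullet> w \<le> wave_speed \<Omega> \<L> \<G> * ((\<G> x *v w) \<bullet> w)"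
    and "0 \<le> wave_speed \<Omega> \<L> \<G>"
proof -
  define E where "E = {\<bar>\<mu>\<bar> | \<mu>. \<exists>x\<in>\<Omega>. \<exists>\<nu> e. norm \<nu> = 1 \<and> e \<noteq> 0 \<and>
    normal_matrix \<L> \<nu> x *v e = \<mu> *\<^sub>R (\<G> x *v e)}"
  have ws: "wave_speed \<Omega> \<L> \<G> = Sup E" by (simp add: wave_speed_def E_def)
  obtain g where g: "g > 0" "\<And>x e. x \<in> \<Omega> \<Longrightarrow> (\<G> x *v e) \<bullet> e \<ge> g * (norm e)\<^sup>2"
    using adm by (auto simp: admissible_coefficients_def)
  have Lb: "bounded (\<L> j ` \<Omega>)" for j using adm by (auto simp: admissible_coefficients_def)
  have "\<exists>b\<ge>0. \<forall>x\<in>\<Omega>. \<forall>e. \<bar>(\<L> j x *v e) \<bullet> e\<bar> \<le> b * (norm e)\<^sup>2" for j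
    by (rule bounded_matrix_form[OF Lb[of j]]) blast
  then obtain b where b: "\<And>j. 0 \<le> b j"
      "\<And>j x e. x \<in> \<Omega> \<Longrightarrow> \<bar>(\<L> j x *v e) \<bullet> e\<bar> \<le> b j * (norm e)\<^sup>2"
    by metis
  have bdd: "bdd_above E"
  proof (rule bdd_aboveI)
    fix m assume "m \<in> E"
    then obtain \<mu> y \<eta> e where m: "m = \<bar>\<mu>\<bar>" and y: "y \<in> \<Omega>" and \<eta>: "norm \<eta> = 1" and e: "e \<noteq> 0"
      and eq: "normal_matrix \<L> \<eta> y *v e = \<mu> *\<^sub>R (\<G> y *v e)"
      by (auto simp: E_def)
    have "\<bar>\<mu>\<bar> * (g * (norm e)\<^sup>2) \<le> \<bar>\<mu>\<bar> * ((\<G> y *v e) \<bullet> e)"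
      using g(2)[OF y] by (intro mult_left_mono) auto
    also have "\<dots> = \<bar>(normal_matrix \<L> \<eta> y *v e) \<bullet> e\<bar>"
      using g(2)[OF y, of e] g(1) by (simp add: eq abs_mult order_trans[OF _ g(2)[OF y]])
    also have "\<dots> \<le> (\<Sum>j\<in>UNIV. \<bar>\<eta> $ j * ((\<L> j y *v e) \<bullet> e)\<bar>)"
      by (simp add: normal_matrix_mult_vec inner_sum_left)
    also have "\<dots> \<le> (\<Sum>j\<in>UNIV. 1 * (b j * (norm e)\<^sup>2))"
      unfolding abs_mult
      by (intro sum_mono mult_mono b y) (use \<eta> Finite_Cartesian_Product.norm_nth_le[of \<eta>] in \<open>auto\<close>)
    finally have "\<bar>\<mu>\<bar> * g * (norm e)\<^sup>2 \<le> (\<Sum>j\<in>UNIV. b j) * (norm e)\<^sup>2"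
      by (simp add: sum_distrib_right mult.assoc)
    then have "\<bar>\<mu>\<bar> * g \<le> (\<Sum>j\<in>UNIV. b j)" using e by simp
    then show "m \<le> (\<Sum>j\<in>UNIV. b j) / g" using g(1) m by (simp add: field_simps)
  qed
  have G: "transpose (\<G> x) = \<G> x" using adm x by (auto simp: admissible_coefficients_def)
  have D: "transpose (normal_matrix \<L> \<nu> x) = normal_matrix \<L> \<nu> x"
    using adm x by (intro transpose_normal_matrix) (auto simp: admissible_coefficients_def)
  have pos: "0 < (\<G> x *v e) \<bullet> e" if "e \<noteq> 0" for e
    using g(2)[OF x, of e] g(1) that by (smt (verit) mult_pos_pos zero_less_norm_iff zero_less_power)
  obtain \<mu> e where e: "e \<noteq> 0" "normal_matrix \<L> \<nu> x *v e = \<mu> *\<^sub>R (\<G> x *v e)"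
      "\<And>w. (normal_matrix \<L> \<nu> x *v w) \<bullet> w \<le> \<mu> * ((\<G> x *v w) \<bullet> w)"
    using largest_generalized_eigenvalue[OF D G pos] by blast
  have "\<bar>\<mu>\<bar> \<in> E" using x \<nu> e by (auto simp: E_def)
  then have le: "\<bar>\<mu>\<bar> \<le> wave_speed \<Omega> \<L> \<G>" unfolding ws using bdd by (rule cSup_upper)
  then show "0 \<le> wave_speed \<Omega> \<L> \<G>" by linarith
  have "\<mu> * ((\<G> x *v w) \<bullet> w) \<le> wave_speed \<Omega> \<L> \<G> * ((\<G> x *v w) \<bullet> w)"
    using le pos[of w] by (cases "w = 0") (auto intro: mult_right_mono)
  then show "(normal_matrix \<L> \<nu> x *v w) \<bullet> w \<le> wave_speed \<Omega> \<L> \<G> * ((\<G> x *v w) \<bullet> w)"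
    using e(3)[of w] by linarith
qed

section \<open>A smooth bump function\<close>

text \<open>The family q(1/u) exp(-1/u), flat at 0. The polynomial is a parameter because
  differentiation stays within the family.\<close>

definition flat_exp :: "real poly \<Rightarrow> real \<Rightarrow> real"
  where "flat_exp q u = (if u \<le> 0 then 0 else poly q (1 / u) * exp (- (1 / u)))"

lemma poly_exp_tendsto_0: "((\<lambda>z::real. poly q z * exp (- z)) \<longlongrightarrow> 0) at_top"
proof -
  have "((\<lambda>z::real. \<Sum>i\<le>degree q. coeff q i * (z ^ i / exp z)) \<longlongrightarrow> (\<Sum>i\<le>degree q. coeff q i * 0)) at_top"
    by (intro tendsto_sum tendsto_mult tendsto_const tendsto_power_div_exp_0)
  moreover have "(\<lambda>z::real. \<Sum>i\<le>degree q. coeff q i * (z ^ i / exp z)) = (\<lambda>z. poly q z * exp (- z))"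
    by (simp add: fun_eq_iff poly_altdef sum_distrib_right exp_minus divide_inverse mult.assoc)
  ultimately show ?thesis by simp
qed

text \<open>With z = 1/u, d/du = - z^2 d/dz maps q(z) exp(-z) to z^2 (q - q')(z) exp(-z), and
  \<open>[:0, 0, 1:]\<close> is z^2. Only u = 0 needs a limit.\<close>

lemma flat_exp_deriv:
  "(flat_exp q has_real_derivative flat_exp ([:0, 0, 1:] * (q - pderiv q)) u) (at u)"
proof -
  consider "u < 0" | "u > 0" | "u = 0" by linarith
  then show ?thesis
  proof cases
    case 1
    have "((\<lambda>u. 0) has_real_derivative 0) (at u)" by simp
    moreover have "\<forall>\<^sub>F u in nhds u. 0 = flat_exp q u"
      using eventually_nhds_in_open[of "{..<0}" u] 1 by (auto elim!: eventually_mono simp: flat_exp_def)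
    ultimately show ?thesis using 1
      by (subst (asm) DERIV_cong_ev) (auto simp: flat_exp_def)
  next
    case 2
    have "((\<lambda>u. poly q (1 / u) * exp (- (1 / u))) has_real_derivative
       poly q (1 / u) * (exp (- (1 / u)) * (1 / u\<^sup>2)) + poly (pderiv q) (1/u) * (- (1 / u\<^sup>2)) * exp (- (1 / u))) (at u)"
      by (rule derivative_eq_intros DERIV_chain2[OF poly_DERIV] refl | use 2 in \<open>simp add: power2_eq_square field_simps; fail\<close>)+
    then have "((\<lambda>u. poly q (1 / u) * exp (- (1 / u))) has_real_derivative
       flat_exp ([:0, 0, 1:] * (q - pderiv q)) u) (at u)"
      by (rule DERIV_cong) (use 2 in \<open>simp add: flat_exp_def power2_eq_square field_simps\<close>)
    moreover have "\<forall>\<^sub>F u in nhds u. poly q (1 / u) * exp (- (1 / u)) = flat_exp q u"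
      using eventually_nhds_in_open[of "{0<..}" u] 2 by (auto elim!: eventually_mono simp: flat_exp_def)
    ultimately show ?thesis
      by (subst (asm) DERIV_cong_ev) auto
  next
    case 3
    \<comment> \<open>From the right the difference quotient at 0 is z q(z) exp(-z) with z = 1 / h;
      \<open>pCons 0 q\<close> is z q(z).\<close>
    have "((\<lambda>h. poly (pCons 0 q) (inverse h) * exp (- inverse h)) \<longlongrightarrow> 0) (at_right (0::real))"
      using filterlim_compose[OF poly_exp_tendsto_0 filterlim_inverse_at_top_right] .
    then have R: "((\<lambda>h. flat_exp q h / h) \<longlongrightarrow> 0) (at_right 0)"
      by (rule Lim_transform_eventually)
        (auto simp: eventually_at_filter flat_exp_def divide_simps intro!: always_eventually)
    have L: "((\<lambda>h. flat_exp q h / h) \<longlongrightarrow> 0) (at_left 0)"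
      by (rule Lim_transform_eventually[OF tendsto_const])
        (auto simp: eventually_at_filter flat_exp_def intro!: always_eventually)
    from L R have "((\<lambda>h. flat_exp q h / h) \<longlongrightarrow> 0) (at 0)" by (simp add: filterlim_at_split)
    then show ?thesis using 3 by (simp add: DERIV_def flat_exp_def)
  qed
qed

text \<open>A class containing the radial bump functions and closed under partial derivatives, so that its
  members are smooth.\<close>

inductive bump_class :: "real^'n \<Rightarrow> real \<Rightarrow> (real^'n \<Rightarrow> real) \<Rightarrow> bool" for p c where
  const: "bump_class p c (\<lambda>x. k)"
| coord: "bump_class p c (\<lambda>x. x $ i)"
| flat: "bump_class p c (\<lambda>x. flat_exp q (c - (norm (x - p))\<^sup>2))"
| add: "bump_class p c f \<Longrightarrow> bump_class p c g \<Longrightarrow> bump_class p c (\<lambda>x. f x + g x)"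
| mult: "bump_class p c f \<Longrightarrow> bump_class p c g \<Longrightarrow> bump_class p c (\<lambda>x. f x * g x)"

lemma flat_exp_radial_derivative:
  "((\<lambda>x::real^'n. flat_exp q (c - (norm (x - p))\<^sup>2)) has_derivative
     (\<lambda>v. flat_exp ([:0, 0, 1:] * (q - pderiv q)) (c - (norm (x - p))\<^sup>2) * (- 2 * ((x - p) \<bullet> v)))) (at x)"
proof -
  have "((\<lambda>x::real^'n. c - (norm (x - p))\<^sup>2) has_derivative (\<lambda>v. - 2 * ((x - p) \<bullet> v))) (at x)"
    unfolding power2_norm_eq_inner
    by (auto intro!: derivative_eq_intros simp: inner_commute)
  from has_derivative_compose[OF this flat_exp_deriv[THEN has_field_derivative_imp_has_derivative]]
  show ?thesis .
qed

lemma bump_class_derivative: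
  assumes "bump_class p c f"
  shows "\<exists>f'. (\<forall>x. (f has_derivative f' x) (at x)) \<and> (\<forall>j. bump_class p c (\<lambda>x. f' x (axis j 1)))"
  using assms
proof induction
  case (const k)
  show ?case by (intro exI[of _ "\<lambda>x v. 0"]) (auto intro: bump_class.const)
next
  case (coord i)
  show ?case
    by (intro exI[of _ "\<lambda>x v. v $ i"])
      (auto intro: bump_class.const bounded_linear.has_derivative[OF bounded_linear_vec_nth has_derivative_ident, simplified])
next
  case (flat q)
  have "bump_class p c (\<lambda>x. flat_exp ([:0, 0, 1:] * (q - pderiv q)) (c - (norm (x - p))\<^sup>2) *
      ((- 2) * (x $ j + (- p $ j))))" for j
    by (intro bump_class.intros)
  moreover have "flat_exp r y * ((- 2) * (x $ j + (- p $ j))) = flat_exp r y * (- 2 * ((x - p) \<bullet> axis j 1))" for r y x j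
    by (simp add: inner_axis)
  ultimately show ?case
    by (intro exI[of _ "\<lambda>x v. flat_exp ([:0, 0, 1:] * (q - pderiv q)) (c - (norm (x - p))\<^sup>2) * (- 2 * ((x - p) \<bullet> v))"])
      (simp only: flat_exp_radial_derivative simp_thms)
next
  case (add f g)
  then obtain f' g' where "\<And>x. (f has_derivative f' x) (at x)" "\<And>j. bump_class p c (\<lambda>x. f' x (axis j 1))"
    "\<And>x. (g has_derivative g' x) (at x)" "\<And>j. bump_class p c (\<lambda>x. g' x (axis j 1))" by blast
  then show ?case
    by (intro exI[of _ "\<lambda>x v. f' x v + g' x v"]) (auto intro: bump_class.intros has_derivative_add)
next
  case (mult f g)
  then obtain f' g' where "\<And>x. (f has_derivative f' x) (at x)" "\<And>j. bump_class p c (\<lambda>x. f' x (axis j 1))"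
    "\<And>x. (g has_derivative g' x) (at x)" "\<And>j. bump_class p c (\<lambda>x. g' x (axis j 1))" by blast
  with mult.hyps show ?case
    by (intro exI[of _ "\<lambda>x v. f x * g' x v + f' x v * g x"]) (auto intro!: bump_class.intros has_derivative_mult)
qed

lemma partial_deriv_eqI:
  "(f has_derivative f') (at x) \<Longrightarrow> partial_deriv j f x = f' (axis j 1)"
  by (simp add: partial_deriv_def frechet_derivative_at[symmetric])

lemma bump_class_smooth:
  assumes "bump_class p c f" shows "smooth f"
proof -
  have "bump_class p c (foldr partial_deriv js f)" for js
  proof (induction js)
    case (Cons j js)
    obtain f' where f': "\<And>x. (foldr partial_deriv js f has_derivative f' x) (at x)"
      "\<And>j. bump_class p c (\<lambda>x. f' x (axis j 1))" using bump_class_derivative[OF Cons] by blast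
    have "foldr partial_deriv (j # js) f = (\<lambda>x. f' x (axis j 1))"
      using partial_deriv_eqI[OF f'(1)] by (simp add: fun_eq_iff)
    with f'(2) show ?case by simp
  qed (use assms in simp)
  then show ?thesis unfolding smooth_def using bump_class_derivative differentiable_def by blast
qed

text \<open>The gradient of a radial function is a radial weight times x - p. For \<psi> =
  \<open>flat_exp 1\<close> of r^2 - |x - p|^2 the weight inside the ball is 2 z^2 exp(-z) in
  absolute value, with z the reciprocal of that argument. Its continuity, sign and symmetry are what
  the computation of moments relies on.\<close>

lemma radial_test_function:
  fixes p :: "real^'n"
  assumes r: "r > 0" and sub: "cball p r \<subseteq> \<Omega>"
  obtains \<psi> :: "real^'n \<Rightarrow> real" and w where "test_function \<Omega> \<psi>" "continuous_on UNIV w"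
    "\<And>x. 0 \<le> w x" "\<And>x. x \<in> ball p r \<Longrightarrow> 0 < w x" "\<And>x. x \<notin> ball p r \<Longrightarrow> w x = 0"
    "\<And>x y. norm (x - p) = norm (y - p) \<Longrightarrow> w x = w y"
    "\<And>j x. partial_deriv j \<psi> x = - w x * (x - p) $ j"
proof
  let ?q = "[:0, 0, 1:] * (1 - pderiv 1) :: real poly"
  let ?\<psi> = "\<lambda>x::real^'n. flat_exp 1 (r\<^sup>2 - (norm (x - p))\<^sup>2)"
  let ?w = "\<lambda>x::real^'n. 2 * flat_exp ?q (r\<^sup>2 - (norm (x - p))\<^sup>2)"
  have le: "r\<^sup>2 - (norm (x - p))\<^sup>2 \<le> 0 \<longleftrightarrow> x \<notin> ball p r" for x :: "real^'n"
  proof -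
    have "r \<le> norm (x - p) \<longleftrightarrow> r\<^sup>2 \<le> (norm (x - p))\<^sup>2"
      using r abs_le_square_iff[of r "norm (x - p)"] by simp
    then show ?thesis by (simp add: mem_ball dist_norm norm_minus_commute not_less)
  qed
  have vanish: "flat_exp q (r\<^sup>2 - (norm (x - p))\<^sup>2) = 0" if "x \<notin> ball p r" for q and x :: "real^'n"
    using le[of x] that unfolding flat_exp_def by (simp only: if_True simp_thms)
  show "test_function \<Omega> ?\<psi>"
    unfolding test_function_def
  proof (intro conjI exI allI impI)
    show "smooth ?\<psi>" by (intro bump_class_smooth[of p "r\<^sup>2"] bump_class.flat)
    show "compact (cball p r)" "cball p r \<subseteq> \<Omega>" using sub by auto
    show "?\<psi> x = 0" if "x \<notin> cball p r" for x
    proof (rule vanish)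
      show "x \<notin> ball p r" using that ball_subset_cball by blast
    qed
  qed
  have "continuous_on UNIV (flat_exp ?q)"
    by (rule DERIV_continuous_on, rule flat_exp_deriv)
  then show "continuous_on UNIV ?w"
    by (rule continuous_on_mult_left[OF continuous_on_compose2]) (intro continuous_intros, simp)
  have nonneg: "0 \<le> flat_exp ?q u" for u by (simp add: flat_exp_def)
  then show "0 \<le> ?w x" for x by simp
  have pos: "0 < flat_exp ?q u" if "\<not> u \<le> 0" for u using that by (simp add: flat_exp_def)
  show "0 < ?w x" if "x \<in> ball p r" for x
    using pos le[of x] that by (metis mult_pos_pos zero_less_numeral)
  show "?w x = 0" if "x \<notin> ball p r" for x using vanish[OF that] by simp
  show "?w x = ?w y" if "norm (x - p) = norm (y - p)" for x y using that by simp
  show "partial_deriv j ?\<psi> x = - ?w x * (x - p) $ j" for j x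
    by (subst partial_deriv_eqI[OF flat_exp_radial_derivative]) (simp add: inner_axis algebra_simps)
qed

section \<open>The measure on hyperplanes\<close>

lemma nn_integral_lborel_translate:
  fixes f :: "'a::euclidean_space \<Rightarrow> ennreal"
  assumes [measurable]: "f \<in> borel_measurable borel"
  shows "(\<integral>\<^sup>+x. f (x + c) \<partial>lborel) = (\<integral>\<^sup>+x. f x \<partial>lborel)"
proof -
  have "(\<integral>\<^sup>+x. f x \<partial>lborel) = (\<integral>\<^sup>+x. f x \<partial>distr lborel borel ((+) c))"
    by (simp add: lborel_distr_plus)
  also have "\<dots> = (\<integral>\<^sup>+x. f (c + x) \<partial>lborel)" by (subst nn_integral_distr) auto
  finally show ?thesis by (simp add: add.commute)
qed

text \<open>The roles of \<open>s\<close> and of the height \<open>u \<bullet> x\<close> are exchanged by three shears of the plane of these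
  two variables, each of which preserves the measure by translation invariance.\<close>

lemma nn_integral_disintegrate:
  fixes f :: "'a::euclidean_space \<Rightarrow> ennreal"
  assumes [measurable]: "f \<in> borel_measurable borel" and u: "norm u = 1"
  shows "(\<integral>\<^sup>+x. indicator {0..1} (u \<bullet> x) * (\<integral>\<^sup>+s. f (x - (u \<bullet> x) *\<^sub>R u + s *\<^sub>R u) \<partial>lborel) \<partial>lborel)
    = (\<integral>\<^sup>+x. f x \<partial>lborel)"
proof -
  have uu: "u \<bullet> u = 1" using u by (simp add: norm_eq_1)
  let ?I = "\<lambda>r::real. indicator {0..1} r :: ennreal"
  have "(\<integral>\<^sup>+x. ?I (u \<bullet> x) * (\<integral>\<^sup>+s. f (x - (u \<bullet> x) *\<^sub>R u + s *\<^sub>R u) \<partial>lborel) \<partial>lborel)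
    = (\<integral>\<^sup>+x. ?I (u \<bullet> x) * (\<integral>\<^sup>+s. f (x - (u \<bullet> x) *\<^sub>R u - s *\<^sub>R u) \<partial>lborel) \<partial>lborel)"
    by (subst nn_integral_real_affine[where c = "-1" and t = 0]) auto
  also have "\<dots> = (\<integral>\<^sup>+x. (\<integral>\<^sup>+s. ?I (u \<bullet> x) * f (x - (u \<bullet> x) *\<^sub>R u - s *\<^sub>R u) \<partial>lborel) \<partial>lborel)"
    by (intro nn_integral_cong nn_integral_cmult[symmetric]) measurable
  also have "\<dots> = (\<integral>\<^sup>+s. (\<integral>\<^sup>+x. ?I (u \<bullet> x) * f (x - (u \<bullet> x) *\<^sub>R u - s *\<^sub>R u) \<partial>lborel) \<partial>lborel)"
    by (rule lborel_pair.Fubini') measurable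
  also have "\<dots> = (\<integral>\<^sup>+s. (\<integral>\<^sup>+x. ?I (u \<bullet> x + s) * f (x - (u \<bullet> x) *\<^sub>R u - s *\<^sub>R u) \<partial>lborel) \<partial>lborel)"
  proof (rule nn_integral_cong)
    fix s
    show "(\<integral>\<^sup>+x. ?I (u \<bullet> x) * f (x - (u \<bullet> x) *\<^sub>R u - s *\<^sub>R u) \<partial>lborel)
        = (\<integral>\<^sup>+x. ?I (u \<bullet> x + s) * f (x - (u \<bullet> x) *\<^sub>R u - s *\<^sub>R u) \<partial>lborel)"
      using nn_integral_lborel_translate[of "\<lambda>x. ?I (u \<bullet> x) * f (x - (u \<bullet> x) *\<^sub>R u - s *\<^sub>R u)" "s *\<^sub>R u"]
      by (simp add: inner_add_right uu scaleR_add_left diff_diff_eq)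
  qed
  also have "\<dots> = (\<integral>\<^sup>+x. (\<integral>\<^sup>+s. ?I (u \<bullet> x + s) * f (x - (u \<bullet> x) *\<^sub>R u - s *\<^sub>R u) \<partial>lborel) \<partial>lborel)"
    by (rule lborel_pair.Fubini') measurable
  also have "\<dots> = (\<integral>\<^sup>+x. (\<integral>\<^sup>+s. ?I s * f (x - s *\<^sub>R u) \<partial>lborel) \<partial>lborel)"
  proof (rule nn_integral_cong)
    fix x
    show "(\<integral>\<^sup>+s. ?I (u \<bullet> x + s) * f (x - (u \<bullet> x) *\<^sub>R u - s *\<^sub>R u) \<partial>lborel)
        = (\<integral>\<^sup>+s. ?I s * f (x - s *\<^sub>R u) \<partial>lborel)"
      using nn_integral_lborel_translate[of "\<lambda>s. ?I s * f (x - s *\<^sub>R u)" "u \<bullet> x"]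
      by (simp add: algebra_simps scaleR_add_left)
  qed
  also have "\<dots> = (\<integral>\<^sup>+s. (\<integral>\<^sup>+x. ?I s * f (x - s *\<^sub>R u) \<partial>lborel) \<partial>lborel)"
    by (rule lborel_pair.Fubini') measurable
  also have "\<dots> = (\<integral>\<^sup>+s. (\<integral>\<^sup>+x. ?I s * f x \<partial>lborel) \<partial>lborel)"
  proof (rule nn_integral_cong)
    fix s
    show "(\<integral>\<^sup>+x. ?I s * f (x - s *\<^sub>R u) \<partial>lborel) = (\<integral>\<^sup>+x. ?I s * f x \<partial>lborel)"
      using nn_integral_lborel_translate[of "\<lambda>x. ?I s * f x" "- s *\<^sub>R u"] by simp
  qed
  also have "\<dots> = (\<integral>\<^sup>+s. ?I s * (\<integral>\<^sup>+x. f x \<partial>lborel) \<partial>lborel)"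
    by (intro nn_integral_cong nn_integral_cmult) measurable
  also have "\<dots> = (\<integral>\<^sup>+x. f x \<partial>lborel)"
    by (subst nn_integral_multc) auto
  finally show ?thesis .
qed

text \<open>The map keeps the foot y = x - (u . x) u and acts on the line over y by s -> \<alpha> s
  + g y, so after disintegration a one-dimensional substitution on each line suffices. Reflections,
  dilations along u and shears are the instances needed.\<close>

lemma nn_integral_move_along:
  fixes f :: "'a::euclidean_space \<Rightarrow> ennreal"
  assumes [measurable]: "f \<in> borel_measurable borel" "g \<in> borel_measurable borel"
    and u: "norm u = 1" and \<alpha>: "\<alpha> \<noteq> 0"
  shows "ennreal \<bar>\<alpha>\<bar> * (\<integral>\<^sup>+x. f (x + ((\<alpha> - 1) * (u \<bullet> x) + g (x - (u \<bullet> x) *\<^sub>R u)) *\<^sub>R u) \<partial>lborel)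
    = (\<integral>\<^sup>+x. f x \<partial>lborel)"
proof -
  have uu: "u \<bullet> u = 1" using u by (simp add: norm_eq_1)
  let ?I = "\<lambda>r::real. indicator {0..1} r :: ennreal"
  let ?F = "\<lambda>x. f (x + ((\<alpha> - 1) * (u \<bullet> x) + g (x - (u \<bullet> x) *\<^sub>R u)) *\<^sub>R u)"
  have "ennreal \<bar>\<alpha>\<bar> * (\<integral>\<^sup>+x. ?F x \<partial>lborel) =
    ennreal \<bar>\<alpha>\<bar> * (\<integral>\<^sup>+x. ?I (u \<bullet> x) * (\<integral>\<^sup>+s. ?F (x - (u \<bullet> x) *\<^sub>R u + s *\<^sub>R u) \<partial>lborel) \<partial>lborel)"
    by (subst nn_integral_disintegrate[OF _ u]) auto
  also have "\<dots> = (\<integral>\<^sup>+x. ?I (u \<bullet> x) * (ennreal \<bar>\<alpha>\<bar> * (\<integral>\<^sup>+s. ?F (x - (u \<bullet> x) *\<^sub>R u + s *\<^sub>R u) \<partial>lborel)) \<partial>lborel)"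
    by (subst nn_integral_cmult[symmetric]) (auto simp: mult_ac)
  also have "\<dots> = (\<integral>\<^sup>+x. ?I (u \<bullet> x) * (\<integral>\<^sup>+s. f (x - (u \<bullet> x) *\<^sub>R u + s *\<^sub>R u) \<partial>lborel) \<partial>lborel)"
  proof (intro nn_integral_cong arg_cong2[of _ _ _ _ "(*)"] refl)
    fix x
    let ?y = "x - (u \<bullet> x) *\<^sub>R u"
    have "?F (?y + s *\<^sub>R u) = f (?y + (g ?y + \<alpha> * s) *\<^sub>R u)" for s
    proof -
      have h: "u \<bullet> (?y + s *\<^sub>R u) = s" by (simp add: inner_add_right inner_diff_right uu)
      have "?y + s *\<^sub>R u + ((\<alpha> - 1) * s + g ?y) *\<^sub>R u = ?y + (g ?y + \<alpha> * s) *\<^sub>R u"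
        by (simp add: scaleR_add_left scaleR_diff_left left_diff_distrib)
      then show ?thesis by (simp only: h add_diff_cancel_right')
    qed
    then show "ennreal \<bar>\<alpha>\<bar> * (\<integral>\<^sup>+s. ?F (?y + s *\<^sub>R u) \<partial>lborel) = (\<integral>\<^sup>+s. f (?y + s *\<^sub>R u) \<partial>lborel)"
      by (subst (2) nn_integral_real_affine[where c = \<alpha> and t = "g ?y"]) (auto simp: \<alpha>)
  qed
  also have "\<dots> = (\<integral>\<^sup>+x. f x \<partial>lborel)" by (rule nn_integral_disintegrate) (auto simp: u)
  finally show ?thesis .
qed

lemma sets_hyperplane_measure [simp, measurable_cong]: "sets (hyperplane_measure \<nu> p) = sets borel"
  by (simp add: hyperplane_measure_def)

lemma space_hyperplane_measure [simp]: "space (hyperplane_measure \<nu> p) = UNIV"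
  by (simp add: hyperplane_measure_def)

lemma nn_integral_hyperplane_measure:
  fixes f :: "real^'n \<Rightarrow> ennreal"
  assumes [measurable]: "f \<in> borel_measurable borel"
  shows "(\<integral>\<^sup>+x. f x \<partial>hyperplane_measure \<nu> p) =
    (\<integral>\<^sup>+x. indicator {0..1} (\<nu> \<bullet> (x - p)) * f (x - (\<nu> \<bullet> (x - p)) *\<^sub>R \<nu>) \<partial>lborel)"
proof -
  have "(\<integral>\<^sup>+x. f x \<partial>hyperplane_measure \<nu> p) =
    (\<integral>\<^sup>+x. f (x - (\<nu> \<bullet> (x - p)) *\<^sub>R \<nu>) \<partial>restrict_space lborel {x. 0 \<le> \<nu> \<bullet> (x - p) \<and> \<nu> \<bullet> (x - p) \<le> 1})"
    unfolding hyperplane_measure_def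
    by (subst nn_integral_distr) (auto intro!: measurable_restrict_space1)
  also have "\<dots> = (\<integral>\<^sup>+x. f (x - (\<nu> \<bullet> (x - p)) *\<^sub>R \<nu>) * indicator {x. 0 \<le> \<nu> \<bullet> (x - p) \<and> \<nu> \<bullet> (x - p) \<le> 1} x \<partial>lborel)"
    by (subst nn_integral_restrict_space) auto
  also have "\<dots> = (\<integral>\<^sup>+x. indicator {0..1} (\<nu> \<bullet> (x - p)) * f (x - (\<nu> \<bullet> (x - p)) *\<^sub>R \<nu>) \<partial>lborel)"
    by (intro nn_integral_cong) (auto simp: indicator_def)
  finally show ?thesis .
qed

text \<open>Cavalieri's principle: over a foot y in F the set is a segment of length f y, or empty
  if f y < 0, where \<open>ennreal\<close> also gives 0. This converts facet integrals into volumes,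
  which affine maps can compare.\<close>

lemma hyperplane_measure_subgraph:
  fixes f :: "real^'n \<Rightarrow> real"
  assumes [measurable]: "f \<in> borel_measurable borel" "F \<in> sets borel" and \<nu>: "norm \<nu> = 1"
  shows "(\<integral>\<^sup>+x\<in>F. ennreal (f x) \<partial>hyperplane_measure \<nu> p) =
    emeasure lborel {x. x - (\<nu> \<bullet> (x - p)) *\<^sub>R \<nu> \<in> F \<and>
      0 \<le> \<nu> \<bullet> (x - p) \<and> \<nu> \<bullet> (x - p) \<le> f (x - (\<nu> \<bullet> (x - p)) *\<^sub>R \<nu>)}"
proof -
  have nn: "\<nu> \<bullet> \<nu> = 1" using \<nu> by (simp add: norm_eq_1)
  let ?G = "{x. x - (\<nu> \<bullet> (x - p)) *\<^sub>R \<nu> \<in> F \<and>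
      0 \<le> \<nu> \<bullet> (x - p) \<and> \<nu> \<bullet> (x - p) \<le> f (x - (\<nu> \<bullet> (x - p)) *\<^sub>R \<nu>)}"
  have [measurable]: "?G \<in> sets borel" by measurable
  have "emeasure lborel ?G = (\<integral>\<^sup>+x. indicator ?G x \<partial>lborel)" by simp
  also have "\<dots> = (\<integral>\<^sup>+x. indicator ?G (x + p) \<partial>lborel)"
    by (rule nn_integral_lborel_translate[symmetric]) measurable
  also have "\<dots> = (\<integral>\<^sup>+x. indicator {0..1} (\<nu> \<bullet> x) * (\<integral>\<^sup>+s. indicator ?G (x - (\<nu> \<bullet> x) *\<^sub>R \<nu> + s *\<^sub>R \<nu> + p) \<partial>lborel) \<partial>lborel)"
    by (rule nn_integral_disintegrate[symmetric]) (auto simp: \<nu>)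
  also have "\<dots> = (\<integral>\<^sup>+x. indicator {0..1} (\<nu> \<bullet> x) * (ennreal (f (x - (\<nu> \<bullet> x) *\<^sub>R \<nu> + p)) * indicator F (x - (\<nu> \<bullet> x) *\<^sub>R \<nu> + p)) \<partial>lborel)"
  proof (intro nn_integral_cong arg_cong2[of _ _ _ _ "(*)"] refl)
    fix x
    let ?y = "x - (\<nu> \<bullet> x) *\<^sub>R \<nu> + p"
    have eq: "x - (\<nu> \<bullet> x) *\<^sub>R \<nu> + s *\<^sub>R \<nu> + p \<in> ?G \<longleftrightarrow> ?y \<in> F \<and> s \<in> {0..f ?y}" for s
    proof -
      have "\<nu> \<bullet> (x - (\<nu> \<bullet> x) *\<^sub>R \<nu> + s *\<^sub>R \<nu> + p - p) = s" by (simp add: inner_add_right inner_diff_right nn)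
      moreover have "x - (\<nu> \<bullet> x) *\<^sub>R \<nu> + s *\<^sub>R \<nu> + p - s *\<^sub>R \<nu> = ?y" by simp
      ultimately show ?thesis unfolding mem_Collect_eq by (simp only: atLeastAtMost_iff)
    qed
    have "(\<integral>\<^sup>+s. indicator ?G (x - (\<nu> \<bullet> x) *\<^sub>R \<nu> + s *\<^sub>R \<nu> + p) \<partial>lborel) = (\<integral>\<^sup>+s. indicator F ?y * indicator {0..f ?y} s \<partial>lborel)"
      by (intro nn_integral_cong) (simp only: indicator_def eq, simp)
    also have "\<dots> = indicator F ?y * ennreal (f ?y)"
      by (subst nn_integral_cmult) (auto simp: ennreal_neg not_le emeasure_lborel_Icc_eq)
    finally show "(\<integral>\<^sup>+s. indicator ?G (x - (\<nu> \<bullet> x) *\<^sub>R \<nu> + s *\<^sub>R \<nu> + p) \<partial>lborel) = ennreal (f ?y) * indicator F ?y"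
      by (simp add: mult.commute)
  qed
  also have "\<dots> = (\<integral>\<^sup>+x. indicator {0..1} (\<nu> \<bullet> (x - p)) * (ennreal (f (x - (\<nu> \<bullet> (x - p)) *\<^sub>R \<nu>)) * indicator F (x - (\<nu> \<bullet> (x - p)) *\<^sub>R \<nu>)) \<partial>lborel)"
    by (subst nn_integral_lborel_translate[symmetric, where c = "-p"]) (auto simp: algebra_simps)
  also have "\<dots> = (\<integral>\<^sup>+x\<in>F. ennreal (f x) \<partial>hyperplane_measure \<nu> p)"
    by (rule nn_integral_hyperplane_measure[symmetric]) measurable
  finally show ?thesis by simp
qed

text \<open>The unit slabs on the two sides of the hyperplane are translates of each other by \<nu>.
  Hence the two elements at a facet integrate against the same measure.\<close>

lemma hyperplane_measure_uminus:
  assumes \<nu>: "norm \<nu> = 1"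
  shows "hyperplane_measure (- \<nu>) p = hyperplane_measure \<nu> p"
proof (rule measure_eqI)
  fix A :: "(real^'a) set" assume "A \<in> sets (hyperplane_measure (- \<nu>) p)"
  then have A[measurable]: "A \<in> sets borel" by simp
  have nn: "\<nu> \<bullet> \<nu> = 1" using \<nu> by (simp add: norm_eq_1)
  have "emeasure (hyperplane_measure \<nu> p) A = (\<integral>\<^sup>+x. indicator A x \<partial>hyperplane_measure \<nu> p)" by simp
  also have "\<dots> = (\<integral>\<^sup>+x. indicator {0..1} (\<nu> \<bullet> (x - p)) * indicator A (x - (\<nu> \<bullet> (x - p)) *\<^sub>R \<nu>) \<partial>lborel)"
    by (rule nn_integral_hyperplane_measure) measurable
  also have "\<dots> = (\<integral>\<^sup>+x. indicator {0..1} (\<nu> \<bullet> (x + \<nu> - p)) * indicator A (x + \<nu> - (\<nu> \<bullet> (x + \<nu> - p)) *\<^sub>R \<nu>) \<partial>lborel)"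
    by (rule nn_integral_lborel_translate[symmetric]) measurable
  also have "\<dots> = (\<integral>\<^sup>+x. indicator {0..1} ((-\<nu>) \<bullet> (x - p)) * indicator A (x - ((-\<nu>) \<bullet> (x - p)) *\<^sub>R (-\<nu>)) \<partial>lborel)"
    by (intro nn_integral_cong) (auto simp: inner_add_right inner_diff_right nn algebra_simps indicator_def)
  also have "\<dots> = (\<integral>\<^sup>+x. indicator A x \<partial>hyperplane_measure (-\<nu>) p)"
    by (rule nn_integral_hyperplane_measure[symmetric]) measurable
  finally show "emeasure (hyperplane_measure (- \<nu>) p) A = emeasure (hyperplane_measure \<nu> p) A" by simp
qed simp

lemma emeasure_hyperplane_measure_finite:
  fixes F :: "(real^'n) set"
  assumes "bounded F" and [measurable]: "F \<in> sets borel"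
  shows "emeasure (hyperplane_measure \<nu> p) F < \<infinity>"
proof -
  obtain c where c: "\<And>x. x \<in> F \<Longrightarrow> norm x \<le> c" using assms(1) bounded_iff by blast
  have "emeasure (hyperplane_measure \<nu> p) F = (\<integral>\<^sup>+x. indicator F x \<partial>hyperplane_measure \<nu> p)" by simp
  also have "\<dots> = (\<integral>\<^sup>+x. indicator {0..1} (\<nu> \<bullet> (x - p)) * indicator F (x - (\<nu> \<bullet> (x - p)) *\<^sub>R \<nu>) \<partial>lborel)"
    by (rule nn_integral_hyperplane_measure) measurable
  also have "\<dots> \<le> (\<integral>\<^sup>+x. indicator (cball (0::real^'n) (c + norm \<nu>)) x \<partial>lborel)"
  proof (intro nn_integral_mono)
    fix x
    have "norm x \<le> c + norm \<nu>" if h: "0 \<le> \<nu> \<bullet> (x - p)" "\<nu> \<bullet> (x - p) \<le> 1" "x - (\<nu> \<bullet> (x - p)) *\<^sub>R \<nu> \<in> F"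
    proof -
      have "norm x \<le> norm (x - (\<nu> \<bullet> (x - p)) *\<^sub>R \<nu>) + norm ((\<nu> \<bullet> (x - p)) *\<^sub>R \<nu>)"
        using norm_triangle_ineq[of "x - (\<nu> \<bullet> (x - p)) *\<^sub>R \<nu>" "(\<nu> \<bullet> (x - p)) *\<^sub>R \<nu>"] by simp
      also have "norm ((\<nu> \<bullet> (x - p)) *\<^sub>R \<nu>) \<le> norm \<nu>" using h by (simp add: mult_left_le_one_le)
      finally show ?thesis using c[OF h(3)] by linarith
    qed
    then show "indicator {0..1} (\<nu> \<bullet> (x - p)) * indicator F (x - (\<nu> \<bullet> (x - p)) *\<^sub>R \<nu>)
        \<le> (indicator (cball 0 (c + norm \<nu>)) x :: ennreal)"
      by (auto simp: indicator_def)
  qed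
  also have "\<dots> < \<infinity>" using emeasure_bounded_finite[OF bounded_cball] by simp
  finally show ?thesis .
qed

section \<open>Continuity of the normal component\<close>

lemma lborel_reflect:
  fixes u :: "'a::euclidean_space"
  assumes u: "norm u = 1"
  shows "distr lborel borel (\<lambda>x. x - (2 * (u \<bullet> x)) *\<^sub>R u) = lborel"
proof (rule measure_eqI)
  fix A assume "A \<in> sets (distr lborel borel (\<lambda>x. x - (2 * (u \<bullet> x)) *\<^sub>R u))"
  then have A[measurable]: "A \<in> sets borel" by simp
  have "emeasure (distr lborel borel (\<lambda>x. x - (2 * (u \<bullet> x)) *\<^sub>R u)) A
      = (\<integral>\<^sup>+x. indicator A x \<partial>distr lborel borel (\<lambda>x. x - (2 * (u \<bullet> x)) *\<^sub>R u))" by simp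
  also have "\<dots> = (\<integral>\<^sup>+x. indicator A (x - (2 * (u \<bullet> x)) *\<^sub>R u) \<partial>lborel)"
    by (rule nn_integral_distr) measurable
  also have "\<dots> = (\<integral>\<^sup>+x. indicator A x \<partial>lborel)"
    using nn_integral_move_along[of "indicator A" "\<lambda>x. 0" u "-1"] u by simp
  finally show "emeasure (distr lborel borel (\<lambda>x. x - (2 * (u \<bullet> x)) *\<^sub>R u)) A = emeasure lborel A" by simp
qed simp

text \<open>The component along u of the first moment of W over one half space. The gradient of a
  radial bump is a weight times the position, so this is what a test function sees on one side of a
  facet.\<close>

definition half_moment :: "('a::euclidean_space \<Rightarrow> real) \<Rightarrow> 'a \<Rightarrow> 'a \<Rightarrow> real"
  where "half_moment W \<nu> u = (LINT y|lborel. indicator {y. \<nu> \<bullet> y < 0} y * W y * (y \<bullet> u))"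

context
  fixes W :: "'a::euclidean_space \<Rightarrow> real" and r :: real
  assumes W_cont: "continuous_on UNIV W" and W_nonneg: "\<And>y. 0 \<le> W y"
    and W_pos: "\<And>y. y \<in> ball 0 r \<Longrightarrow> 0 < W y" and W_zero: "\<And>y. y \<notin> ball 0 r \<Longrightarrow> W y = 0"
    and W_radial: "\<And>x y. norm x = norm y \<Longrightarrow> W x = W y" and r: "r > 0"
begin

lemma integrable_half_moment: "integrable lborel (\<lambda>y. indicator {y. \<nu> \<bullet> y < 0} y * W y * (y \<bullet> u))"
proof -
  have "integrable lborel (\<lambda>y. indicator (cball 0 r) y *\<^sub>R (W y * (y \<bullet> u)))"
    by (intro borel_integrable_compact continuous_intros continuous_on_subset[OF W_cont]) auto
  then have "integrable lborel (\<lambda>y. indicator {y. \<nu> \<bullet> y < 0} y *\<^sub>R (indicator (cball 0 r) y *\<^sub>R (W y * (y \<bullet> u))))"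
    by (rule integrable_mult_indicator[rotated]) measurable
  moreover have "indicator {y. \<nu> \<bullet> y < 0} y *\<^sub>R (indicator (cball 0 r) y *\<^sub>R (W y * (y \<bullet> u)))
      = indicator {y. \<nu> \<bullet> y < 0} y * W y * (y \<bullet> u)" for y
    using W_zero[of y] by (cases "y \<in> ball 0 r") (auto simp: indicator_def)
  ultimately show ?thesis by (simp only:)
qed

text \<open>Reflections are isometric, selfadjoint and measure preserving, and W is radial, so the
  reflection passes from the variable of integration to \<nu> and v.\<close>

lemma half_moment_reflect:
  assumes u: "norm u = 1"
  shows "half_moment W \<nu> v = half_moment W (\<nu> - (2 * (u \<bullet> \<nu>)) *\<^sub>R u) (v - (2 * (u \<bullet> v)) *\<^sub>R u)"
proof -
  have uu: "u \<bullet> u = 1" using u by (simp add: norm_eq_1)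
  let ?R = "\<lambda>x. x - (2 * (u \<bullet> x)) *\<^sub>R u"
  have [measurable]: "W \<in> borel_measurable borel"
    using W_cont by (rule borel_measurable_continuous_onI)
  have in1: "\<nu> \<bullet> ?R x = ?R \<nu> \<bullet> x" for x \<nu>
    by (simp add: inner_diff_left inner_diff_right inner_commute)
  have "norm (?R x) = norm x" for x
  proof -
    have "?R x \<bullet> ?R x = x \<bullet> x" using uu
      by (simp add: inner_diff_left inner_diff_right inner_commute algebra_simps)
    then show ?thesis by (simp add: norm_eq_sqrt_inner)
  qed
  then have WR: "W (?R x) = W x" for x by (rule W_radial)
  have "half_moment W \<nu> v = (LINT y|distr lborel borel ?R. indicator {y. \<nu> \<bullet> y < 0} y * W y * (y \<bullet> v))"
    by (simp only: lborel_reflect[OF u] half_moment_def)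
  also have "\<dots> = (LINT y|lborel. indicator {y. \<nu> \<bullet> y < 0} (?R y) * W (?R y) * (?R y \<bullet> v))"
    by (rule integral_distr) measurable
  also have "\<dots> = half_moment W (?R \<nu>) (?R v)"
    unfolding half_moment_def
  proof (rule Bochner_Integration.integral_cong[OF refl])
    fix y
    have "indicator {y. \<nu> \<bullet> y < 0} (?R y) = (indicator {y. ?R \<nu> \<bullet> y < 0} y :: real)"
      unfolding indicator_def mem_Collect_eq in1 ..
    moreover have "?R y \<bullet> v = y \<bullet> ?R v" using in1[of v y] by (simp only: inner_commute)
    ultimately show "indicator {y. \<nu> \<bullet> y < 0} (?R y) * W (?R y) * (?R y \<bullet> v)
      = indicator {y. ?R \<nu> \<bullet> y < 0} y * W y * (y \<bullet> ?R v)" by (simp only: WR)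
  qed
  finally show ?thesis .
qed

lemma half_moment_linear:
  "half_moment W \<nu> (a *\<^sub>R u + b *\<^sub>R v) = a * half_moment W \<nu> u + b * half_moment W \<nu> v"
proof -
  have "half_moment W \<nu> (a *\<^sub>R u + b *\<^sub>R v) = (LINT y|lborel. a * (indicator {y. \<nu> \<bullet> y < 0} y * W y * (y \<bullet> u)) +
      b * (indicator {y. \<nu> \<bullet> y < 0} y * W y * (y \<bullet> v)))"
    unfolding half_moment_def by (intro Bochner_Integration.integral_cong) (auto simp: inner_add_right algebra_simps)
  then show ?thesis
    unfolding half_moment_def using integrable_half_moment[of \<nu> u] integrable_half_moment[of \<nu> v]
    by simp
qed

text \<open>Reflecting in a direction e orthogonal to \<nu> keeps the half space and sends e to - e,
  so the tangential moments vanish.\<close>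

lemma half_moment_eq:
  assumes \<nu>: "norm \<nu> = 1"
  shows "half_moment W \<nu> u = (\<nu> \<bullet> u) * half_moment W \<nu> \<nu>"
proof -
  have nn: "\<nu> \<bullet> \<nu> = 1" using \<nu> by (simp add: norm_eq_1)
  define t where "t = u - (\<nu> \<bullet> u) *\<^sub>R \<nu>"
  have orth: "t \<bullet> \<nu> = 0" by (simp add: t_def inner_diff_left nn inner_commute[of u])
  have "half_moment W \<nu> t = 0"
  proof (cases "t = 0")
    case True
    then show ?thesis by (simp add: half_moment_def)
  next
    case False
    define e where "e = t /\<^sub>R norm t"
    have e: "norm e = 1" "e \<bullet> \<nu> = 0" using False orth by (auto simp: e_def)
    have "e \<bullet> e = 1" using e by (simp add: norm_eq_1)
    then have "half_moment W \<nu> e = half_moment W \<nu> (- 1 *\<^sub>R e + 0 *\<^sub>R e)"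
      using half_moment_reflect[OF e(1), of \<nu> e] e(2) by (simp add: scaleR_2)
    then have "half_moment W \<nu> e = 0" unfolding half_moment_linear by simp
    moreover have "t = norm t *\<^sub>R e + 0 *\<^sub>R e" using False by (simp add: e_def)
    ultimately show ?thesis by (metis half_moment_linear mult_zero_right add_0)
  qed
  moreover have "u = (\<nu> \<bullet> u) *\<^sub>R \<nu> + 1 *\<^sub>R t" by (simp add: t_def)
  ultimately show ?thesis by (metis half_moment_linear mult_zero_right add_0_right)
qed

lemma half_moment_uminus:
  assumes \<nu>: "norm \<nu> = 1"
  shows "half_moment W (- \<nu>) u = - half_moment W \<nu> u"
proof -
  have nn: "\<nu> \<bullet> \<nu> = 1" using \<nu> by (simp add: norm_eq_1)
  have "half_moment W \<nu> \<nu> = half_moment W (- \<nu>) (- \<nu>)"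
    using half_moment_reflect[OF \<nu>, of \<nu> \<nu>] nn by (simp add: scaleR_2)
  then show ?thesis using half_moment_eq[of \<nu> u] half_moment_eq[of "- \<nu>" u] \<nu> by simp
qed

text \<open>The negated integrand is nonnegative, and positive on an open half ball; a zero integral
  would make a nonempty open set negligible.\<close>

lemma half_moment_neg:
  assumes \<nu>: "norm \<nu> = 1"
  shows "half_moment W \<nu> \<nu> < 0"
proof -
  have nn: "\<nu> \<bullet> \<nu> = 1" using \<nu> by (simp add: norm_eq_1)
  let ?f = "\<lambda>y. - (indicator {y. \<nu> \<bullet> y < 0} y * W y * (y \<bullet> \<nu>))"
  have int: "integrable lborel ?f" using integrable_half_moment by simp
  have nonneg: "0 \<le> ?f y" for y
    using W_nonneg[of y] by (auto simp: indicator_def inner_commute mult_nonneg_nonpos)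
  have "integral\<^sup>L lborel ?f \<noteq> 0"
  proof
    assume "integral\<^sup>L lborel ?f = 0"
    then have "AE y in lborel. ?f y = 0"
      using integral_nonneg_eq_0_iff_AE[OF int] nonneg by auto
    then have "AE y in lebesgue. ?f y = 0" by (rule AE_completion)
    moreover have "?f y \<noteq> 0" if "y \<in> ball 0 r \<inter> {y. \<nu> \<bullet> y < 0}" for y
      using W_pos[of y] that by (auto simp: indicator_def inner_commute)
    ultimately have "AE y in lebesgue. y \<notin> ball 0 r \<inter> {y. \<nu> \<bullet> y < 0}"
      by (auto elim!: eventually_mono)
    then have "negligible (ball 0 r \<inter> {y. \<nu> \<bullet> y < 0})"
      by (simp add: negligible_iff_null_sets AE_iff_null_sets lmeasurable_open)
    moreover have "open (ball 0 r \<inter> {y. \<nu> \<bullet> y < 0})"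
      by (intro open_Int open_ball open_halfspace_lt)
    moreover have "- (r / 2) *\<^sub>R \<nu> \<in> ball 0 r \<inter> {y. \<nu> \<bullet> y < 0}"
      using r \<nu> nn by (simp add: dist_norm)
    ultimately show False using open_not_negligible by blast
  qed
  moreover have "0 \<le> integral\<^sup>L lborel ?f" using nonneg by (intro integral_nonneg_AE) auto
  ultimately show ?thesis by (simp add: half_moment_def)
qed

end

text \<open>Completeness of the Lebesgue measure. On the hyperplane of a facet nothing is known
  about \<L>, so measurability of the tested integrand has to come from its values off a negligible
  set.\<close>

lemma borel_measurable_lebesgue_AE_negligible:
  fixes f g :: "'a::euclidean_space \<Rightarrow> 'b::topological_space"
  assumes g: "g \<in> borel_measurable lebesgue" and N: "negligible N" and eq: "\<And>x. x \<notin> N \<Longrightarrow> f x = g x"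
  shows "f \<in> borel_measurable lebesgue"
proof (rule measurableI)
  fix A :: "'b set" assume A: "A \<in> sets borel"
  have "f -` A \<inter> space lebesgue = (g -` A \<inter> space lebesgue - N) \<union> (f -` A \<inter> N)"
    using eq by auto
  moreover have "g -` A \<inter> space lebesgue \<in> sets lebesgue" using g A by (rule measurable_sets)
  moreover have "N \<in> sets lebesgue" "f -` A \<inter> N \<in> sets lebesgue"
    using N negligible_subset[OF N] by (auto intro: negligible_imp_sets)
  ultimately show "f -` A \<inter> space lebesgue \<in> sets lebesgue" unfolding \<open>f -` A \<inter> space lebesgue = _\<close> by (intro sets.Un sets.Diff)
qed simp

text \<open>The moments of a radial weight over the two half balls are \<open>\<plusminus>k \<nu>\<close> with \<open>k \<noteq> 0\<close>, so testing the
  divergence constraint with a radial bump function isolates the jump of the normal component.\<close>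

lemma normal_component_continuous:
  fixes \<L> :: "'n::finite \<Rightarrow> real^'n \<Rightarrow> real^'l^'l" and A A' :: "'n \<Rightarrow> real^'l^'l"
  assumes adm: "admissible_coefficients \<Omega> \<L> \<G>"
    and r: "r > 0" and sub: "cball p r \<subseteq> \<Omega>" and \<nu>: "norm \<nu> = 1"
    and A: "\<And>j x. x \<in> ball p r \<Longrightarrow> \<nu> \<bullet> (x - p) < 0 \<Longrightarrow> \<L> j x = A j"
    and A': "\<And>j x. x \<in> ball p r \<Longrightarrow> \<nu> \<bullet> (x - p) > 0 \<Longrightarrow> \<L> j x = A' j"
  shows "(\<Sum>j\<in>UNIV. (\<nu> $ j) *\<^sub>R A j) = (\<Sum>j\<in>UNIV. (\<nu> $ j) *\<^sub>R A' j)"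
proof -
  obtain \<psi> w where test: "test_function \<Omega> \<psi>" and cont: "continuous_on UNIV w"
    and w: "\<And>x. 0 \<le> w x" "\<And>x. x \<in> ball p r \<Longrightarrow> 0 < w x" "\<And>x. x \<notin> ball p r \<Longrightarrow> w x = 0"
    "\<And>x y. norm (x - p) = norm (y - p) \<Longrightarrow> w x = w y"
    and d: "\<And>j x. partial_deriv j \<psi> x = - w x * (x - p) $ j"
    by (rule radial_test_function[OF r sub]) blast
  define W where "W y = w (p + y)" for y
  have W: "continuous_on UNIV W" "\<And>y. 0 \<le> W y" "\<And>y. y \<in> ball 0 r \<Longrightarrow> 0 < W y"
      "\<And>y. y \<notin> ball 0 r \<Longrightarrow> W y = 0" "\<And>x y. norm x = norm y \<Longrightarrow> W x = W y"
    unfolding W_def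
    by (auto intro!: w continuous_intros continuous_on_compose2[OF cont] simp: dist_norm)
  have int: "integrable lborel (\<lambda>y. indicator {y. \<eta> \<bullet> y < 0} y * W y * (y \<bullet> u))" for \<eta> u
    by (rule integrable_half_moment[of W r]) (assumption | rule W r \<nu>)+
  have hm: "half_moment W \<nu> u = (\<nu> \<bullet> u) * half_moment W \<nu> \<nu>" for u
    by (rule half_moment_eq[of W r]) (assumption | rule W r \<nu>)+
  have hm_minus: "half_moment W (- \<nu>) u = - half_moment W \<nu> u" for u
    by (rule half_moment_uminus[of W r]) (assumption | rule W r \<nu>)+
  define k where "k = half_moment W \<nu> \<nu>"
  have k: "k < 0" unfolding k_def by (rule half_moment_neg[of W r]) (assumption | rule W r \<nu>)+
  define H where "H \<eta> j x = indicator {y. \<eta> \<bullet> y < 0} (x - p) * W (x - p) * ((x - p) \<bullet> axis j 1)" for \<eta> j x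
  have H: "has_bochner_integral lborel (H \<eta> j) (half_moment W \<eta> (axis j 1))" for \<eta> j
  proof -
    have [measurable]: "W \<in> borel_measurable borel" using W(1) by (rule borel_measurable_continuous_onI)
    let ?f = "\<lambda>y. indicator {y. \<eta> \<bullet> y < 0} y * W y * (y \<bullet> axis j 1)"
    have "has_bochner_integral (distr lborel borel ((+) (-p))) ?f (half_moment W \<eta> (axis j 1))"
      unfolding lborel_distr_plus half_moment_def
      by (intro has_bochner_integral_integrable int)
    then have "has_bochner_integral lborel (\<lambda>x. ?f (- p + x)) (half_moment W \<eta> (axis j 1))"
      by (subst (asm) has_bochner_integral_iff, subst (asm) integrable_distr_eq, simp, measurable,
          subst (asm) integral_distr, simp, measurable) (simp add: has_bochner_integral_iff)
    then show ?thesis by (simp add: H_def[abs_def])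
  qed
  \<comment> \<open>Off the hyperplane \<open>\<L> j\<close> is \<open>A j\<close> or
    \<open>A' j\<close> wherever the weight is positive. The minus signs stem from grad \<psi> = - w
    (x - p); the second half ball lies in the half space of - \<nu>, whose moment has the opposite
    sign.\<close>
  have int: "(LINT x:\<Omega>|lebesgue. partial_deriv j \<psi> x *\<^sub>R \<L> j x) = (k * \<nu> $ j) *\<^sub>R (A' j - A j)" for j
  proof -
    let ?f = "\<lambda>x. indicator \<Omega> x *\<^sub>R (partial_deriv j \<psi> x *\<^sub>R \<L> j x)"
    let ?g = "\<lambda>x. (- H \<nu> j x) *\<^sub>R A j + (- H (- \<nu>) j x) *\<^sub>R A' j"
    let ?N = "{x. \<nu> \<bullet> x = \<nu> \<bullet> p}"
    have N: "negligible ?N" using \<nu> by (intro negligible_hyperplane) auto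
    have eq: "?f x = ?g x" if "x \<notin> ?N" for x
    proof (cases "x \<in> ball p r")
      case True
      then have "x \<in> \<Omega>" using sub ball_subset_cball by blast
      with that True A[of x j] A'[of x j] show ?thesis
        by (cases "\<nu> \<bullet> (x - p) < 0")
          (auto simp: H_def W_def d inner_axis inner_diff_right)
    next
      case False
      then show ?thesis by (simp add: d H_def W_def w(3))
    qed
    have g: "has_bochner_integral lborel ?g ((- half_moment W \<nu> (axis j 1)) *\<^sub>R A j + (- half_moment W (- \<nu>) (axis j 1)) *\<^sub>R A' j)"
      by (intro has_bochner_integral_add has_bochner_integral_scaleR_left has_bochner_integral_minus H)
    have gm: "?g \<in> borel_measurable lborel" using g by (rule borel_measurable_has_bochner_integral)
    have "integral\<^sup>L lebesgue ?f = integral\<^sup>L lebesgue ?g"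
    proof (rule integral_cong_AE)
      show "?g \<in> borel_measurable lebesgue" using gm by (rule measurable_completion)
      then show "?f \<in> borel_measurable lebesgue"
        by (rule borel_measurable_lebesgue_AE_negligible[OF _ N eq])
      show "AE x in lebesgue. ?f x = ?g x"
        using N eq by (intro AE_I'[of ?N]) (auto simp: negligible_iff_null_sets)
    qed
    also have "\<dots> = integral\<^sup>L lborel ?g" using gm by (rule integral_completion)
    also have "\<dots> = (- half_moment W \<nu> (axis j 1)) *\<^sub>R A j + (- half_moment W (- \<nu>) (axis j 1)) *\<^sub>R A' j"
      using g by (simp add: has_bochner_integral_iff)
    also have "\<dots> = (k * \<nu> $ j) *\<^sub>R (A' j - A j)"
      using hm[of "axis j 1"] hm_minus[of "axis j 1"]
      by (simp add: k_def inner_axis scaleR_diff_right mult.commute)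
    finally show ?thesis by (simp add: set_lebesgue_integral_def)
  qed
  have "(\<Sum>j\<in>UNIV. LINT x:\<Omega>|lebesgue. partial_deriv j \<psi> x *\<^sub>R \<L> j x) = 0"
    using adm test by (auto simp: admissible_coefficients_def)
  then have "k *\<^sub>R ((\<Sum>j\<in>UNIV. (\<nu> $ j) *\<^sub>R A' j) - (\<Sum>j\<in>UNIV. (\<nu> $ j) *\<^sub>R A j)) = 0"
    by (simp add: int scaleR_sum_right sum_subtractf[symmetric] scaleR_diff_right)
  then show ?thesis using k by simp
qed

section \<open>Simplices in barycentric coordinates\<close>

text \<open>The vertices C with the affine coordinates x -> g c . x + b c. The gradients are kept
  explicit since the geometry is read off them: - g c is an outward normal of the facet opposite c,
  and 1 / norm (g c) is the height over that facet.\<close>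

locale barycentric =
  fixes K :: "(real^'n) set" and C :: "(real^'n) set" and g :: "real^'n \<Rightarrow> real^'n" and b :: "real^'n \<Rightarrow> real"
  assumes finite_C: "finite C" and card_C: "card C = CARD('n) + 1"
    and K_hull: "K = convex hull C" and indep: "\<not> affine_dependent C"
    and vertex: "\<And>c c'. c \<in> C \<Longrightarrow> c' \<in> C \<Longrightarrow> g c \<bullet> c' + b c = (if c = c' then 1 else 0)"
    and sum_one: "\<And>x. (\<Sum>c\<in>C. g c \<bullet> x + b c) = 1"
    and repr: "\<And>x. (\<Sum>c\<in>C. (g c \<bullet> x + b c) *\<^sub>R c) = x"

text \<open>The coordinate of c comes from the equation of the hyperplane through the other
  vertices, scaled to 1 at c; affine independence keeps c off that hyperplane.\<close>

lemma simplex_barycentric: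
  fixes K :: "(real^'n) set"
  assumes "int CARD('n) simplex K"
  obtains C g b where "barycentric K C g b"
proof -
  obtain C where C: "\<not> affine_dependent C" "int (card C) = int CARD('n) + 1" "K = convex hull C"
    using assms by (auto simp: simplex_def)
  have fin: "finite C" using C(1) by (rule aff_independent_finite)
  have card: "card C = CARD('n) + 1" using C(2) by linarith
  have "aff_dim C = int CARD('n)" using aff_dim_affine_independent[OF C(1)] card by simp
  then have hullU: "affine hull C = UNIV" using aff_dim_eq_full[of C] by simp
  have "\<exists>gc bc. \<forall>c'\<in>C. gc \<bullet> c' + bc = (if c = c' then 1 else (0::real))" if c: "c \<in> C" for c
  proof -
    have ind': "\<not> affine_dependent (C - {c})" using C(1) affine_independent_Diff by blast
    have "aff_dim (C - {c}) = int (card (C - {c})) - 1"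
      using aff_dim_affine_independent[OF ind'] by simp
    then have "aff_dim (C - {c}) = int DIM(real^'n) - 1" using card c fin by simp
    then obtain a \<beta> where a: "affine hull (C - {c}) = {x. a \<bullet> x = \<beta>}"
      using aff_dim_eq_hyperplane[of "C - {c}"] by auto
    have "c \<notin> affine hull (C - {c})" using C(1) c by (auto simp: affine_dependent_def)
    then have ne: "a \<bullet> c - \<beta> \<noteq> 0" using a by auto
    have on: "a \<bullet> c' = \<beta>" if "c' \<in> C" "c' \<noteq> c" for c'
      using a that hull_inc[of c' "C - {c}" affine] by auto
    show ?thesis
      by (rule exI[of _ "(1 / (a \<bullet> c - \<beta>)) *\<^sub>R a"], rule exI[of _ "- \<beta> / (a \<bullet> c - \<beta>)"])
        (use ne on in \<open>auto simp: diff_divide_distrib[symmetric]\<close>)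
  qed
  then obtain g b where gb: "\<And>c c'. c \<in> C \<Longrightarrow> c' \<in> C \<Longrightarrow> g c \<bullet> c' + b c = (if c = c' then 1 else (0::real))"
    by metis
  have coord: "\<exists>u. sum u C = 1 \<and> (\<Sum>c\<in>C. u c *\<^sub>R c) = x \<and> (\<forall>c\<in>C. g c \<bullet> x + b c = u c)" for x
  proof -
    have "x \<in> affine hull C" using hullU by simp
    then obtain u where u: "sum u C = 1" "(\<Sum>c\<in>C. u c *\<^sub>R c) = x"
      unfolding affine_hull_finite[OF fin] by auto
    have "g c \<bullet> x + b c = u c" if c: "c \<in> C" for c
    proof -
      have "g c \<bullet> x + b c = (\<Sum>c'\<in>C. u c' * (g c \<bullet> c')) + (\<Sum>c'\<in>C. u c' * b c)"
        by (simp add: u(2)[symmetric] inner_sum_right sum_distrib_right[symmetric] u(1))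
      also have "\<dots> = (\<Sum>c'\<in>C. u c' * (g c \<bullet> c' + b c))"
        by (simp add: sum.distrib distrib_left)
      also have "\<dots> = (\<Sum>c'\<in>C. if c' = c then u c' else 0)"
        by (intro sum.cong) (auto simp: gb[OF c])
      finally show ?thesis using c fin by simp
    qed
    with u show ?thesis by blast
  qed
  have "barycentric K C g b"
  proof
    show "(\<Sum>c\<in>C. g c \<bullet> x + b c) = 1" for x
    proof -
      obtain u where u: "sum u C = 1" "\<And>c. c \<in> C \<Longrightarrow> g c \<bullet> x + b c = u c" using coord by blast
      have "(\<Sum>c\<in>C. g c \<bullet> x + b c) = sum u C" by (intro sum.cong u refl)
      with u(1) show ?thesis by simp
    qed
    show "(\<Sum>c\<in>C. (g c \<bullet> x + b c) *\<^sub>R c) = x" for x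
    proof -
      obtain u where u: "(\<Sum>c\<in>C. u c *\<^sub>R c) = x" "\<And>c. c \<in> C \<Longrightarrow> g c \<bullet> x + b c = u c" using coord by blast
      have "(\<Sum>c\<in>C. (g c \<bullet> x + b c) *\<^sub>R c) = (\<Sum>c\<in>C. u c *\<^sub>R c)"
        by (intro sum.cong refl arg_cong2[of _ _ _ _ scaleR] u(2))
      with u(1) show ?thesis by simp
    qed
  qed (use fin card C gb in auto)
  then show thesis by (rule that)
qed

context barycentric
begin

definition lam :: "real^'n \<Rightarrow> real^'n \<Rightarrow> real"
  where "lam c x = g c \<bullet> x + b c"

text \<open>For c in C, the facet is indexed by the vertex opposite to it, the only one that it
  misses.\<close>

definition face :: "real^'n \<Rightarrow> (real^'n) set"
  where "face c = {x \<in> K. lam c x = 0}"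

lemma lam_vertex: "c \<in> C \<Longrightarrow> c' \<in> C \<Longrightarrow> lam c c' = (if c = c' then 1 else 0)"
  by (simp add: lam_def vertex)

lemma sum_lam: "(\<Sum>c\<in>C. lam c x) = 1" by (simp add: lam_def sum_one)

lemma lam_repr: "(\<Sum>c\<in>C. lam c x *\<^sub>R c) = x" by (simp add: lam_def repr)

lemma lam_add: "lam c (x + y) = lam c x + g c \<bullet> y" by (simp add: lam_def inner_add_right)

lemma lam_diff: "g c \<bullet> (x - y) = lam c x - lam c y" by (simp add: lam_def inner_diff_right)

lemma continuous_lam [continuous_intros]: "continuous_on S (lam c)"
  unfolding lam_def[abs_def] by (intro continuous_intros)

lemma borel_measurable_lam [measurable]: "lam c \<in> borel_measurable borel"
  by (intro borel_measurable_continuous_onI continuous_lam)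

lemma affine_combination: "q \<bullet> x + \<beta> = (\<Sum>c\<in>C. lam c x * (q \<bullet> c + \<beta>))"
proof -
  have "(\<Sum>c\<in>C. lam c x * (q \<bullet> c + \<beta>)) = q \<bullet> (\<Sum>c\<in>C. lam c x *\<^sub>R c) + (\<Sum>c\<in>C. lam c x) * \<beta>"
    by (simp add: inner_sum_right distrib_left sum.distrib sum_distrib_right)
  then show ?thesis by (simp add: lam_repr sum_lam)
qed

lemma K_iff: "x \<in> K \<longleftrightarrow> (\<forall>c\<in>C. 0 \<le> lam c x)"
proof
  assume "x \<in> K"
  then obtain u where u: "\<forall>c\<in>C. 0 \<le> u c" "sum u C = 1" "(\<Sum>c\<in>C. u c *\<^sub>R c) = x"
    unfolding K_hull convex_hull_finite[OF finite_C] by auto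
  have "lam c x = u c" if "c \<in> C" for c
  proof -
    have "lam c x = (\<Sum>c'\<in>C. u c' * (g c \<bullet> c')) + (\<Sum>c'\<in>C. u c') * b c"
      by (simp add: lam_def u(3)[symmetric] inner_sum_right u(2))
    also have "\<dots> = (\<Sum>c'\<in>C. u c' * lam c c')"
      by (simp add: sum.distrib distrib_left sum_distrib_right lam_def)
    also have "\<dots> = (\<Sum>c'\<in>C. if c' = c then u c' else 0)"
      by (intro sum.cong) (auto simp: lam_vertex that)
    finally show ?thesis using that finite_C by simp
  qed
  with u show "\<forall>c\<in>C. 0 \<le> lam c x" by auto
next
  assume "\<forall>c\<in>C. 0 \<le> lam c x"
  then show "x \<in> K" unfolding K_hull convex_hull_finite[OF finite_C]
    by (intro CollectI exI[of _ "\<lambda>c. lam c x"] conjI sum_lam lam_repr)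
qed

lemma compact_K: "compact K"
  unfolding K_hull by (intro compact_convex_hull finite_imp_compact finite_C)

lemma closed_K: "closed K" by (rule compact_imp_closed[OF compact_K])

lemma convex_K: "convex K" by (simp add: K_hull)

lemma vertex_in: "c \<in> C \<Longrightarrow> c \<in> K" by (simp add: K_hull hull_inc)

lemma extreme_point_iff: "x extreme_point_of K \<longleftrightarrow> x \<in> C"
  unfolding K_hull by (rule extreme_point_of_convex_hull_affine_independent[OF indep])

lemma other_vertex: obtains c' where "c' \<in> C" "c' \<noteq> c"
proof -
  have "\<not> C \<subseteq> {c}"
  proof
    assume "C \<subseteq> {c}"
    then have "card C \<le> 1" using card_mono[of "{c}" C] by simp
    moreover have "CARD('n) \<ge> 1" by (simp add: Suc_leI)
    ultimately show False using card_C by simp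
  qed
  then show thesis using that by blast
qed

lemma g_nonzero: assumes "c \<in> C" shows "g c \<noteq> 0"
proof
  assume "g c = 0"
  obtain c' where "c' \<in> C" "c' \<noteq> c" by (rule other_vertex)
  then show False using \<open>g c = 0\<close> vertex[OF assms assms] vertex[OF assms, of c'] by simp
qed

lemma norm_g_pos: "c \<in> C \<Longrightarrow> 0 < norm (g c)" using g_nonzero by simp

lemma sum_g: "(\<Sum>c\<in>C. g c) = 0"
proof -
  have "(\<Sum>c\<in>C. g c) \<bullet> x = 0 \<bullet> x" for x
    using sum_one[of x] sum_one[of 0] by (simp add: sum.distrib inner_sum_left)
  then show ?thesis by (rule iffD1[OF vector_eq_rdot, OF allI])
qed

lemma interior_iff: "x \<in> interior K \<longleftrightarrow> (\<forall>c\<in>C. 0 < lam c x)"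
proof
  assume x: "x \<in> interior K"
  show "\<forall>c\<in>C. 0 < lam c x"
  proof (rule ballI, rule ccontr)
    fix c assume c: "c \<in> C" "\<not> 0 < lam c x"
    obtain e where e: "e > 0" "ball x e \<subseteq> K" using x by (meson interior_subset mem_interior open_contains_ball subset_trans)
    define y where "y = x + (- (e / (2 * norm (g c)))) *\<^sub>R g c"
    have "y \<in> ball x e" using e norm_g_pos[OF c(1)] by (simp add: y_def dist_norm)
    then have "0 \<le> lam c y" using e c K_iff by blast
    moreover have "lam c y < lam c x"
      unfolding y_def lam_add using e g_nonzero[OF c(1)] norm_g_pos[OF c(1)]
      by (simp add: inner_commute)
    ultimately show False using c by simp
  qed
next
  assume pos: "\<forall>c\<in>C. 0 < lam c x"
  have "open (\<Inter>c\<in>C. {x. 0 < lam c x})"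
    using finite_C by (intro open_INT ballI open_Collect_less continuous_intros) auto
  moreover have "(\<Inter>c\<in>C. {x. 0 < lam c x}) \<subseteq> K" using K_iff by (auto intro: less_imp_le)
  ultimately show "x \<in> interior K" using pos by (intro interiorI) auto
qed

lemma interior_nonempty: "interior K \<noteq> {}"
proof -
  let ?x = "\<Sum>c\<in>C. (1 / real (card C)) *\<^sub>R c"
  have "lam c ?x > 0" if "c \<in> C" for c
  proof -
    have "lam c ?x = (\<Sum>c'\<in>C. (1 / real (card C)) * (g c \<bullet> c')) + (\<Sum>c'\<in>C. 1 / real (card C)) * b c"
      using card_C by (simp add: lam_def inner_sum_right)
    also have "\<dots> = (\<Sum>c'\<in>C. (1 / real (card C)) * lam c c')"
      unfolding lam_def distrib_left sum.distrib sum_distrib_right by simp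
    also have "\<dots> = (\<Sum>c'\<in>C. if c' = c then 1 / real (card C) else 0)"
      by (intro sum.cong) (auto simp: lam_vertex that)
    finally show ?thesis using that finite_C card_C by simp
  qed
  then show ?thesis using interior_iff by blast
qed

lemma K_subset_closure_interior: "K \<subseteq> closure (interior K)"
  using convex_closure_interior[OF convex_K interior_nonempty] closed_K by simp

lemma volume_pos: "0 < measure lebesgue K"
proof -
  have "\<not> negligible K"
    using interior_nonempty open_not_negligible[of "interior K"] negligible_subset interior_subset by blast
  moreover have "K \<in> lmeasurable" using compact_K by (rule lmeasurable_compact)
  ultimately show ?thesis using negligible_iff_measure measure_nonneg[of lebesgue K] by (metis less_le)
qed

lemma negligible_frontier_K: "negligible (frontier K)"
  by (intro negligible_convex_frontier convex_K)

lemma face_hull: assumes "c \<in> C" shows "face c = convex hull (C - {c})"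
proof
  show "convex hull (C - {c}) \<subseteq> face c"
  proof (rule hull_minimal)
    show "C - {c} \<subseteq> face c" using vertex_in lam_vertex assms by (auto simp: face_def)
    have "face c = K \<inter> {x. g c \<bullet> x = - b c}" by (auto simp: face_def lam_def)
    then show "convex (face c)" using convex_K convex_hyperplane by (metis convex_Int)
  qed
  show "face c \<subseteq> convex hull (C - {c})"
  proof
    fix x assume x: "x \<in> face c"
    have "(\<Sum>c'\<in>C - {c}. lam c' x) = 1" "(\<Sum>c'\<in>C - {c}. lam c' x *\<^sub>R c') = x"
      using sum_lam[of x] lam_repr[of x] x
        sum.remove[OF finite_C assms, of "\<lambda>c'. lam c' x"] sum.remove[OF finite_C assms, of "\<lambda>c'. lam c' x *\<^sub>R c'"]
      by (auto simp: face_def)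
    moreover have "\<forall>c'\<in>C - {c}. 0 \<le> lam c' x" using x K_iff by (auto simp: face_def)
    ultimately show "x \<in> convex hull (C - {c})"
      using finite_C by (auto simp: convex_hull_finite)
  qed
qed

lemma facet_iff: "F facet_of K \<longleftrightarrow> (\<exists>c\<in>C. F = face c)"
proof -
  have "2 \<le> card C" using card_C by (simp add: Suc_leI)
  then have "F facet_of convex hull C \<longleftrightarrow> (\<exists>c. c \<in> C \<and> F = convex hull (C - {c}))"
    unfolding facet_of_convex_hull_affine_independent_alt[OF indep] by simp
  then show ?thesis using face_hull by (auto simp: K_hull[symmetric])
qed

lemma face_inj: assumes "c \<in> C" "c' \<in> C" "face c = face c'" shows "c = c'"
proof (rule ccontr)
  assume "c \<noteq> c'"
  then have "c \<in> face c'" using assms(1,2) vertex_in lam_vertex by (auto simp: face_def)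
  moreover have "c \<notin> face c" using assms(1) lam_vertex by (auto simp: face_def)
  ultimately show False using assms by simp
qed

lemma vertex_in_face_iff: "c \<in> C \<Longrightarrow> v \<in> C \<Longrightarrow> v \<in> face c \<longleftrightarrow> v \<noteq> c"
  using vertex_in lam_vertex by (auto simp: face_def)

lemma facets_eq: "{F. F facet_of K} = face ` C" using facet_iff by auto

lemma sum_facets: "(\<Sum>F\<in>{F. F facet_of K}. h F) = (\<Sum>c\<in>C. h (face c))"
  unfolding facets_eq by (rule sum.reindex_cong) (auto simp: inj_on_def face_inj)

lemma rel_interior_face:
  assumes "c \<in> C"
  shows "x \<in> rel_interior (face c) \<longleftrightarrow> lam c x = 0 \<and> (\<forall>c'\<in>C - {c}. 0 < lam c' x)"
proof -
  have ind': "\<not> affine_dependent (C - {c})" using indep affine_independent_Diff by blast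
  have "x \<in> rel_interior (face c) \<longleftrightarrow>
      (\<exists>u. (\<forall>c'\<in>C - {c}. 0 < u c') \<and> sum u (C - {c}) = 1 \<and> (\<Sum>c'\<in>C - {c}. u c' *\<^sub>R c') = x)"
    unfolding face_hull[OF assms] rel_interior_convex_hull_explicit[OF ind'] by simp
  also have "\<dots> \<longleftrightarrow> lam c x = 0 \<and> (\<forall>c'\<in>C - {c}. 0 < lam c' x)"
  proof
    assume "\<exists>u. (\<forall>c'\<in>C - {c}. 0 < u c') \<and> sum u (C - {c}) = 1 \<and> (\<Sum>c'\<in>C - {c}. u c' *\<^sub>R c') = x"
    then obtain u where u: "\<forall>c'\<in>C - {c}. 0 < u c'" "sum u (C - {c}) = 1" "(\<Sum>c'\<in>C - {c}. u c' *\<^sub>R c') = x"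
      by blast
    have "lam d x = (if d = c then 0 else u d)" if d: "d \<in> C" for d
    proof -
      have "lam d x = (\<Sum>c'\<in>C - {c}. u c' * (g d \<bullet> c')) + (\<Sum>c'\<in>C - {c}. u c') * b d"
        by (simp add: lam_def u(3)[symmetric] inner_sum_right u(2))
      also have "\<dots> = (\<Sum>c'\<in>C - {c}. u c' * lam d c')"
        by (simp add: sum.distrib distrib_left sum_distrib_right lam_def)
      also have "\<dots> = (\<Sum>c'\<in>C - {c}. if c' = d then u c' else 0)"
        by (intro sum.cong) (auto simp: lam_vertex d)
      finally show ?thesis using d finite_C by simp
    qed
    then show "lam c x = 0 \<and> (\<forall>c'\<in>C - {c}. 0 < lam c' x)" using u assms by auto
  next
    assume r: "lam c x = 0 \<and> (\<forall>c'\<in>C - {c}. 0 < lam c' x)"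
    have "(\<Sum>c'\<in>C - {c}. lam c' x) = 1" "(\<Sum>c'\<in>C - {c}. lam c' x *\<^sub>R c') = x"
      using sum_lam[of x] lam_repr[of x] r
        sum.remove[OF finite_C assms, of "\<lambda>c'. lam c' x"] sum.remove[OF finite_C assms, of "\<lambda>c'. lam c' x *\<^sub>R c'"]
      by auto
    with r show "\<exists>u. (\<forall>c'\<in>C - {c}. 0 < u c') \<and> sum u (C - {c}) = 1 \<and> (\<Sum>c'\<in>C - {c}. u c' *\<^sub>R c') = x"
      by (intro exI[of _ "\<lambda>c'. lam c' x"]) auto
  qed
  finally show ?thesis .
qed

text \<open>Near a relative interior point of a facet all other coordinates remain positive, so the
  sign of \<open>lam c\<close> alone decides.\<close>

lemma half_ball_in_interior:
  assumes c: "c \<in> C" and x: "x \<in> rel_interior (face c)"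
  obtains r where "r > 0" "\<And>y. y \<in> ball x r \<Longrightarrow> 0 < lam c y \<Longrightarrow> y \<in> interior K"
proof -
  have "open (\<Inter>d\<in>C - {c}. {y. 0 < lam d y})"
    using finite_C by (intro open_INT ballI open_Collect_less continuous_intros) auto
  moreover have "x \<in> (\<Inter>d\<in>C - {c}. {y. 0 < lam d y})" using x rel_interior_face[OF c] by auto
  ultimately obtain r where r: "r > 0" "ball x r \<subseteq> (\<Inter>d\<in>C - {c}. {y. 0 < lam d y})"
    by (meson open_contains_ball)
  show thesis
  proof (rule that[OF r(1)])
    fix y assume y: "y \<in> ball x r" "0 < lam c y"
    then have "y \<in> (\<Inter>d\<in>C - {c}. {y. 0 < lam d y})" using r(2) by blast
    with y(2) show "y \<in> interior K" unfolding interior_iff by auto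
  qed
qed

text \<open>Uniqueness resolves the THE: an affine function \<beta> - \<nu> . x that vanishes at all
  vertices of the facet is h times \<open>lam c\<close>, where h is its value at c. The supporting
  inequality gives h \<ge> 0, and the unit length of \<nu> gives h = 1 / norm (g c).\<close>

lemma outward_normal_face:
  assumes c: "c \<in> C"
  shows "outward_normal K (face c) = - g c /\<^sub>R norm (g c)"
  unfolding outward_normal_def
proof (rule the_equality)
  note pos = norm_g_pos[OF c]
  have eq: "(- g c /\<^sub>R norm (g c)) \<bullet> x = (b c - lam c x) / norm (g c)" for x
    by (simp add: lam_def divide_inverse)
  show "norm (- g c /\<^sub>R norm (g c)) = 1 \<and>
    (\<exists>\<beta>. (\<forall>x\<in>K. (- g c /\<^sub>R norm (g c)) \<bullet> x \<le> \<beta>) \<and> face c = {x \<in> K. (- g c /\<^sub>R norm (g c)) \<bullet> x = \<beta>})"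
    unfolding eq
  proof (intro conjI exI[of _ "b c / norm (g c)"])
    show "norm (- g c /\<^sub>R norm (g c)) = 1" using pos by simp
    show "\<forall>x\<in>K. (b c - lam c x) / norm (g c) \<le> b c / norm (g c)"
      using pos K_iff c by (auto intro!: divide_right_mono)
    show "face c = {x \<in> K. (b c - lam c x) / norm (g c) = b c / norm (g c)}"
      using pos by (auto simp: face_def field_simps)
  qed
  fix \<nu> assume "norm \<nu> = 1 \<and> (\<exists>\<beta>. (\<forall>x\<in>K. \<nu> \<bullet> x \<le> \<beta>) \<and> face c = {x \<in> K. \<nu> \<bullet> x = \<beta>})"
  then obtain \<beta> where \<nu>: "norm \<nu> = 1" "\<forall>x\<in>K. \<nu> \<bullet> x \<le> \<beta>" "face c = {x \<in> K. \<nu> \<bullet> x = \<beta>}" by auto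
  define h where "h = \<beta> - \<nu> \<bullet> c"
  have val: "\<beta> - \<nu> \<bullet> d = (if d = c then h else 0)" if "d \<in> C" for d
    using \<nu>(3) vertex_in_face_iff[OF c that] vertex_in[OF that] by (auto simp: h_def)
  have "\<beta> - \<nu> \<bullet> x = (\<Sum>d\<in>C. if d = c then h * lam d x else 0)" for x
  proof -
    have "\<beta> - \<nu> \<bullet> x = (- \<nu>) \<bullet> x + \<beta>" by simp
    also have "\<dots> = (\<Sum>d\<in>C. lam d x * (\<beta> - \<nu> \<bullet> d))"
      using affine_combination[of "- \<nu>" x \<beta>] by (simp add: add.commute)
    also have "\<dots> = (\<Sum>d\<in>C. if d = c then h * lam d x else 0)"
      by (intro sum.cong refl) (simp add: val)
    finally show ?thesis .
  qed
  then have aff: "\<beta> - \<nu> \<bullet> x = h * (g c \<bullet> x + b c)" for x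
    using c finite_C by (simp add: lam_def)
  have "\<nu> \<bullet> x = ((- h) *\<^sub>R g c) \<bullet> x" for x
  proof -
    have "\<beta> = h * b c" using aff[of 0] by simp
    with aff[of x] show ?thesis by (simp add: distrib_left)
  qed
  then have eq\<nu>: "\<nu> = (- h) *\<^sub>R g c" by (rule iffD1[OF vector_eq_rdot, OF allI])
  have "h \<ge> 0" using \<nu>(2) vertex_in[OF c] by (simp add: h_def)
  moreover have "\<bar>h\<bar> * norm (g c) = 1" using \<nu>(1) eq\<nu> by simp
  ultimately have "h = 1 / norm (g c)" using pos by (simp add: field_simps)
  with eq\<nu> show "\<nu> = - g c /\<^sub>R norm (g c)" by (simp add: divide_inverse)
qed

lemma norm_outward_normal: "c \<in> C \<Longrightarrow> norm (outward_normal K (face c)) = 1"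
  using norm_g_pos by (simp add: outward_normal_face)

lemma compact_face: "c \<in> C \<Longrightarrow> compact (face c)"
  unfolding face_hull using finite_C by (intro compact_convex_hull finite_imp_compact) auto

lemma face_nonempty: assumes "c \<in> C" shows "face c \<noteq> {}"
proof -
  obtain c' where "c' \<in> C" "c' \<noteq> c" by (rule other_vertex)
  then show ?thesis using vertex_in_face_iff[OF assms] by blast
qed

end

section \<open>Facet integrals of the barycentric coordinates\<close>

context barycentric
begin

text \<open>The affine map \<open>T\<close> fixes the hyperplane of the facet and moves the opposite vertex \<open>c\<close> to
  \<open>v + \<nu>\<close>; it maps \<open>K\<close> onto the region below the graph of \<open>lam v\<close> over the facet.\<close>

lemma nn_integral_face_lam:
  assumes c: "c \<in> C" and v: "v \<in> C" "v \<noteq> c" and p: "p \<in> face c"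
  shows "(\<integral>\<^sup>+x\<in>face c. ennreal (lam v x) \<partial>hyperplane_measure (outward_normal K (face c)) p)
    = ennreal (norm (g c)) * emeasure lborel K"
proof -
  define \<nu> where "\<nu> = outward_normal K (face c)"
  define \<gamma> where "\<gamma> = norm (g c)"
  have \<gamma>: "0 < \<gamma>" using norm_g_pos[OF c] by (simp add: \<gamma>_def)
  have \<nu>: "norm \<nu> = 1" using norm_outward_normal[OF c] by (simp add: \<nu>_def)
  then have nn: "\<nu> \<bullet> \<nu> = 1" by (simp add: norm_eq_1)
  have \<nu>g: "\<nu> \<bullet> y = - (g c \<bullet> y) / \<gamma>" for y
    unfolding \<nu>_def outward_normal_face[OF c] \<gamma>_def by (simp add: divide_inverse)
  have gn: "g c = - \<gamma> *\<^sub>R \<nu>"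
    unfolding \<nu>_def outward_normal_face[OF c] \<gamma>_def using g_nonzero[OF c] by simp
  have lp: "lam c p = 0" using p by (simp add: face_def)
  have height: "\<nu> \<bullet> (x - p) = - lam c x / \<gamma>" for x
    unfolding \<nu>g lam_diff lp by simp
  define G where "G = {x. x - (\<nu> \<bullet> (x - p)) *\<^sub>R \<nu> \<in> face c \<and>
      0 \<le> \<nu> \<bullet> (x - p) \<and> \<nu> \<bullet> (x - p) \<le> lam v (x - (\<nu> \<bullet> (x - p)) *\<^sub>R \<nu>)}"
  have [measurable]: "face c \<in> sets borel"
    using compact_face[OF c] by (simp add: compact_imp_closed)
  have G[measurable]: "G \<in> sets borel" unfolding G_def by measurable
  have K[measurable]: "K \<in> sets borel" using closed_K by simp
  \<comment> \<open>The part of v - c parallel to the facet. The map T below is a dilation by -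
    \<gamma> along \<nu> about the hyperplane, followed by a shear in direction q that keeps
    heights, so it scales volumes by \<gamma>.\<close>
  define q where "q = (v - c) - (1 / \<gamma>) *\<^sub>R \<nu>"
  have gvc: "g d \<bullet> (v - c) = (if d = v then 1 else if d = c then -1 else 0)" if "d \<in> C" for d
    unfolding lam_diff using that c v by (simp add: lam_vertex)
  have q: "\<nu> \<bullet> q = 0"
  proof -
    have "\<nu> \<bullet> (v - c) = 1 / \<gamma>" using gvc[OF c] v(2) unfolding \<nu>g by simp
    then show ?thesis unfolding q_def inner_diff_right[of _ "v - c"] inner_scaleR_right nn by simp
  qed
  define T where "T x = x + lam c x *\<^sub>R (v + \<nu> - c)" for x
  have TG: "T x \<in> G \<longleftrightarrow> x \<in> K" for x
  proof -
    have h: "\<nu> \<bullet> (T x - p) = lam c x"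
    proof -
      have "\<nu> \<bullet> (T x - p) = \<nu> \<bullet> (x - p) + lam c x * (\<nu> \<bullet> (v - c) + 1)"
        by (simp add: T_def inner_add_right inner_diff_right nn algebra_simps)
      also have "\<nu> \<bullet> (v - c) = 1 / \<gamma>" using gvc[OF c] v(2) by (simp add: \<nu>g)
      finally show ?thesis unfolding height using \<gamma> by (simp add: field_simps)
    qed
    have pr: "T x - lam c x *\<^sub>R \<nu> = x + lam c x *\<^sub>R (v - c)"
      by (simp add: T_def algebra_simps)
    have l: "lam d (x + lam c x *\<^sub>R (v - c)) =
        (if d = v then lam v x + lam c x else if d = c then 0 else lam d x)" if "d \<in> C" for d
      unfolding lam_add inner_scaleR_right gvc[OF that] using v(2) by auto
    have "T x \<in> G \<longleftrightarrow> (\<forall>d\<in>C. 0 \<le> lam d (x + lam c x *\<^sub>R (v - c))) \<and>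
        0 \<le> lam c x \<and> lam c x \<le> lam v x + lam c x"
      unfolding G_def mem_Collect_eq h pr face_def K_iff l[OF v(1)] l[OF c] using v(2) by auto
    also have "\<dots> \<longleftrightarrow> (\<forall>d\<in>C. 0 \<le> lam d x)"
    proof
      assume a: "(\<forall>d\<in>C. 0 \<le> lam d (x + lam c x *\<^sub>R (v - c))) \<and> 0 \<le> lam c x \<and> lam c x \<le> lam v x + lam c x"
      show "\<forall>d\<in>C. 0 \<le> lam d x"
      proof
        fix d assume d: "d \<in> C"
        have "0 \<le> lam d (x + lam c x *\<^sub>R (v - c))" using a d by blast
        then show "0 \<le> lam d x" unfolding l[OF d] using a by (auto split: if_splits)
      qed
    next
      assume a: "\<forall>d\<in>C. 0 \<le> lam d x"
      then have "0 \<le> lam v x" "0 \<le> lam c x" using v c by auto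
      with a show "(\<forall>d\<in>C. 0 \<le> lam d (x + lam c x *\<^sub>R (v - c))) \<and> 0 \<le> lam c x \<and> lam c x \<le> lam v x + lam c x"
        by (simp add: l)
    qed
    finally show ?thesis by (simp add: K_iff)
  qed
  have shear: "(\<integral>\<^sup>+x. indicator G (x + (\<nu> \<bullet> (x - p)) *\<^sub>R q) \<partial>lborel) = emeasure lborel G"
  proof (cases "q = 0")
    case False
    define u where "u = q /\<^sub>R norm q"
    have u: "norm u = 1" and uq: "norm q *\<^sub>R u = q" using False by (auto simp: u_def)
    have nu: "\<nu> \<bullet> u = 0" using q by (simp add: u_def)
    have eq: "x + ((1 - 1) * (u \<bullet> x) + norm q * (\<nu> \<bullet> (x - (u \<bullet> x) *\<^sub>R u - p))) *\<^sub>R u = x + (\<nu> \<bullet> (x - p)) *\<^sub>R q" for x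
    proof -
      have "\<nu> \<bullet> (x - (u \<bullet> x) *\<^sub>R u - p) = \<nu> \<bullet> (x - p)" by (simp add: inner_diff_right nu)
      then have "((1 - 1) * (u \<bullet> x) + norm q * (\<nu> \<bullet> (x - (u \<bullet> x) *\<^sub>R u - p))) *\<^sub>R u = (\<nu> \<bullet> (x - p)) *\<^sub>R (norm q *\<^sub>R u)"
        by simp
      then show ?thesis by (simp only: uq)
    qed
    have "ennreal \<bar>1\<bar> * (\<integral>\<^sup>+x. indicator G (x + ((1 - 1) * (u \<bullet> x) + norm q * (\<nu> \<bullet> (x - (u \<bullet> x) *\<^sub>R u - p))) *\<^sub>R u) \<partial>lborel)
        = (\<integral>\<^sup>+x. indicator G x \<partial>lborel)"
      by (rule nn_integral_move_along) (auto simp: u)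
    then show ?thesis unfolding eq by simp
  qed simp
  have scale: "ennreal \<gamma> * (\<integral>\<^sup>+x. indicator G (T x) \<partial>lborel) = (\<integral>\<^sup>+x. indicator G (x + (\<nu> \<bullet> (x - p)) *\<^sub>R q) \<partial>lborel)"
  proof -
    let ?f = "\<lambda>x. indicator G (x + (\<nu> \<bullet> (x - p)) *\<^sub>R q) :: ennreal"
    have "ennreal \<bar>- \<gamma>\<bar> * (\<integral>\<^sup>+x. ?f (x + ((- \<gamma> - 1) * (\<nu> \<bullet> x) + (\<gamma> + 1) * (\<nu> \<bullet> p)) *\<^sub>R \<nu>) \<partial>lborel) = (\<integral>\<^sup>+x. ?f x \<partial>lborel)"
      by (rule nn_integral_move_along) (use \<nu> \<gamma> in auto)
    moreover have "?f (x + ((- \<gamma> - 1) * (\<nu> \<bullet> x) + (\<gamma> + 1) * (\<nu> \<bullet> p)) *\<^sub>R \<nu>) = indicator G (T x)" for x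
    proof -
      let ?t = "\<nu> \<bullet> (x - p)"
      have e: "(- \<gamma> - 1) * (\<nu> \<bullet> x) + (\<gamma> + 1) * (\<nu> \<bullet> p) = - (\<gamma> + 1) * ?t"
        by (simp add: inner_diff_right algebra_simps)
      have h: "\<nu> \<bullet> (x + (- (\<gamma> + 1) * ?t) *\<^sub>R \<nu> - p) = - \<gamma> * ?t"
        by (simp add: inner_diff_right inner_add_right nn algebra_simps)
      have l: "lam c x = - \<gamma> * ?t" using \<gamma> by (simp add: height)
      have "T x = x + (- \<gamma> * ?t) *\<^sub>R (v - c) + (- \<gamma> * ?t) *\<^sub>R \<nu>"
        by (simp add: T_def l algebra_simps)
      also have "\<dots> = x + (- (\<gamma> + 1) * ?t) *\<^sub>R \<nu> + (- \<gamma> * ?t) *\<^sub>R q"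
      proof -
        have "(- \<gamma> * ?t) *\<^sub>R q = (- \<gamma> * ?t) *\<^sub>R (v - c) + ?t *\<^sub>R \<nu>"
          using \<gamma> by (simp add: q_def scaleR_diff_right)
        then show ?thesis by (simp add: algebra_simps)
      qed
      finally show ?thesis unfolding e h by simp
    qed
    ultimately show ?thesis using \<gamma> by simp
  qed
  have "(\<integral>\<^sup>+x\<in>face c. ennreal (lam v x) \<partial>hyperplane_measure \<nu> p) = emeasure lborel G"
    unfolding G_def by (rule hyperplane_measure_subgraph) (auto simp: \<nu>)
  also have "\<dots> = ennreal \<gamma> * (\<integral>\<^sup>+x. indicator G (T x) \<partial>lborel)" using shear scale by simp
  also have "(\<integral>\<^sup>+x. indicator G (T x) \<partial>lborel) = (\<integral>\<^sup>+x. indicator K x \<partial>lborel)"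
    by (intro nn_integral_cong) (simp add: indicator_def TG)
  finally show ?thesis by (simp add: \<nu>_def \<gamma>_def)
qed

lemma set_integrable_face:
  assumes c: "c \<in> C" and m: "set_borel_measurable borel (face c) f"
    and bd: "\<And>x. x \<in> face c \<Longrightarrow> \<bar>f x\<bar> \<le> (B::real)"
  shows "set_integrable (hyperplane_measure \<nu> p) (face c) f"
proof -
  have cl: "face c \<in> sets borel" using compact_face[OF c] by (simp add: compact_imp_closed)
  have "emeasure (hyperplane_measure \<nu> p) (face c) < \<infinity>"
    using compact_face[OF c] cl by (intro emeasure_hyperplane_measure_finite compact_imp_bounded)
  moreover have "(\<lambda>x. indicator (face c) x *\<^sub>R f x) \<in> borel_measurable (hyperplane_measure \<nu> p)"
    using m unfolding set_borel_measurable_def by simp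
  ultimately show ?thesis
    unfolding set_integrable_def using cl bd
    by (intro integrableI_bounded_set[where A = "face c" and B = B]) auto
qed

text \<open>In classical terms the volume is the facet area divided by N norm (g c), and for v
  different from c the function \<open>lam v\<close> has mean 1 / N on the facet; both sides are the
  area divided by N.\<close>

lemma facet_integral_lam:
  assumes c: "c \<in> C" and v: "v \<in> C"
  shows "facet_integral K (face c) (lam v) = (if v = c then 0 else norm (g c) * measure lebesgue K)"
proof -
  define p where "p = (SOME p. p \<in> face c)"
  let ?M = "hyperplane_measure (outward_normal K (face c)) p"
  have p: "p \<in> face c" unfolding p_def using face_nonempty[OF c] by (simp add: some_in_eq)
  have fi: "facet_integral K (face c) (lam v) = (LINT x|?M. indicator (face c) x *\<^sub>R lam v x)"
    by (simp add: facet_integral_def set_lebesgue_integral_def p_def)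
  show ?thesis
  proof (cases "v = c")
    case True
    then have "(\<lambda>x. indicator (face c) x *\<^sub>R lam v x) = (\<lambda>x. 0)" by (auto simp: indicator_def face_def)
    then show ?thesis unfolding fi using True by (simp only: if_True integral_zero refl)
  next
    case False
    have [measurable]: "face c \<in> sets borel" using compact_face[OF c] by (simp add: compact_imp_closed)
    have nonneg: "0 \<le> lam v x" if "x \<in> face c" for x using that v K_iff by (auto simp: face_def)
    have "(LINT x|?M. indicator (face c) x *\<^sub>R lam v x)
        = enn2real (\<integral>\<^sup>+x. ennreal (indicator (face c) x *\<^sub>R lam v x) \<partial>?M)"
      by (intro integral_eq_nn_integral) (auto simp: indicator_def nonneg)
    also have "(\<integral>\<^sup>+x. ennreal (indicator (face c) x *\<^sub>R lam v x) \<partial>?M) = (\<integral>\<^sup>+x\<in>face c. ennreal (lam v x) \<partial>?M)"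
      by (intro nn_integral_cong) (auto simp: indicator_def)
    also have "\<dots> = ennreal (norm (g c)) * emeasure lborel K"
      by (rule nn_integral_face_lam[OF c v False p])
    also have "emeasure lborel K = ennreal (measure lebesgue K)"
    proof -
      have "emeasure lborel K = emeasure lebesgue K" using closed_K by (simp add: emeasure_completion)
      also have "\<dots> = ennreal (measure lebesgue K)"
        by (rule emeasure_eq_measure2[OF lmeasurable_compact[OF compact_K]])
      finally show ?thesis .
    qed
    finally show ?thesis unfolding fi using False by (simp add: ennreal_mult'[symmetric])
  qed
qed

section \<open>Affine functions and shape regularity on a simplex\<close>

lemma affine_vanishing:
  assumes v: "v \<in> C" and \<phi>: "\<And>x. x \<in> K \<Longrightarrow> \<phi> x = q \<bullet> x + \<beta>" and z: "\<And>c. c \<in> C \<Longrightarrow> c \<noteq> v \<Longrightarrow> \<phi> c = 0"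
  shows "x \<in> K \<Longrightarrow> \<phi> x = \<phi> v * lam v x" and "q = \<phi> v *\<^sub>R g v"
proof -
  have val: "q \<bullet> c + \<beta> = (if c = v then \<phi> v else 0)" if "c \<in> C" for c
    using \<phi>[OF vertex_in[OF that]] z[OF that] by auto
  have aff: "q \<bullet> x + \<beta> = \<phi> v * lam v x" for x
  proof -
    have "q \<bullet> x + \<beta> = (\<Sum>c\<in>C. if c = v then \<phi> v * lam v x else 0)"
      using affine_combination[of q x \<beta>] by (auto intro!: sum.cong simp: val)
    then show ?thesis using v finite_C by simp
  qed
  then show "x \<in> K \<Longrightarrow> \<phi> x = \<phi> v * lam v x" using \<phi> by simp
  have "q \<bullet> x = (\<phi> v *\<^sub>R g v) \<bullet> x" for x
  proof -
    have "\<beta> = \<phi> v * b v" using aff[of 0] by (simp add: lam_def)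
    with aff[of x] show ?thesis by (simp add: lam_def distrib_left)
  qed
  then show "q = \<phi> v *\<^sub>R g v" by (rule iffD1[OF vector_eq_rdot, OF allI])
qed

text \<open>A step of length \<rho> from the center along g c raises \<open>lam c\<close> by \<rho>
  norm (g c), while \<open>lam c\<close> stays between 0 and 1 on K.\<close>

lemma inball_radius_le:
  assumes c: "c \<in> C" and x: "cball x \<rho> \<subseteq> K"
  shows "\<rho> \<le> 1 / norm (g c)"
proof (cases "\<rho> \<ge> 0")
  case True
  define e where "e = (\<rho> / norm (g c)) *\<^sub>R g c"
  have "norm e = \<rho>" using True norm_g_pos[OF c] by (simp add: e_def)
  then have "x \<in> cball x \<rho>" "x + e \<in> cball x \<rho>" using True by (auto simp: dist_norm)
  then have xe: "x \<in> K" "x + e \<in> K" using x by blast+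
  have "lam c (x + e) \<le> (\<Sum>c\<in>C. lam c (x + e))"
    using xe(2) K_iff c finite_C by (intro member_le_sum) auto
  moreover have "0 \<le> lam c x" using xe(1) c by (simp add: K_iff)
  ultimately have "lam c (x + e) - lam c x \<le> 1" using sum_lam[of "x + e"] by linarith
  then have "\<rho> * norm (g c) \<le> 1"
    using norm_g_pos[OF c] by (simp add: lam_add e_def dot_square_norm power2_eq_square)
  then show ?thesis using norm_g_pos[OF c] by (simp add: field_simps)
next
  \<comment> \<open>Negative radii do occur in the set that defines \<open>inradius\<close>, since
    their balls are empty.\<close>
  case False
  moreover have "0 \<le> 1 / norm (g c)" by simp
  ultimately show ?thesis by linarith
qed

lemma inradius_nonneg: "0 \<le> inradius K"
proof -
  obtain c where c: "c \<in> C" by (rule other_vertex)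
  have "bdd_above {\<rho>. \<exists>x. cball x \<rho> \<subseteq> K}"
    using inball_radius_le[OF c] by (intro bdd_aboveI) blast
  moreover have "0 \<in> {\<rho>. \<exists>x. cball x \<rho> \<subseteq> K}" using vertex_in[OF c] by auto
  ultimately show ?thesis unfolding inradius_def by (intro cSup_upper)
qed

lemma inradius_le: "c \<in> C \<Longrightarrow> inradius K \<le> 1 / norm (g c)"
  unfolding inradius_def
proof (rule cSup_least)
  have "(-1) \<in> {\<rho>. \<exists>x. cball x \<rho> \<subseteq> K}" by simp
  then show "{\<rho>. \<exists>x. cball x \<rho> \<subseteq> K} \<noteq> {}" by blast
qed (use inball_radius_le in blast)

text \<open>Shape regularity in the form used later: the diameter is controlled by every height 1 /
  norm (g c). \<sigma> is an arbitrary real, hence the absolute value.\<close>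

lemma diameter_le:
  assumes c: "c \<in> C" and d: "diameter K \<le> \<sigma> * inradius K"
  shows "diameter K \<le> \<bar>\<sigma>\<bar> / norm (g c)"
proof -
  have "\<sigma> * inradius K \<le> \<bar>\<sigma>\<bar> * (1 / norm (g c))"
    using inradius_nonneg inradius_le[OF c] by (intro mult_mono) auto
  with d show ?thesis by simp
qed

end

section \<open>Neighboring elements\<close>

lemma mesh_barycentric:
  fixes \<T> :: "(real^'n) set set"
  assumes "conforming_mesh \<Omega> \<T>" "K \<in> \<T>"
  obtains C g b where "barycentric K C g b"
  using assms simplex_barycentric[of K] by (auto simp: conforming_mesh_def)

text \<open>The intersection is a face of both elements, and a face that meets the interior is the
  whole element.\<close>

lemma mesh_interiors_disjoint:
  assumes mesh: "conforming_mesh \<Omega> \<T>" and K: "K \<in> \<T>" "K' \<in> \<T>" "K \<noteq> K'"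
  shows "interior K \<inter> interior K' = {}"
proof (rule ccontr)
  assume ne: "interior K \<inter> interior K' \<noteq> {}"
  have f: "(K \<inter> K') face_of K" "(K' \<inter> K) face_of K'"
    using mesh K by (auto simp: conforming_mesh_def triangulation_def)
  have "K \<inter> K' = K" using face_of_disjoint_interior[OF f(1)] ne interior_subset[of K] interior_subset[of K'] by blast
  moreover have "K' \<inter> K = K'" using face_of_disjoint_interior[OF f(2)] ne interior_subset[of K] interior_subset[of K'] by blast
  ultimately show False using K(3) by blast
qed

text \<open>The barycentric coordinates of the two vertices opposite to a common facet are negative multiples
  of each other; were the factor positive, the two elements would overlap near the facet.\<close>

lemma opposite_elements:
  fixes \<T> :: "(real^'n) set set"
  assumes mesh: "conforming_mesh \<Omega> \<T>" and K: "K \<in> \<T>" "K' \<in> \<T>" "K \<noteq> K'"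
    and bary: "barycentric K C g b" "barycentric K' C' g' b'" and c: "c \<in> C" "c' \<in> C'"
    and F: "barycentric.face K g b c = barycentric.face K' g' b' c'"
  obtains s where "s < 0" "\<And>x. barycentric.lam g' b' c' x = s * barycentric.lam g b c x" "g' c' = s *\<^sub>R g c"
proof -
  interpret k: barycentric K C g b by fact
  interpret k': barycentric K' C' g' b' by fact
  have z: "k'.lam c' d = 0" if "d \<in> C" "d \<noteq> c" for d
    using k.vertex_in_face_iff[OF c(1) that(1)] that(2) F by (auto simp: k'.face_def)
  define s where "s = k'.lam c' c"
  have eq: "k'.lam c' x = s * k.lam c x" for x
  proof -
    have "k'.lam c' x = (\<Sum>d\<in>C. k.lam d x * k'.lam c' d)"
      unfolding k'.lam_def by (rule k.affine_combination)
    also have "\<dots> = (\<Sum>d\<in>C. if d = c then s * k.lam c x else 0)"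
      by (intro sum.cong refl) (auto simp: z s_def)
    finally show ?thesis using c(1) k.finite_C by simp
  qed
  have geq: "g' c' = s *\<^sub>R g c"
  proof -
    have "g' c' \<bullet> x = (s *\<^sub>R g c) \<bullet> x" for x
    proof -
      have "g' c' \<bullet> (x - 0) = s * (g c \<bullet> (x - 0))"
        unfolding k'.lam_diff k.lam_diff eq by (simp add: right_diff_distrib)
      then show ?thesis by simp
    qed
    then show ?thesis by (rule iffD1[OF vector_eq_rdot, OF allI])
  qed
  have "s \<noteq> 0" using geq k'.g_nonzero[OF c(2)] by auto
  moreover have "\<not> 0 < s"
  proof
    assume s: "0 < s"
    have "convex (k.face c)" using k.face_hull[OF c(1)] by simp
    then obtain x where x: "x \<in> rel_interior (k.face c)"
      using rel_interior_eq_empty k.face_nonempty[OF c(1)] by blast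
    obtain r where r: "r > 0" "\<And>y. y \<in> ball x r \<Longrightarrow> 0 < k.lam c y \<Longrightarrow> y \<in> interior K"
      using k.half_ball_in_interior[OF c(1) x] by blast
    have "x \<in> rel_interior (k'.face c')" using x F by simp
    then obtain r' where r': "r' > 0" "\<And>y. y \<in> ball x r' \<Longrightarrow> 0 < k'.lam c' y \<Longrightarrow> y \<in> interior K'"
      using k'.half_ball_in_interior[OF c(2)] by blast
    define y where "y = x + (min r r' / (2 * norm (g c))) *\<^sub>R g c"
    have "dist x y < r" "dist x y < r'" using r(1) r'(1) k.norm_g_pos[OF c(1)] by (auto simp: y_def dist_norm)
    then have yb: "y \<in> ball x r" "y \<in> ball x r'" by auto
    have "0 < k.lam c y"
    proof -
      have "k.lam c y = (min r r' / (2 * norm (g c))) * (g c \<bullet> g c)"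
        using x k.rel_interior_face[OF c(1)] by (simp add: y_def k.lam_add)
      then show ?thesis using r(1) r'(1) k.g_nonzero[OF c(1)] by simp
    qed
    moreover from this have "0 < k'.lam c' y" using s by (simp add: eq)
    ultimately have "y \<in> interior K \<inter> interior K'" using yb r(2) r'(2) by blast
    then show False using mesh_interiors_disjoint[OF mesh K] by blast
  qed
  ultimately have "s < 0" by linarith
  with eq geq show thesis using that by blast
qed

lemma opposite_outward_normal:
  fixes \<T> :: "(real^'n) set set"
  assumes mesh: "conforming_mesh \<Omega> \<T>" and K: "K \<in> \<T>" "K' \<in> \<T>" "K \<noteq> K'"
    and F: "F facet_of K" "F facet_of K'"
  shows "outward_normal K' F = - outward_normal K F"
proof -
  obtain C g b where "barycentric K C g b" using mesh_barycentric[OF mesh K(1)] .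
  then interpret k: barycentric K C g b .
  obtain C' g' b' where "barycentric K' C' g' b'" using mesh_barycentric[OF mesh K(2)] .
  then interpret k': barycentric K' C' g' b' .
  obtain c where c: "c \<in> C" "F = k.face c" using F(1) k.facet_iff by auto
  obtain c' where c': "c' \<in> C'" "F = k'.face c'" using F(2) k'.facet_iff by auto
  obtain s where s: "s < 0" "g' c' = s *\<^sub>R g c"
    using opposite_elements[OF mesh K k.barycentric_axioms k'.barycentric_axioms c(1) c'(1)
        trans[OF c(2)[symmetric] c'(2)]] by blast
  show ?thesis
    using k.outward_normal_face[OF c(1)] k'.outward_normal_face[OF c'(1)] s c(2) c'(2) by simp
qed

lemma norm_mesh_normal:
  fixes \<T> :: "(real^'n) set set"
  assumes mesh: "conforming_mesh \<Omega> \<T>" and K: "K \<in> \<T>" and F: "F facet_of K"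
  shows "norm (outward_normal K F) = 1"
proof -
  obtain C g b where "barycentric K C g b" using mesh_barycentric[OF mesh K] .
  then interpret k: barycentric K C g b .
  show ?thesis using F k.facet_iff k.norm_outward_normal by auto
qed

text \<open>At a relative interior point of F, a small step across F leaves K but not \<Omega>;
  since the other elements have a closed union, one of them contains the point. Its intersection
  with K is a proper face of K that contains F, hence F itself by dimension.\<close>

lemma mesh_neighbor_exists:
  fixes \<T> :: "(real^'n) set set"
  assumes om: "open \<Omega>" and mesh: "conforming_mesh \<Omega> \<T>" and K: "K \<in> \<T>"
    and F: "F facet_of K" and sub: "rel_interior F \<subseteq> \<Omega>"
  obtains K' where "K' \<in> \<T>" "K' \<noteq> K" "F facet_of K'"
proof -
  obtain C g b where "barycentric K C g b" using mesh_barycentric[OF mesh K] .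
  then interpret k: barycentric K C g b .
  obtain c where c: "c \<in> C" "F = k.face c" using F k.facet_iff by auto
  have "convex F" using k.face_hull[OF c(1)] c(2) by simp
  then obtain x where x: "x \<in> rel_interior F"
    using rel_interior_eq_empty k.face_nonempty[OF c(1)] c(2) by blast
  have fin: "finite \<T>" and simp: "\<And>K. K \<in> \<T> \<Longrightarrow> int CARD('n) simplex K" and un: "\<Union>\<T> = closure \<Omega>"
    and face: "\<And>K K'. K \<in> \<T> \<Longrightarrow> K' \<in> \<T> \<Longrightarrow> (K \<inter> K') face_of K"
    using mesh by (auto simp: conforming_mesh_def triangulation_def)
  have "x \<in> \<Union>(\<T> - {K})"
  proof (rule ccontr)
    assume "x \<notin> \<Union>(\<T> - {K})"
    moreover have "closed (\<Union>(\<T> - {K}))"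
    proof (rule closed_Union)
      show "\<forall>S\<in>\<T> - {K}. closed S"
      proof
        fix S assume "S \<in> \<T> - {K}"
        then obtain C' g' b' where "barycentric S C' g' b'" using mesh_barycentric[OF mesh] by blast
        then show "closed S" by (rule barycentric.closed_K)
      qed
    qed (use fin in auto)
    ultimately have "open (\<Omega> - \<Union>(\<T> - {K}))" "x \<in> \<Omega> - \<Union>(\<T> - {K})" using om sub x by (auto intro: open_Diff)
    then obtain e where e: "e > 0" "ball x e \<subseteq> \<Omega> - \<Union>(\<T> - {K})" by (meson open_contains_ball)
    define y where "y = x + (- (e / (2 * norm (g c)))) *\<^sub>R g c"
    have "dist x y < e" using e(1) k.norm_g_pos[OF c(1)] by (simp add: y_def dist_norm)
    then have "y \<in> \<Omega>" "y \<notin> \<Union>(\<T> - {K})" using e(2) by auto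
    moreover have "y \<notin> K"
    proof -
      have "k.lam c y = - (e / (2 * norm (g c)) * (g c \<bullet> g c))"
        unfolding y_def k.lam_add using x k.rel_interior_face[OF c(1)] c(2) by simp
      then have "k.lam c y < 0" using e(1) k.g_nonzero[OF c(1)] by simp
      then show ?thesis using k.K_iff c(1) by force
    qed
    ultimately show False using un closure_subset[of \<Omega>] by blast
  qed
  then obtain K' where K': "K' \<in> \<T>" "K' \<noteq> K" "x \<in> K'" by auto
  have "F \<subseteq> K" using F facet_of_imp_subset by blast
  have "K \<inter> K' \<inter> rel_interior F \<noteq> {}"
    using x K'(3) \<open>F \<subseteq> K\<close> rel_interior_subset[of F] by blast
  then have FK: "F \<subseteq> K \<inter> K'" using subset_of_face_of[OF face[OF K K'(1)] \<open>F \<subseteq> K\<close>] by blast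
  have "K \<inter> K' \<noteq> K"
  proof
    assume "K \<inter> K' = K"
    then have "interior K \<subseteq> interior K'" by (intro interior_mono) auto
    moreover have "interior K \<inter> interior K' = {}"
      using mesh_interiors_disjoint[OF mesh K K'(1)] K'(2) by simp
    ultimately show False using k.interior_nonempty by blast
  qed
  then have lt: "aff_dim (K \<inter> K') < aff_dim K" by (intro face_of_aff_dim_lt k.convex_K face K K'(1))
  have "F face_of (K \<inter> K')" by (rule face_of_subset[of F K]) (use F FK in \<open>auto simp: facet_of_def\<close>)
  moreover have "convex (K \<inter> K')" using face[OF K K'(1)] face_of_imp_convex k.convex_K by blast
  moreover have "aff_dim F = aff_dim K - 1" using F by (simp add: facet_of_def)
  ultimately have "F = K \<inter> K'" using lt face_of_aff_dim_lt[of "K \<inter> K'" F] by (cases "F = K \<inter> K'") auto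
  moreover have "(K' \<inter> K) face_of K'" using face K K'(1) by blast
  moreover have "aff_dim K = aff_dim K'" using aff_dim_simplex[OF simp[OF K]] aff_dim_simplex[OF simp[OF K'(1)]] by simp
  ultimately have "F facet_of K'" using F by (auto simp: facet_of_def Int_commute)
  with K' show thesis using that by blast
qed

text \<open>The normals of two elements at a common facet are opposite, and three unit vectors
  cannot be pairwise opposite.\<close>

lemma mesh_neighbor_unique:
  fixes \<T> :: "(real^'n) set set"
  assumes mesh: "conforming_mesh \<Omega> \<T>" and K: "K \<in> \<T>" "K1 \<in> \<T>" "K2 \<in> \<T>" "K1 \<noteq> K" "K2 \<noteq> K"
    and F: "F facet_of K" "F facet_of K1" "F facet_of K2"
  shows "K1 = K2"
proof (rule ccontr)
  assume ne: "K1 \<noteq> K2"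
  have "outward_normal K1 F = - outward_normal K F" "outward_normal K2 F = - outward_normal K F"
      "outward_normal K2 F = - outward_normal K1 F"
    using opposite_outward_normal[OF mesh K(1,2) _ F(1,2)] opposite_outward_normal[OF mesh K(1,3) _ F(1,3)]
      opposite_outward_normal[OF mesh K(2,3) ne F(2,3)] K(4,5) by auto
  then have "2 *\<^sub>R outward_normal K F = 0" by (metis add.right_inverse minus_minus scaleR_2)
  then have "outward_normal K F = 0" by (simp only: scaleR_eq_0_iff) simp
  then show False using norm_mesh_normal[OF mesh K(1) F(1)] by simp
qed

text \<open>One relative interior point of F suffices: a small ball around it is cut by F into half
  balls inside K and K', where \<L> is constant.\<close>

lemma mesh_normal_component:
  fixes \<T> :: "(real^'n::finite) set set" and \<L> :: "'n \<Rightarrow> real^'n \<Rightarrow> real^'l^'l"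
  assumes om: "open \<Omega>" and adm: "admissible_coefficients \<Omega> \<L> \<G>" and mesh: "conforming_mesh \<Omega> \<T>"
    and K: "K \<in> \<T>" "K' \<in> \<T>" "K \<noteq> K'" and F: "F facet_of K" "F facet_of K'" and sub: "rel_interior F \<subseteq> \<Omega>"
    and A: "\<And>j x. x \<in> interior K \<Longrightarrow> \<L> j x = A j" and A': "\<And>j x. x \<in> interior K' \<Longrightarrow> \<L> j x = A' j"
  shows "(\<Sum>j\<in>UNIV. (outward_normal K F $ j) *\<^sub>R A j) = (\<Sum>j\<in>UNIV. (outward_normal K F $ j) *\<^sub>R A' j)"
proof -
  obtain C g b where "barycentric K C g b" using mesh_barycentric[OF mesh K(1)] .
  then interpret k: barycentric K C g b .
  obtain C' g' b' where "barycentric K' C' g' b'" using mesh_barycentric[OF mesh K(2)] .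
  then interpret k': barycentric K' C' g' b' .
  obtain c where c: "c \<in> C" "F = k.face c" using F(1) k.facet_iff by auto
  obtain c' where c': "c' \<in> C'" "F = k'.face c'" using F(2) k'.facet_iff by auto
  obtain s where s: "s < 0" "\<And>x. k'.lam c' x = s * k.lam c x"
    using opposite_elements[OF mesh K k.barycentric_axioms k'.barycentric_axioms c(1) c'(1)
        trans[OF c(2)[symmetric] c'(2)]] by blast
  have "convex F" using k.face_hull[OF c(1)] c(2) by simp
  then obtain x where x: "x \<in> rel_interior F"
    using rel_interior_eq_empty k.face_nonempty[OF c(1)] c(2) by blast
  obtain r1 where r1: "r1 > 0" "\<And>y. y \<in> ball x r1 \<Longrightarrow> 0 < k.lam c y \<Longrightarrow> y \<in> interior K"
    using k.half_ball_in_interior[OF c(1)] x c(2) by blast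
  obtain r2 where r2: "r2 > 0" "\<And>y. y \<in> ball x r2 \<Longrightarrow> 0 < k'.lam c' y \<Longrightarrow> y \<in> interior K'"
    using k'.half_ball_in_interior[OF c'(1)] x c'(2) by blast
  have "x \<in> \<Omega>" using x sub by blast
  then obtain r3 where r3: "r3 > 0" "cball x r3 \<subseteq> \<Omega>" using om open_contains_cball by blast
  define r where "r = min r1 (min r2 r3)"
  have lx: "k.lam c x = 0" using x k.rel_interior_face[OF c(1)] c(2) by simp
  have side: "outward_normal K F \<bullet> (y - x) = - k.lam c y / norm (g c)" for y
    unfolding c(2) k.outward_normal_face[OF c(1)]
    using k.lam_diff[of c y x] lx by (simp add: divide_inverse)
  show ?thesis
  proof (rule normal_component_continuous[OF adm])
    show "r > 0" "cball x r \<subseteq> \<Omega>" using r1(1) r2(1) r3 by (auto simp: r_def)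
    show "norm (outward_normal K F) = 1" by (rule norm_mesh_normal[OF mesh K(1) F(1)])
    show "\<L> j y = A j" if "y \<in> ball x r" "outward_normal K F \<bullet> (y - x) < 0" for j y
    proof (rule A, rule r1(2))
      show "y \<in> ball x r1" using that by (simp add: r_def)
      show "0 < k.lam c y" using that(2) k.norm_g_pos[OF c(1)] unfolding side by (simp add: field_simps)
    qed
    show "\<L> j y = A' j" if "y \<in> ball x r" "outward_normal K F \<bullet> (y - x) > 0" for j y
    proof (rule A', rule r2(2))
      show "y \<in> ball x r2" using that by (simp add: r_def)
      have "k.lam c y < 0" using that(2) k.norm_g_pos[OF c(1)] unfolding side by (simp add: field_simps)
      then show "0 < k'.lam c' y" using s by (simp add: mult_neg_neg)
    qed
  qed
qed

section \<open>Piecewise constant functions on a tent\<close>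

lemma partial_deriv_affine:
  assumes U: "open U" "x \<in> U" and f: "\<And>y. y \<in> U \<Longrightarrow> f y = q \<bullet> y + \<beta>"
  shows "partial_deriv j f x = q $ j"
proof -
  have "((\<lambda>y. q \<bullet> y + \<beta>) has_derivative (\<lambda>y. q \<bullet> y)) (at x)"
    by (auto intro!: derivative_eq_intros)
  then have "(f has_derivative (\<lambda>y. q \<bullet> y)) (at x)"
    by (rule has_derivative_transform_within_open[OF _ U]) (simp add: f)
  then show ?thesis by (simp add: partial_deriv_eqI inner_axis)
qed

lemma element_trace_eq:
  assumes x: "x \<in> closure (interior K)" and f: "\<And>y. y \<in> interior K \<Longrightarrow> f y = l"
  shows "element_trace K f x = l"
  unfolding element_trace_def
proof (rule tendsto_Lim)
  have "x islimpt interior K"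
    using x interior_limit_point[of x "interior K"] by (auto simp: closure_def)
  then show "\<not> trivial_limit (at x within interior K)" by (simp add: trivial_limit_within)
  show "(f \<longlongrightarrow> l) (at x within interior K)"
    by (rule tendsto_eventually) (auto simp: eventually_at_filter f)
qed

text \<open>Extracts the constant of a function that is constant on the interior of K.\<close>

definition val :: "'a::topological_space set \<Rightarrow> ('a \<Rightarrow> 'b) \<Rightarrow> 'b"
  where "val K f = f (SOME x. x \<in> interior K)"

lemma val_eqI:
  assumes "interior K \<noteq> {}" "\<And>y. y \<in> interior K \<Longrightarrow> f y = l"
  shows "val K f = l"
  using assms unfolding val_def by (metis some_in_eq)

text \<open>The hypotheses on one tent. The coercivity constant \<open>g0\<close> of \<G> is a
  parameter so that the final constant can be fixed before mesh and tent are chosen.\<close>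

locale tent_setup = tent_dg \<Omega> \<L> \<G> \<T> vtx \<phi>b \<phi>t S B
  for \<Omega> :: "(real^'n) set" and \<L> :: "'n \<Rightarrow> real^'n \<Rightarrow> real^'l^'l" and \<G> :: "real^'n \<Rightarrow> real^'l^'l"
    and \<T> :: "(real^'n) set set" and vtx :: "real^'n" and \<phi>b \<phi>t :: "real^'n \<Rightarrow> real"
    and S B :: "(real^'n) set \<Rightarrow> real^'n \<Rightarrow> real^'l^'l" +
  fixes c' \<sigma> \<Gamma> g0 :: real
  assumes open_\<Omega>: "open \<Omega>"
    and adm: "admissible_coefficients \<Omega> \<L> \<G>"
    and speed: "wave_speed \<Omega> \<L> \<G> < c'"
    and mesh: "conforming_mesh \<Omega> \<T>"
    and shape: "shape_regular \<sigma> \<T>"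
    and \<L>_const: "\<And>j. elementwise_constant \<T> (\<L> j)"
    and \<G>_const: "elementwise_constant \<T> \<G>"
    and causal: "causal_tent c' \<T> vtx \<phi>b \<phi>t"
    and fluxc: "flux_conditions \<Gamma> \<Omega> \<L> \<T> S B"
    and g0: "g0 > 0" "\<And>x e. x \<in> \<Omega> \<Longrightarrow> (\<G> x *v e) \<bullet> e \<ge> g0 * (norm e)\<^sup>2"
begin

abbreviation P where "P \<equiv> patch \<T> vtx"
abbreviation vol where "vol K \<equiv> measure lebesgue K"

lemma P_sub: "K \<in> P \<Longrightarrow> K \<in> \<T>" by (simp add: patch_def)

lemma finite_P: "finite P"
  using mesh by (simp add: patch_def conforming_mesh_def triangulation_def)

lemma patch_barycentric:
  assumes "K \<in> P"
  obtains C g b where "barycentric K C g b" "vtx \<in> C"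
proof -
  obtain C g b where b: "barycentric K C g b" using mesh_barycentric[OF mesh P_sub[OF assms]] .
  moreover have "vtx \<in> C" using assms barycentric.extreme_point_iff[OF b] by (simp add: patch_def)
  ultimately show thesis using that by blast
qed

lemma interior_ne: "K \<in> P \<Longrightarrow> interior K \<noteq> {}"
  using patch_barycentric barycentric.interior_nonempty by metis

lemma vol_pos: "K \<in> P \<Longrightarrow> 0 < vol K"
  using patch_barycentric barycentric.volume_pos by metis

lemma patch_disjoint: "K \<in> P \<Longrightarrow> K' \<in> P \<Longrightarrow> x \<in> interior K \<Longrightarrow> x \<in> interior K' \<Longrightarrow> K = K'"
  using mesh_interiors_disjoint[OF mesh P_sub P_sub] by blast

lemma val_interior: "K \<in> P \<Longrightarrow> val K f = l \<Longrightarrow> f constant_on interior K \<Longrightarrow> x \<in> interior K \<Longrightarrow> f x = l"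
  using val_eqI[OF interior_ne] unfolding constant_on_def by metis

lemma \<L>_val: "K \<in> P \<Longrightarrow> x \<in> interior K \<Longrightarrow> \<L> j x = val K (\<L> j)"
  using \<L>_const[of j] P_sub by (intro val_interior[OF _ refl]) (auto simp: elementwise_constant_def)

lemma \<G>_val: "K \<in> P \<Longrightarrow> x \<in> interior K \<Longrightarrow> \<G> x = val K \<G>"
  using \<G>_const P_sub by (intro val_interior[OF _ refl]) (auto simp: elementwise_constant_def)

lemma interior_sub: "K \<in> P \<Longrightarrow> interior K \<subseteq> \<Omega>"
  using mesh P_sub by (auto simp: conforming_mesh_def)

lemma some_interior: "K \<in> P \<Longrightarrow> (SOME x. x \<in> interior K) \<in> interior K"
  using interior_ne by (simp add: some_in_eq)

text \<open>\<open>normal_matrix\<close> on K for an arbitrary vector q. Linearity in q lets it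
  serve normals, front gradients and the divergence theorem alike.\<close>

definition dirm :: "(real^'n) set \<Rightarrow> real^'n \<Rightarrow> real^'l^'l"
  where "dirm K q = (\<Sum>j\<in>UNIV. (q $ j) *\<^sub>R val K (\<L> j))"

lemma dirm_normal_matrix: "K \<in> P \<Longrightarrow> x \<in> interior K \<Longrightarrow> normal_matrix \<L> q x = dirm K q"
  by (simp add: normal_matrix_def dirm_def \<L>_val)

lemma dirm_mult: "dirm K q *v w = (\<Sum>j\<in>UNIV. (q $ j) *\<^sub>R (val K (\<L> j) *v w))"
  using normal_matrix_mult_vec[of "\<lambda>j x. val K (\<L> j)" q undefined w] by (simp add: dirm_def normal_matrix_def)

lemma dirm_add: "dirm K (p + q) = dirm K p + dirm K q"
  by (simp add: dirm_def scaleR_add_left sum.distrib)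

lemma dirm_scale: "dirm K (t *\<^sub>R q) = t *\<^sub>R dirm K q"
  by (simp add: dirm_def scaleR_sum_right)

lemma dirm_zero: "dirm K 0 = 0" by (simp add: dirm_def)

lemma dirm_minus: "dirm K (- q) = - dirm K q"
  by (simp add: dirm_def sum_negf)

lemma dirm_sum: "dirm K (\<Sum>i\<in>A. f i) = (\<Sum>i\<in>A. dirm K (f i))"
  by (induction A rule: infinite_finite_induct) (auto simp: dirm_add dirm_zero)

lemma dirm_symmetric: assumes "K \<in> P" shows "transpose (dirm K q) = dirm K q"
proof -
  have x: "(SOME x. x \<in> interior K) \<in> \<Omega>" using some_interior interior_sub assms by blast
  show ?thesis
    using transpose_normal_matrix[of \<L> "SOME x. x \<in> interior K" q] adm x dirm_normal_matrix[OF assms some_interior[OF assms]]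
    by (auto simp: admissible_coefficients_def)
qed

definition grad_val :: "(real^'n \<Rightarrow> real) \<Rightarrow> (real^'n) set \<Rightarrow> real^'n"
  where "grad_val \<phi> K = val K (grad \<phi>)"

lemma speed_nonneg: assumes "K \<in> P" shows "0 \<le> wave_speed \<Omega> \<L> \<G>"
proof -
  have x: "(SOME x. x \<in> interior K) \<in> \<Omega>" using some_interior interior_sub assms by blast
  have "norm (axis undefined 1 :: real^'n) = 1" by simp
  then show ?thesis using wave_speed_bound(2)[OF adm x] by blast
qed

lemma c'_pos: "K \<in> P \<Longrightarrow> 0 < c'" using speed_nonneg speed by fastforce

lemma
  assumes K: "K \<in> P" and \<phi>: "\<phi> \<in> {\<phi>b, \<phi>t}"
  shows front_affine: "\<exists>\<beta>. \<forall>x\<in>K. \<phi> x = grad_val \<phi> K \<bullet> x + \<beta>"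
    and front_deriv: "x \<in> interior K \<Longrightarrow> partial_deriv j \<phi> x = grad_val \<phi> K $ j"
    and front_norm: "norm (grad_val \<phi> K) \<le> 1 / c'"
proof -
  have "\<exists>q \<beta>. \<forall>x\<in>K. \<phi> x = q \<bullet> x + \<beta>"
    and nm: "\<And>x. x \<in> interior K \<Longrightarrow> norm (grad \<phi> x) \<le> 1 / c'"
    using causal K \<phi> unfolding causal_tent_def by auto
  then obtain q \<beta> where q: "\<forall>x\<in>K. \<phi> x = q \<bullet> x + \<beta>" by auto
  have pd: "partial_deriv j \<phi> x = q $ j" if "x \<in> interior K" for x j
    by (rule partial_deriv_affine[OF open_interior that]) (use q interior_subset in auto)
  then have gr: "grad \<phi> x = q" if "x \<in> interior K" for x
    using that by (simp add: grad_def vec_eq_iff)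
  then have gv: "grad_val \<phi> K = q" unfolding grad_val_def by (intro val_eqI interior_ne K)
  show "\<exists>\<beta>. \<forall>x\<in>K. \<phi> x = grad_val \<phi> K \<bullet> x + \<beta>" unfolding gv using q by (rule exI)
  show "x \<in> interior K \<Longrightarrow> partial_deriv j \<phi> x = grad_val \<phi> K $ j" unfolding gv by (rule pd)
  show "norm (grad_val \<phi> K) \<le> 1 / c'"
    unfolding gv using nm[OF some_interior[OF K]] gr[OF some_interior[OF K]] by simp
qed

definition grad\<delta> :: "(real^'n) set \<Rightarrow> real^'n"
  where "grad\<delta> K = grad_val \<phi>t K - grad_val \<phi>b K"

lemma
  assumes K: "K \<in> P"
  shows \<delta>_affine: "\<exists>\<beta>. \<forall>x\<in>K. \<delta> x = grad\<delta> K \<bullet> x + \<beta>"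
    and \<delta>_deriv: "x \<in> interior K \<Longrightarrow> partial_deriv j \<delta> x = grad\<delta> K $ j"
    and grad\<delta>_norm: "norm (grad\<delta> K) \<le> 2 / c'"
proof -
  obtain \<beta>1 where 1: "\<forall>x\<in>K. \<phi>b x = grad_val \<phi>b K \<bullet> x + \<beta>1" using front_affine[OF K, of \<phi>b] by auto
  obtain \<beta>2 where 2: "\<forall>x\<in>K. \<phi>t x = grad_val \<phi>t K \<bullet> x + \<beta>2" using front_affine[OF K, of \<phi>t] by auto
  have eq: "\<forall>x\<in>K. \<delta> x = grad\<delta> K \<bullet> x + (\<beta>2 - \<beta>1)"
    using 1 2 by (auto simp: \<delta>_def grad\<delta>_def inner_diff_left)
  then show "\<exists>\<beta>. \<forall>x\<in>K. \<delta> x = grad\<delta> K \<bullet> x + \<beta>" by (rule exI)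
  show "partial_deriv j \<delta> x = grad\<delta> K $ j" if "x \<in> interior K"
    by (rule partial_deriv_affine[OF open_interior that]) (use eq interior_subset in auto)
  show "norm (grad\<delta> K) \<le> 2 / c'"
    using norm_triangle_ineq4[of "grad_val \<phi>t K" "grad_val \<phi>b K"] front_norm[OF K, of \<phi>b] front_norm[OF K, of \<phi>t]
    by (simp add: grad\<delta>_def)
qed

section \<open>Piecewise constants and their inner product\<close>

lemma Vh_val: "v \<in> V\<^sub>h \<Longrightarrow> K \<in> P \<Longrightarrow> x \<in> interior K \<Longrightarrow> v x = val K v"
  by (rule val_interior[OF _ refl]) (simp_all add: V\<^sub>h_def elementwise_constant_def)

lemma Vh_zero: "v \<in> V\<^sub>h \<Longrightarrow> x \<notin> \<Union>(interior ` P) \<Longrightarrow> v x = 0"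
  by (simp add: V\<^sub>h_def)

definition pw :: "((real^'n) set \<Rightarrow> real^'l) \<Rightarrow> real^'n \<Rightarrow> real^'l"
  where "pw y x = (\<Sum>K\<in>P. indicator (interior K) x *\<^sub>R y K)"

lemma pw_interior: assumes "K \<in> P" "x \<in> interior K" shows "pw y x = y K"
proof -
  have "pw y x = (\<Sum>K'\<in>P. if K' = K then y K else 0)"
    unfolding pw_def
  proof (rule sum.cong[OF refl])
    fix K' assume K': "K' \<in> P"
    show "indicator (interior K') x *\<^sub>R y K' = (if K' = K then y K else 0)"
    proof (cases "K' = K")
      case False
      then have "x \<notin> interior K'" using patch_disjoint[OF assms(1) K' assms(2)] by blast
      then show ?thesis using False by simp
    qed (use assms(2) in simp)
  qed
  then show ?thesis using assms finite_P by simp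
qed

lemma pw_outside: "x \<notin> \<Union>(interior ` P) \<Longrightarrow> pw y x = 0"
  unfolding pw_def by (intro sum.neutral) auto

lemma pw_Vh: "pw y \<in> V\<^sub>h"
  unfolding V\<^sub>h_def elementwise_constant_def constant_on_def using pw_interior pw_outside by auto

lemma val_pw: "K \<in> P \<Longrightarrow> val K (pw y) = y K"
  using pw_interior interior_ne by (intro val_eqI) auto

lemma VhI:
  assumes "\<And>K x. K \<in> P \<Longrightarrow> x \<in> interior K \<Longrightarrow> v x = y K" "\<And>x. x \<notin> \<Union>(interior ` P) \<Longrightarrow> v x = 0"
  shows "v \<in> V\<^sub>h" "\<And>K. K \<in> P \<Longrightarrow> val K v = y K"
proof -
  show "v \<in> V\<^sub>h" unfolding V\<^sub>h_def elementwise_constant_def constant_on_def using assms by auto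
  show "\<And>K. K \<in> P \<Longrightarrow> val K v = y K" using assms(1) interior_ne by (intro val_eqI) auto
qed

lemma Vh_ext:
  assumes "v \<in> V\<^sub>h" "w \<in> V\<^sub>h" "\<And>K. K \<in> P \<Longrightarrow> val K v = val K w"
  shows "v = w"
proof
  fix x
  show "v x = w x"
  proof (cases "x \<in> \<Union>(interior ` P)")
    case True
    then obtain K where "K \<in> P" "x \<in> interior K" by blast
    then show ?thesis using Vh_val[OF assms(1)] Vh_val[OF assms(2)] assms(3) by metis
  next
    case False
    then show ?thesis using Vh_zero[OF assms(1) False] Vh_zero[OF assms(2) False] by (simp only:)
  qed
qed

lemma Vh_lincomb:
  assumes "v \<in> V\<^sub>h" "w \<in> V\<^sub>h"
  shows "(\<lambda>x. s *\<^sub>R v x + t *\<^sub>R w x) \<in> V\<^sub>h"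
    and "K \<in> P \<Longrightarrow> val K (\<lambda>x. s *\<^sub>R v x + t *\<^sub>R w x) = s *\<^sub>R val K v + t *\<^sub>R val K w"
  using VhI[of "\<lambda>x. s *\<^sub>R v x + t *\<^sub>R w x" "\<lambda>K. s *\<^sub>R val K v + t *\<^sub>R val K w"]
    Vh_val[OF assms(1)] Vh_val[OF assms(2)] Vh_zero[OF assms(1)] Vh_zero[OF assms(2)] by auto

lemma inner_patch_eq:
  assumes w: "w \<in> V\<^sub>h" and v: "v \<in> V\<^sub>h"
  shows "inner_patch w v = (\<Sum>K\<in>P. vol K * (val K w \<bullet> val K v))"
proof -
  have eq: "indicator (\<Union>P) x *\<^sub>R (w x \<bullet> v x) = (\<Sum>K\<in>P. indicator (interior K) x *\<^sub>R (val K w \<bullet> val K v))" for x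
  proof (cases "x \<in> \<Union>(interior ` P)")
    case True
    then obtain K where K: "K \<in> P" "x \<in> interior K" by blast
    have "(\<Sum>K'\<in>P. indicator (interior K') x *\<^sub>R (val K' w \<bullet> val K' v)) = (\<Sum>K'\<in>P. if K' = K then val K w \<bullet> val K v else 0)"
    proof (rule sum.cong[OF refl])
      fix K' assume K': "K' \<in> P"
      show "indicator (interior K') x *\<^sub>R (val K' w \<bullet> val K' v) = (if K' = K then val K w \<bullet> val K v else 0)"
      proof (cases "K' = K")
        case False
        then have "x \<notin> interior K'" using patch_disjoint[OF K(1) K' K(2)] by blast
        then show ?thesis using False by simp
      qed (use K(2) in simp)
    qed
    moreover have "x \<in> \<Union>P" using K interior_subset by blast
    ultimately show ?thesis using K finite_P Vh_val[OF w K] Vh_val[OF v K] by simp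
  next
    case False
    then have "(\<Sum>K\<in>P. indicator (interior K) x *\<^sub>R (val K w \<bullet> val K v)) = 0" by (intro sum.neutral) auto
    then show ?thesis using Vh_zero[OF w False] by simp
  qed
  have bd: "bounded K" "negligible (frontier K)" if K: "K \<in> P" for K
  proof -
    obtain C g b where b: "barycentric K C g b" using patch_barycentric[OF K] by blast
    show "bounded K" using barycentric.compact_K[OF b] by (rule compact_imp_bounded)
    show "negligible (frontier K)" by (rule barycentric.negligible_frontier_K[OF b])
  qed
  have lm: "interior K \<in> lmeasurable" if "K \<in> P" for K
    using bd[OF that] bounded_subset interior_subset by (intro lmeasurable_open) auto
  have "inner_patch w v = (LINT x|lebesgue. (\<Sum>K\<in>P. indicator (interior K) x *\<^sub>R (val K w \<bullet> val K v)))"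
    unfolding inner_patch_def set_lebesgue_integral_def eq ..
  also have "\<dots> = (\<Sum>K\<in>P. LINT x|lebesgue. indicator (interior K) x *\<^sub>R (val K w \<bullet> val K v))"
    using lm by (intro Bochner_Integration.integral_sum integrable_scaleR_left) (auto simp: fmeasurable_def)
  also have "\<dots> = (\<Sum>K\<in>P. vol K * (val K w \<bullet> val K v))"
  proof (intro sum.cong refl)
    fix K assume K: "K \<in> P"
    have "(LINT x|lebesgue. indicator (interior K) x *\<^sub>R (val K w \<bullet> val K v)) = measure lebesgue (interior K) *\<^sub>R (val K w \<bullet> val K v)"
      using lm[OF K] by (simp add: fmeasurable_def)
    also have "measure lebesgue (interior K) = vol K" using bd[OF K] by (rule measure_interior)
    finally show "(LINT x|lebesgue. indicator (interior K) x *\<^sub>R (val K w \<bullet> val K v)) = vol K * (val K w \<bullet> val K v)" by simp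
  qed
  finally show ?thesis .
qed

lemma inner_patch_lincomb:
  assumes "u \<in> V\<^sub>h" "v \<in> V\<^sub>h" "w \<in> V\<^sub>h"
  shows "inner_patch (\<lambda>x. s *\<^sub>R u x + t *\<^sub>R v x) w = s * inner_patch u w + t * inner_patch v w"
  using assms Vh_lincomb[OF assms(1,2)]
  by (simp add: inner_patch_eq inner_add_left sum_distrib_left sum.distrib distrib_left mult_ac)

lemma inner_patch_commute: "inner_patch u v = inner_patch v u"
  by (simp add: inner_patch_def inner_commute)

lemma inner_patch_definite:
  assumes v: "v \<in> V\<^sub>h" and z: "inner_patch v v = 0"
  shows "v = (\<lambda>x. 0)"
proof (rule Vh_ext[OF v])
  show "(\<lambda>x. 0) \<in> V\<^sub>h" by (rule VhI(1)[where y = "\<lambda>K. 0"]) auto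
  fix K assume K: "K \<in> P"
  have "vol K * (val K v \<bullet> val K v) = 0"
    using z v K vol_pos finite_P unfolding inner_patch_eq[OF v v]
    by (subst (asm) sum_nonneg_eq_0_iff) (auto intro: mult_nonneg_nonneg)
  then show "val K v = val K (\<lambda>x. 0)" using vol_pos[OF K] by (simp add: val_def)
qed

lemma Vh_eqI:
  assumes u: "u \<in> V\<^sub>h" and w: "w \<in> V\<^sub>h" and eq: "\<And>v. v \<in> V\<^sub>h \<Longrightarrow> inner_patch u v = inner_patch w v"
  shows "u = w"
proof -
  let ?e = "\<lambda>x. 1 *\<^sub>R u x + (- 1) *\<^sub>R w x"
  have e: "?e \<in> V\<^sub>h" by (rule Vh_lincomb[OF u w])
  have "inner_patch ?e ?e = 0" unfolding inner_patch_lincomb[OF u w e] using eq[OF e] by simp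
  then have "?e = (\<lambda>x. 0)" by (rule inner_patch_definite[OF e])
  then have "?e x = 0" for x by (rule fun_cong)
  then show "u = w" by (simp add: fun_eq_iff)
qed

section \<open>The elementwise matrices of M\<close>

definition Mmat :: "real \<Rightarrow> (real^'n) set \<Rightarrow> real^'l^'l"
  where "Mmat \<tau> K = val K \<G> - dirm K (grad_val \<phi>b K + \<tau> *\<^sub>R grad\<delta> K)"

lemma M1_Vh:
  assumes w: "w \<in> V\<^sub>h"
  shows "M\<^sub>1 w \<in> V\<^sub>h" and "K \<in> P \<Longrightarrow> val K (M\<^sub>1 w) = dirm K (grad\<delta> K) *v val K w"
proof -
  have 1: "M\<^sub>1 w x = dirm K (grad\<delta> K) *v val K w" if K: "K \<in> P" "x \<in> interior K" for K x
  proof -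
    show ?thesis unfolding M\<^sub>1_def dirm_mult using K by (simp add: \<delta>_deriv \<L>_val Vh_val[OF w])
  qed
  have 2: "M\<^sub>1 w x = 0" if "x \<notin> \<Union>(interior ` P)" for x
    unfolding M\<^sub>1_def using Vh_zero[OF w that] by simp
  show "M\<^sub>1 w \<in> V\<^sub>h" "K \<in> P \<Longrightarrow> val K (M\<^sub>1 w) = dirm K (grad\<delta> K) *v val K w"
    using VhI[of "M\<^sub>1 w" "\<lambda>K. dirm K (grad\<delta> K) *v val K w"] 1 2 by auto
qed

lemma M_Vh:
  assumes w: "w \<in> V\<^sub>h"
  shows "M \<tau> w \<in> V\<^sub>h" and "K \<in> P \<Longrightarrow> val K (M \<tau> w) = Mmat \<tau> K *v val K w"
proof -
  have 1: "M \<tau> w x = Mmat \<tau> K *v val K w" if K: "K \<in> P" "x \<in> interior K" for K x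
  proof -
    have "M\<^sub>1 w x = dirm K (grad\<delta> K) *v val K w" using M1_Vh[OF w] Vh_val[OF M1_Vh(1)[OF w] K] K by simp
    moreover have "M\<^sub>0 w x = val K \<G> *v val K w - dirm K (grad_val \<phi>b K) *v val K w"
      unfolding M\<^sub>0_def dirm_mult using K by (simp add: front_deriv \<L>_val \<G>_val Vh_val[OF w])
    ultimately show ?thesis
      by (simp add: M_def Mmat_def dirm_add dirm_scale matrix_vector_mult_diff_rdistrib matrix_vector_mult_add_rdistrib
          scaleR_matrix_vector_assoc)
  qed
  have 2: "M \<tau> w x = 0" if "x \<notin> \<Union>(interior ` P)" for x
    unfolding M_def M\<^sub>0_def using Vh_zero[OF w that] Vh_zero[OF M1_Vh(1)[OF w] that] by simp
  show "M \<tau> w \<in> V\<^sub>h" "K \<in> P \<Longrightarrow> val K (M \<tau> w) = Mmat \<tau> K *v val K w"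
    using VhI[of "M \<tau> w" "\<lambda>K. Mmat \<tau> K *v val K w"] 1 2 by auto
qed

definition m0 :: real
  where "m0 = (1 - wave_speed \<Omega> \<L> \<G> / c') * g0"

lemma m0_pos: "K \<in> P \<Longrightarrow> 0 < m0"
  unfolding m0_def using speed c'_pos g0(1) by (intro mult_pos_pos) (auto simp: field_simps)

lemma Mmat_symmetric: assumes K: "K \<in> P" shows "transpose (Mmat \<tau> K) = Mmat \<tau> K"
proof -
  have "(SOME x. x \<in> interior K) \<in> \<Omega>" using some_interior interior_sub K by blast
  then have "transpose (val K \<G>) = val K \<G>" using adm by (auto simp: admissible_coefficients_def val_def)
  then show ?thesis using dirm_symmetric[OF K, of "grad_val \<phi>b K + \<tau> *\<^sub>R grad\<delta> K"]
    unfolding Mmat_def by (simp add: transpose_def vec_eq_iff)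
qed

text \<open>At pseudo-time \<tau> the front has as gradient a convex combination of the gradients of
  \<phi>b and \<phi>t, of norm at most 1 / c'. By the wave speed bound the subtracted term costs at
  most the fraction \<open>wave_speed\<close> / c' of the energy of \<G>; \<open>m0\<close> is g0
  times what remains.\<close>

lemma Mmat_coercive:
  assumes K: "K \<in> P" and \<tau>: "\<tau> \<in> {0..1}"
  shows "m0 * (norm y)\<^sup>2 \<le> (Mmat \<tau> K *v y) \<bullet> y"
proof -
  define x where "x = (SOME x. x \<in> interior K)"
  have xi: "x \<in> interior K" unfolding x_def by (rule some_interior[OF K])
  then have x: "x \<in> \<Omega>" using interior_sub K by blast
  define q where "q = grad_val \<phi>b K + \<tau> *\<^sub>R grad\<delta> K"
  let ?Gy = "(val K \<G> *v y) \<bullet> y"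
  let ?c = "wave_speed \<Omega> \<L> \<G>"
  have Gy: "g0 * (norm y)\<^sup>2 \<le> ?Gy" using g0(2)[OF x, of y] \<G>_val[OF K xi] by simp
  then have Gy0: "0 \<le> ?Gy" using g0(1) by (meson mult_nonneg_nonneg less_imp_le order_trans zero_le_power2)
  have nb: "norm (grad_val \<phi>b K) \<le> 1 / c'" "norm (grad_val \<phi>t K) \<le> 1 / c'"
    using front_norm[OF K] by auto
  have "q = (1 - \<tau>) *\<^sub>R grad_val \<phi>b K + \<tau> *\<^sub>R grad_val \<phi>t K"
    by (simp add: q_def grad\<delta>_def scaleR_diff_right scaleR_diff_left)
  then have "norm q \<le> (1 - \<tau>) * norm (grad_val \<phi>b K) + \<tau> * norm (grad_val \<phi>t K)"
    using norm_triangle_ineq[of "(1 - \<tau>) *\<^sub>R grad_val \<phi>b K" "\<tau> *\<^sub>R grad_val \<phi>t K"] \<tau> by simp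
  also have "\<dots> \<le> (1 - \<tau>) * (1 / c') + \<tau> * (1 / c')"
    using nb \<tau> by (intro add_mono mult_left_mono) auto
  finally have q: "norm q \<le> 1 / c'" by (simp add: add_divide_distrib[symmetric])
  have "(dirm K q *v y) \<bullet> y \<le> (1 / c') * (?c * ?Gy)"
  proof (cases "q = 0")
    case True
    then show ?thesis using Gy0 speed_nonneg[OF K] c'_pos[OF K] by (simp add: dirm_zero)
  next
    case False
    have "(normal_matrix \<L> (q /\<^sub>R norm q) x *v y) \<bullet> y \<le> ?c * ((\<G> x *v y) \<bullet> y)"
      by (rule wave_speed_bound(1)[OF adm x]) (use False in simp)
    then have "(dirm K (q /\<^sub>R norm q) *v y) \<bullet> y \<le> ?c * ?Gy"
      by (simp add: dirm_normal_matrix[OF K xi] \<G>_val[OF K xi])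
    moreover have "dirm K q = norm q *\<^sub>R dirm K (q /\<^sub>R norm q)" unfolding dirm_scale[symmetric] using False by simp
    ultimately have "(dirm K q *v y) \<bullet> y \<le> norm q * (?c * ?Gy)"
      by (simp add: scaleR_matrix_vector_assoc[symmetric] mult_left_mono)
    also have "\<dots> \<le> (1 / c') * (?c * ?Gy)" using q Gy0 speed_nonneg[OF K] by (intro mult_right_mono) auto
    finally show ?thesis .
  qed
  then have "(1 - ?c / c') * ?Gy \<le> (Mmat \<tau> K *v y) \<bullet> y"
    unfolding Mmat_def q_def[symmetric] by (simp add: matrix_vector_mult_diff_rdistrib inner_diff_left left_diff_distrib)
  moreover have "(1 - ?c / c') * (g0 * (norm y)\<^sup>2) \<le> (1 - ?c / c') * ?Gy"
    using Gy speed c'_pos[OF K] by (intro mult_left_mono) (auto simp: field_simps)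
  ultimately show ?thesis by (simp add: m0_def)
qed

text \<open>\<open>M_inv\<close> is \<open>inv_into\<close>, so surjectivity on
  \<open>V\<^sub>h\<close> is what matters; on each element it follows from coercivity, as injective
  square matrices are surjective.\<close>

lemma M_inv:
  assumes z: "z \<in> V\<^sub>h" and \<tau>: "\<tau> \<in> {0..1}"
  shows "M_inv \<tau> z \<in> V\<^sub>h" "M \<tau> (M_inv \<tau> z) = z"
proof -
  have "\<exists>y. Mmat \<tau> K *v y = val K z" if K: "K \<in> P" for K
  proof -
    have "inj ((*v) (Mmat \<tau> K))"
    proof (rule linear_injective_on_subspace_0[THEN iffD2, OF matrix_vector_mul_linear subspace_UNIV], intro ballI impI)
      fix y assume "Mmat \<tau> K *v y = 0"
      then have "m0 * (norm y)\<^sup>2 \<le> 0" using Mmat_coercive[OF K \<tau>, of y] by simp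
      then show "y = 0" using m0_pos[OF K] by (simp add: mult_le_0_iff)
    qed
    then have "surj ((*v) (Mmat \<tau> K))" by (intro linear_injective_imp_surjective matrix_vector_mul_linear) auto
    then show ?thesis by (metis surj_def)
  qed
  then obtain y where y: "\<And>K. K \<in> P \<Longrightarrow> Mmat \<tau> K *v y K = val K z" by metis
  have "M \<tau> (pw y) = z"
    by (rule Vh_ext[OF M_Vh(1)[OF pw_Vh] z]) (simp add: M_Vh(2)[OF pw_Vh] val_pw y)
  then have "z \<in> M \<tau> ` V\<^sub>h" using pw_Vh by blast
  then show "M_inv \<tau> z \<in> V\<^sub>h" "M \<tau> (M_inv \<tau> z) = z"
    unfolding M_inv_def by (rule inv_into_into, rule f_inv_into_f)
qed

end

section \<open>Facet integrals\<close>

context tent_setup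
begin

text \<open>The facet determines which of the two flux parameters acts; the facts common to both are
  proved once for X.\<close>

definition X :: "(real^'n) set \<Rightarrow> real^'n \<Rightarrow> real^'l^'l"
  where "X F x = (if F \<subseteq> frontier \<Omega> then B F x else S F x)"

definition Dn :: "(real^'n) set \<Rightarrow> (real^'n) set \<Rightarrow> real^'l^'l"
  where "Dn K F = dirm K (outward_normal K F)"

definition \<delta>_int :: "(real^'n) set \<Rightarrow> (real^'n) set \<Rightarrow> real"
  where "\<delta>_int K F = facet_integral K F \<delta>"

text \<open>The integral of \<delta> X over F. Traces of piecewise constants are constant on F, so
  all facet terms are forms in \<open>Q\<close> and multiples of
  \<open>\<delta>_int\<close>.\<close>

definition Q :: "(real^'n) set \<Rightarrow> (real^'n) set \<Rightarrow> real^'l^'l"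
  where "Q K F = (\<chi> i j. facet_integral K F (\<lambda>x. \<delta> x * X F x $ i $ j))"

text \<open>Sides of facets: a facet shared by two elements of the patch occurs twice, which makes
  the exchange of its sides a permutation of pairs.\<close>

definition E :: "((real^'n) set \<times> (real^'n) set) set"
  where "E = (SIGMA K:P. {F. F facet_of K})"

definition facet_measure :: "(real^'n) set \<Rightarrow> (real^'n) set \<Rightarrow> (real^'n) measure"
  where "facet_measure K F = hyperplane_measure (outward_normal K F) (SOME p. p \<in> F)"

lemma facet_integral_eq: "facet_integral K F f = (LINT x|facet_measure K F. indicator F x *\<^sub>R f x)"
  by (simp add: facet_integral_def facet_measure_def set_lebesgue_integral_def)

lemma E_iff: "(K, F) \<in> E \<longleftrightarrow> K \<in> P \<and> F facet_of K" by (auto simp: E_def)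

lemma facet_barycentric:
  assumes "(K, F) \<in> E"
  obtains C g b c where "barycentric K C g b" "vtx \<in> C" "c \<in> C" "F = barycentric.face K g b c"
proof -
  from assms have K: "K \<in> P" and F: "F facet_of K" by (auto simp: E_iff)
  obtain C g b where b: "barycentric K C g b" "vtx \<in> C" using patch_barycentric[OF K] .
  then show thesis using that[OF b] barycentric.facet_iff[OF b(1), of F] F by auto
qed

lemma finite_facets: assumes "K \<in> P" shows "finite {F. F facet_of K}" "card {F. F facet_of K} = CARD('n) + 1"
proof -
  obtain C g b where b: "barycentric K C g b" using patch_barycentric[OF assms] by blast
  interpret k: barycentric K C g b by (rule b)
  have "inj_on k.face C" using k.face_inj by (auto simp: inj_on_def)
  then show "finite {F. F facet_of K}" "card {F. F facet_of K} = CARD('n) + 1"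
    unfolding k.facets_eq using k.finite_C k.card_C by (auto simp: card_image)
qed

lemma finite_E: "finite E" unfolding E_def using finite_P finite_facets by auto

lemma sum_E: "(\<Sum>K\<in>P. \<Sum>F\<in>{F. F facet_of K}. h K F) = (\<Sum>(K, F)\<in>E. h K F)"
  unfolding E_def using finite_P finite_facets by (subst sum.Sigma) auto

lemma \<delta>_other_vertex: "K \<in> P \<Longrightarrow> x extreme_point_of K \<Longrightarrow> x \<noteq> vtx \<Longrightarrow> \<delta> x = 0"
  using causal unfolding causal_tent_def \<delta>_def by simp

lemma \<delta>_nonneg: "K \<in> P \<Longrightarrow> x \<in> K \<Longrightarrow> 0 \<le> \<delta> x"
  using causal unfolding causal_tent_def \<delta>_def by auto

lemma \<delta>_barycentric:
  assumes K: "K \<in> P" and b: "barycentric K C g b" and v: "vtx \<in> C"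
  shows "x \<in> K \<Longrightarrow> \<delta> x = \<delta> vtx * barycentric.lam g b vtx x" and "grad\<delta> K = \<delta> vtx *\<^sub>R g vtx"
proof -
  interpret k: barycentric K C g b by (rule b)
  obtain \<beta> where "\<forall>x\<in>K. \<delta> x = grad\<delta> K \<bullet> x + \<beta>" using \<delta>_affine[OF K] by blast
  then have \<beta>: "\<And>x. x \<in> K \<Longrightarrow> \<delta> x = grad\<delta> K \<bullet> x + \<beta>" by blast
  have z: "\<delta> c = 0" if "c \<in> C" "c \<noteq> vtx" for c
    using \<delta>_other_vertex[OF K] that k.extreme_point_iff by blast
  show "x \<in> K \<Longrightarrow> \<delta> x = \<delta> vtx * k.lam vtx x" using k.affine_vanishing(1)[OF v \<beta> z] .
  show "grad\<delta> K = \<delta> vtx *\<^sub>R g vtx" using k.affine_vanishing(2)[OF v \<beta> z] .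
qed

lemma \<delta>_vtx_nonneg: "K \<in> P \<Longrightarrow> 0 \<le> \<delta> vtx"
  by (rule \<delta>_nonneg) (auto simp: patch_def extreme_point_of_def)

lemma facet_subset: "(K, F) \<in> E \<Longrightarrow> F \<subseteq> K"
  by (simp add: E_iff facet_of_imp_subset)

lemma X_facts:
  assumes e: "(K, F) \<in> E"
  shows "set_borel_measurable borel F (X F)" and "x \<in> F \<Longrightarrow> onorm ((*v) (X F x)) \<le> \<Gamma>"
    and "x \<in> F \<Longrightarrow> 0 \<le> (X F x *v y) \<bullet> y"
proof -
  from e have K: "K \<in> \<T>" and F: "F facet_of K" using P_sub by (auto simp: E_iff)
  note c = fluxc[unfolded flux_conditions_def Let_def]
  have two: "0 \<le> (A *v y) \<bullet> y" if "0 \<le> ((A + transpose A) *v y) \<bullet> y" for A :: "real^'l^'l" and y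
    using that transpose_form[of A y y] by (simp add: matrix_vector_mult_add_rdistrib inner_add_left)
  show "set_borel_measurable borel F (X F)"
  proof (cases "F \<subseteq> frontier \<Omega>")
    case True
    then have "X F = B F" by (simp add: X_def fun_eq_iff)
    then show ?thesis using c K F True by auto
  next
    case False
    then have "X F = S F" by (simp add: X_def fun_eq_iff)
    then show ?thesis using c K F False by auto
  qed
  show "onorm ((*v) (X F x)) \<le> \<Gamma>" if "x \<in> F"
    using c K F that by (cases "F \<subseteq> frontier \<Omega>") (auto simp: X_def)
  have "0 \<le> ((X F x + transpose (X F x)) *v y) \<bullet> y" if "x \<in> F"
    using c K F that by (cases "F \<subseteq> frontier \<Omega>") (auto simp: X_def)
  then show "x \<in> F \<Longrightarrow> 0 \<le> (X F x *v y) \<bullet> y" by (rule two)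
qed

lemma X_entry_bound:
  assumes e: "(K, F) \<in> E" and x: "x \<in> F"
  shows "\<bar>X F x $ i $ j\<bar> \<le> \<Gamma>"
proof -
  have "\<bar>matrix ((*v) (X F x)) $ i $ j\<bar> \<le> onorm ((*v) (X F x))"
    by (rule component_le_onorm) (rule matrix_vector_mul_linear)
  also have "\<dots> \<le> \<Gamma>" by (rule X_facts(2)[OF e x])
  finally show ?thesis by (simp only: matrix_of_matrix_vector_mul)
qed

lemma \<delta>_int_has_integral:
  assumes e: "(K, F) \<in> E"
  shows "has_bochner_integral (facet_measure K F) (\<lambda>x. indicator F x *\<^sub>R \<delta> x) (\<delta>_int K F)"
    and "has_bochner_integral (facet_measure K F) (\<lambda>x. indicator F x *\<^sub>R (\<delta> x * X F x $ i $ j)) (Q K F $ i $ j)"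
proof -
  obtain C g b c where b: "barycentric K C g b" "vtx \<in> C" "c \<in> C" "F = barycentric.face K g b c"
    using facet_barycentric[OF e] .
  interpret k: barycentric K C g b by (rule b)
  from e have K: "K \<in> P" by (simp add: E_iff)
  have \<delta>: "\<delta> x = \<delta> vtx * k.lam vtx x" "0 \<le> k.lam vtx x" "k.lam vtx x \<le> 1" if "x \<in> F" for x
  proof -
    have xK: "x \<in> K" using facet_subset[OF e] that by blast
    show "\<delta> x = \<delta> vtx * k.lam vtx x" by (rule \<delta>_barycentric(1)[OF K b(1,2) xK])
    show "0 \<le> k.lam vtx x" using xK b(2) k.K_iff by blast
    have "k.lam vtx x \<le> (\<Sum>d\<in>C. k.lam d x)" using xK b(2) k.K_iff k.finite_C by (intro member_le_sum) auto
    then show "k.lam vtx x \<le> 1" by (simp add: k.sum_lam)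
  qed
  have cl: "F \<in> sets borel" using k.compact_face[OF b(3)] b(4) by (simp add: compact_imp_closed)
  have v0: "0 \<le> \<delta> vtx" by (rule \<delta>_vtx_nonneg[OF K])
  have bd: "\<bar>\<delta> x\<bar> \<le> \<delta> vtx" if "x \<in> F" for x
    using \<delta>[OF that] v0 by (simp add: abs_mult mult_left_le)
  have "(\<lambda>x. indicator F x *\<^sub>R \<delta> x) = (\<lambda>x. indicator F x *\<^sub>R (\<delta> vtx * k.lam vtx x))"
    using \<delta>(1) by (auto simp: indicator_def fun_eq_iff)
  also have "\<dots> \<in> borel_measurable borel" using cl by measurable
  finally have m1: "(\<lambda>x. indicator F x *\<^sub>R \<delta> x) \<in> borel_measurable borel" .
  have "set_integrable (facet_measure K F) F \<delta>"
    unfolding facet_measure_def b(4)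
    by (rule k.set_integrable_face[OF b(3), where B = "\<delta> vtx"]) (use m1 bd b(4) in \<open>auto simp: set_borel_measurable_def\<close>)
  then show "has_bochner_integral (facet_measure K F) (\<lambda>x. indicator F x *\<^sub>R \<delta> x) (\<delta>_int K F)"
    unfolding set_integrable_def \<delta>_int_def facet_integral_eq by (rule has_bochner_integral_integrable)
  have "(\<lambda>A::real^'l^'l. A $ i $ j) \<in> borel_measurable borel"
    by (intro borel_measurable_continuous_onI continuous_intros)
  from measurable_compose[OF X_facts(1)[OF e, unfolded set_borel_measurable_def] this]
  have "(\<lambda>x. (indicator F x *\<^sub>R X F x) $ i $ j) \<in> borel_measurable borel" .
  with m1 have "(\<lambda>x. (indicator F x *\<^sub>R \<delta> x) * (indicator F x *\<^sub>R X F x) $ i $ j) \<in> borel_measurable borel"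
    by measurable
  also have "(\<lambda>x. (indicator F x *\<^sub>R \<delta> x) * (indicator F x *\<^sub>R X F x) $ i $ j) = (\<lambda>x. indicator F x *\<^sub>R (\<delta> x * X F x $ i $ j))"
    by (auto simp: indicator_def fun_eq_iff)
  finally have m2: "(\<lambda>x. indicator F x *\<^sub>R (\<delta> x * X F x $ i $ j)) \<in> borel_measurable borel" .
  have "set_integrable (facet_measure K F) F (\<lambda>x. \<delta> x * X F x $ i $ j)"
    unfolding facet_measure_def b(4)
  proof (rule k.set_integrable_face[OF b(3), where B = "\<delta> vtx * \<Gamma>"])
    show "set_borel_measurable borel (k.face c) (\<lambda>x. \<delta> x * X (k.face c) x $ i $ j)"
      using m2 b(4) by (simp add: set_borel_measurable_def)
    fix x assume "x \<in> k.face c"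
    then have x: "x \<in> F" using b(4) by simp
    show "\<bar>\<delta> x * X (k.face c) x $ i $ j\<bar> \<le> \<delta> vtx * \<Gamma>"
      unfolding abs_mult b(4)[symmetric] using bd[OF x] X_entry_bound[OF e x] v0 by (intro mult_mono) auto
  qed
  then show "has_bochner_integral (facet_measure K F) (\<lambda>x. indicator F x *\<^sub>R (\<delta> x * X F x $ i $ j)) (Q K F $ i $ j)"
    unfolding set_integrable_def Q_def vec_lambda_beta facet_integral_eq by (rule has_bochner_integral_integrable)
qed

lemma matrix_form_sum: "(A *v y) \<bullet> z = (\<Sum>i\<in>UNIV. \<Sum>j\<in>UNIV. A $ i $ j * (y $ j * z $ i))"
  for A :: "real^'l^'l"
  by (simp add: inner_vec_def matrix_vector_mult_def sum_distrib_right mult.assoc)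

text \<open>One constant and two forms are just what the pointwise estimate on a facet needs: the
  central term with |u|^2, the flux tested with u, and the dissipation.\<close>

lemma facet_has_integral:
  assumes e: "(K, F) \<in> E"
  shows "has_bochner_integral (facet_measure K F)
    (\<lambda>x. indicator F x *\<^sub>R (\<delta> x * (\<alpha> + (X F x *v y) \<bullet> z + (X F x *v y') \<bullet> z')))
    (\<delta>_int K F * \<alpha> + (Q K F *v y) \<bullet> z + (Q K F *v y') \<bullet> z')"
proof -
  have form: "has_bochner_integral (facet_measure K F) (\<lambda>x. \<Sum>i\<in>UNIV. \<Sum>j\<in>UNIV. (indicator F x *\<^sub>R (\<delta> x * X F x $ i $ j)) * (y $ j * z $ i))
      ((Q K F *v y) \<bullet> z)" for y z
    unfolding matrix_form_sum by (intro has_bochner_integral_sum has_bochner_integral_mult_left \<delta>_int_has_integral(2)[OF e])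
  have "has_bochner_integral (facet_measure K F)
    (\<lambda>x. (indicator F x *\<^sub>R \<delta> x) * \<alpha> + (\<Sum>i\<in>UNIV. \<Sum>j\<in>UNIV. (indicator F x *\<^sub>R (\<delta> x * X F x $ i $ j)) * (y $ j * z $ i))
      + (\<Sum>i\<in>UNIV. \<Sum>j\<in>UNIV. (indicator F x *\<^sub>R (\<delta> x * X F x $ i $ j)) * (y' $ j * z' $ i)))
    (\<delta>_int K F * \<alpha> + (Q K F *v y) \<bullet> z + (Q K F *v y') \<bullet> z')"
    by (intro has_bochner_integral_add has_bochner_integral_mult_left \<delta>_int_has_integral(1)[OF e] form)
  moreover have "(indicator F x *\<^sub>R \<delta> x) * \<alpha> + (\<Sum>i\<in>UNIV. \<Sum>j\<in>UNIV. (indicator F x *\<^sub>R (\<delta> x * X F x $ i $ j)) * (y $ j * z $ i))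
      + (\<Sum>i\<in>UNIV. \<Sum>j\<in>UNIV. (indicator F x *\<^sub>R (\<delta> x * X F x $ i $ j)) * (y' $ j * z' $ i))
    = indicator F x *\<^sub>R (\<delta> x * (\<alpha> + (X F x *v y) \<bullet> z + (X F x *v y') \<bullet> z'))" for x
    unfolding matrix_form_sum by (cases "x \<in> F") (simp_all add: distrib_left sum_distrib_left mult.assoc)
  ultimately show ?thesis by simp
qed

lemma facet_integral_form:
  assumes e: "(K, F) \<in> E"
    and f: "\<And>x. x \<in> F \<Longrightarrow> f x = \<delta> x * (\<alpha> + (X F x *v y) \<bullet> z + (X F x *v y') \<bullet> z')"
  shows "facet_integral K F f = \<delta>_int K F * \<alpha> + (Q K F *v y) \<bullet> z + (Q K F *v y') \<bullet> z'"
proof -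
  have "facet_integral K F f = (LINT x|facet_measure K F. indicator F x *\<^sub>R (\<delta> x * (\<alpha> + (X F x *v y) \<bullet> z + (X F x *v y') \<bullet> z')))"
    unfolding facet_integral_eq by (intro Bochner_Integration.integral_cong refl) (simp add: f indicator_def)
  also have "\<dots> = \<delta>_int K F * \<alpha> + (Q K F *v y) \<bullet> z + (Q K F *v y') \<bullet> z'"
    by (rule has_bochner_integral_integral_eq[OF facet_has_integral[OF e]])
  finally show ?thesis .
qed

text \<open>As \<delta> \<ge> 0 on F, an inequality that is affine in X carries over from the points
  of F to \<open>\<delta>_int\<close> and \<open>Q\<close>.\<close>

lemma facet_average_nonneg:
  assumes e: "(K, F) \<in> E"
    and f: "\<And>x. x \<in> F \<Longrightarrow> 0 \<le> \<alpha> + (X F x *v y) \<bullet> z + (X F x *v y') \<bullet> z'"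
  shows "0 \<le> \<delta>_int K F * \<alpha> + (Q K F *v y) \<bullet> z + (Q K F *v y') \<bullet> z'"
  unfolding has_bochner_integral_integral_eq[OF facet_has_integral[OF e], symmetric]
proof (rule integral_nonneg_AE)
  show "AE x in facet_measure K F. 0 \<le> indicator F x *\<^sub>R (\<delta> x * (\<alpha> + (X F x *v y) \<bullet> z + (X F x *v y') \<bullet> z'))"
  proof (rule AE_I2)
    fix x
    have "0 \<le> \<delta> x" if "x \<in> F" using \<delta>_nonneg[of K x] facet_subset[OF e] e that by (auto simp: E_iff)
    then show "0 \<le> indicator F x *\<^sub>R (\<delta> x * (\<alpha> + (X F x *v y) \<bullet> z + (X F x *v y') \<bullet> z'))"
      using f by (cases "x \<in> F") simp_all
  qed
qed

text \<open>The one facet of K without \<open>vtx\<close> lies opposite to it, and \<delta> is a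
  multiple of \<open>lam vtx\<close>. This disposes of the facets off the boundary of \<Omega> whose
  \<open>neighbor\<close> may be unspecified.\<close>

lemma facet_off_vertex:
  assumes e: "(K, F) \<in> E" and v: "vtx \<notin> F"
  shows "x \<in> F \<Longrightarrow> \<delta> x = 0" "\<delta>_int K F = 0" "Q K F = 0"
proof -
  obtain C g b c where b: "barycentric K C g b" "vtx \<in> C" "c \<in> C" "F = barycentric.face K g b c"
    using facet_barycentric[OF e] .
  interpret k: barycentric K C g b by (rule b)
  from e have K: "K \<in> P" by (simp add: E_iff)
  have cv: "c = vtx" using v k.vertex_in_face_iff[OF b(3,2)] b(4) by auto
  show z: "\<delta> x = 0" if "x \<in> F" for x
    using \<delta>_barycentric(1)[OF K b(1,2)] facet_subset[OF e] that b(4) cv by (auto simp: k.face_def)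
  have "facet_integral K F f = 0" if "\<And>x. x \<in> F \<Longrightarrow> f x = 0" for f
  proof -
    have "(\<lambda>x. indicator F x *\<^sub>R f x) = (\<lambda>x. 0)" using that by (auto simp: indicator_def fun_eq_iff)
    then show ?thesis unfolding facet_integral_eq by (simp only: integral_zero)
  qed
  then show "\<delta>_int K F = 0" "Q K F = 0" unfolding \<delta>_int_def Q_def using z by (auto simp: vec_eq_iff)
qed

lemma \<delta>_int_face:
  assumes K: "K \<in> P" and b: "barycentric K C g b" and v: "vtx \<in> C" and c: "c \<in> C"
  shows "\<delta>_int K (barycentric.face K g b c) = (if c = vtx then 0 else \<delta> vtx * norm (g c) * vol K)"
proof -
  interpret k: barycentric K C g b by (rule b)
  have "\<delta>_int K (k.face c) = \<delta> vtx * facet_integral K (k.face c) (k.lam vtx)"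
  proof -
    have "\<delta>_int K (k.face c) = (LINT x|facet_measure K (k.face c). \<delta> vtx * (indicator (k.face c) x *\<^sub>R k.lam vtx x))"
      unfolding \<delta>_int_def facet_integral_eq
    proof (rule Bochner_Integration.integral_cong[OF refl])
      fix x
      have "\<delta> x = \<delta> vtx * k.lam vtx x" if "x \<in> k.face c"
        using \<delta>_barycentric(1)[OF K b v, of x] that by (simp add: k.face_def)
      then show "indicator (k.face c) x *\<^sub>R \<delta> x = \<delta> vtx * (indicator (k.face c) x *\<^sub>R k.lam vtx x)"
        by (cases "x \<in> k.face c") simp_all
    qed
    then show ?thesis by (simp only: integral_mult_right_zero facet_integral_eq)
  qed
  then show ?thesis using k.facet_integral_lam[OF c v] by auto
qed

text \<open>Both sides are the integral of grad \<delta> over K. Every facet but the one opposite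
  \<open>vtx\<close> contributes - \<delta> vtx vol K g c, and since the g c sum to zero the missing
  term is what remains.\<close>

lemma divergence_theorem:
  assumes K: "K \<in> P"
  shows "(\<Sum>F\<in>{F. F facet_of K}. \<delta>_int K F *\<^sub>R outward_normal K F) = vol K *\<^sub>R grad\<delta> K"
proof -
  obtain C g b where b: "barycentric K C g b" and v: "vtx \<in> C" using patch_barycentric[OF K] .
  interpret k: barycentric K C g b by (rule b)
  have "(\<Sum>F\<in>{F. F facet_of K}. \<delta>_int K F *\<^sub>R outward_normal K F) = (\<Sum>c\<in>C. \<delta>_int K (k.face c) *\<^sub>R outward_normal K (k.face c))"
    by (rule k.sum_facets)
  also have "\<dots> = (\<Sum>c\<in>C. - (\<delta> vtx * vol K) *\<^sub>R g c + (if c = vtx then (\<delta> vtx * vol K) *\<^sub>R g vtx else 0))"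
  proof (rule sum.cong[OF refl])
    fix c assume c: "c \<in> C"
    show "\<delta>_int K (k.face c) *\<^sub>R outward_normal K (k.face c)
        = - (\<delta> vtx * vol K) *\<^sub>R g c + (if c = vtx then (\<delta> vtx * vol K) *\<^sub>R g vtx else 0)"
      unfolding \<delta>_int_face[OF K b v c] k.outward_normal_face[OF c] using k.g_nonzero[OF c] by simp
  qed
  also have "\<dots> = (\<Sum>c\<in>C. - (\<delta> vtx * vol K) *\<^sub>R g c) + (\<delta> vtx * vol K) *\<^sub>R g vtx"
    using v k.finite_C by (simp only: sum.distrib sum.delta if_True)
  also have "(\<Sum>c\<in>C. - (\<delta> vtx * vol K) *\<^sub>R g c) = - (\<delta> vtx * vol K) *\<^sub>R (\<Sum>c\<in>C. g c)"
    by (rule scaleR_sum_right[symmetric])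
  also have "(\<Sum>c\<in>C. g c) = 0" by (rule k.sum_g)
  finally show ?thesis by (simp add: \<delta>_barycentric(2)[OF K b v] mult.commute)
qed

text \<open>Unless it is 0, the integral is \<delta> vtx norm (g c) vol K. Causality bounds the tent
  height \<delta> vtx by 2 / c' times the diameter, and shape regularity bounds the diameter times
  norm (g c) by |\<sigma>|, so the inverse length of a trace inequality cancels.\<close>

lemma \<delta>_int_bound:
  assumes e: "(K, F) \<in> E"
  shows "\<delta>_int K F \<le> 2 * \<bar>\<sigma>\<bar> / c' * vol K"
proof -
  obtain C g b c where b: "barycentric K C g b" and v: "vtx \<in> C" and c: "c \<in> C" and F: "F = barycentric.face K g b c"
    using facet_barycentric[OF e] .
  interpret k: barycentric K C g b by (rule b)
  from e have K: "K \<in> P" by (simp add: E_iff)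
  obtain u where u: "u \<in> C" "u \<noteq> vtx" by (rule k.other_vertex)
  obtain \<beta> where \<beta>: "\<forall>x\<in>K. \<delta> x = grad\<delta> K \<bullet> x + \<beta>" using \<delta>_affine[OF K] by blast
  have "\<delta> u = 0" using \<delta>_other_vertex[OF K] u k.extreme_point_iff by blast
  then have "\<delta> vtx = grad\<delta> K \<bullet> (vtx - u)"
    using \<beta> k.vertex_in[OF v] k.vertex_in[OF u(1)] by (simp add: inner_diff_right)
  also have "\<dots> \<le> norm (grad\<delta> K) * norm (vtx - u)" by (rule norm_cauchy_schwarz)
  also have "\<dots> \<le> 2 / c' * diameter K"
    using grad\<delta>_norm[OF K] diameter_bounded_bound[OF compact_imp_bounded[OF k.compact_K] k.vertex_in[OF v] k.vertex_in[OF u(1)]] c'_pos[OF K]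
    by (intro mult_mono) (auto simp: dist_norm)
  also have "\<dots> \<le> 2 / c' * (\<bar>\<sigma>\<bar> / norm (g c))"
    using k.diameter_le[OF c] shape P_sub[OF K] c'_pos[OF K] by (intro mult_left_mono) (auto simp: shape_regular_def)
  finally have "\<delta> vtx * norm (g c) \<le> 2 * \<bar>\<sigma>\<bar> / c'"
    using k.norm_g_pos[OF c] c'_pos[OF K] by (simp add: field_simps)
  then have "\<delta> vtx * norm (g c) * vol K \<le> 2 * \<bar>\<sigma>\<bar> / c' * vol K" by (rule mult_right_mono) simp
  moreover have "0 \<le> 2 * \<bar>\<sigma>\<bar> / c' * vol K" using c'_pos[OF K] by simp
  ultimately show ?thesis unfolding F \<delta>_int_face[OF K b v c] by (cases "c = vtx") simp_all
qed

text \<open>Resolves the THE in \<open>neighbor\<close>: the mesh neighbor has F as a facet and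
  therefore \<open>vtx\<close> as a vertex, which puts it into the patch; uniqueness is
  \<open>mesh_neighbor_unique\<close>, applied from either side.\<close>

lemma neighbor_facts:
  assumes e: "(K, F) \<in> E" and v: "vtx \<in> F" and i: "\<not> F \<subseteq> frontier \<Omega>"
  shows "(neighbor K F, F) \<in> E" "neighbor K F \<noteq> K" "neighbor (neighbor K F) F = K" "rel_interior F \<subseteq> \<Omega>"
proof -
  from e have K: "K \<in> P" and F: "F facet_of K" by (auto simp: E_iff)
  have "F \<subseteq> frontier \<Omega> \<or> rel_interior F \<subseteq> \<Omega>"
    using mesh P_sub[OF K] F unfolding conforming_mesh_def by blast
  with i show sub: "rel_interior F \<subseteq> \<Omega>" by blast
  obtain K' where K': "K' \<in> \<T>" "K' \<noteq> K" "F facet_of K'"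
    using mesh_neighbor_exists[OF open_\<Omega> mesh P_sub[OF K] F sub] .
  have "vtx extreme_point_of F" 
    using K v extreme_point_of_face[OF facet_of_imp_face_of[OF F]] by (simp add: patch_def)
  then have "vtx extreme_point_of K'" using extreme_point_of_face[OF facet_of_imp_face_of[OF K'(3)]] by simp
  then have K'P: "K' \<in> P" using K'(1) by (simp add: patch_def)
  have uniq: "K1 = K'" if "K1 \<in> P" "K1 \<noteq> K" "F facet_of K1" for K1
    by (rule mesh_neighbor_unique[OF mesh P_sub[OF K] P_sub[OF that(1)] K'(1) that(2) K'(2) F that(3) K'(3)])
  have nK: "neighbor K F = K'" unfolding neighbor_def
  proof (rule the_equality)
    show "K' \<in> P \<and> K' \<noteq> K \<and> F facet_of K'" using K' K'P by simp
    show "\<And>K1. K1 \<in> P \<and> K1 \<noteq> K \<and> F facet_of K1 \<Longrightarrow> K1 = K'" by (elim conjE) (rule uniq)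
  qed
  have uniq': "K1 = K" if "K1 \<in> P" "K1 \<noteq> K'" "F facet_of K1" for K1
    by (rule mesh_neighbor_unique[OF mesh K'(1) P_sub[OF that(1)] P_sub[OF K] that(2) K'(2)[symmetric] K'(3) that(3) F])
  have nK': "neighbor K' F = K" unfolding neighbor_def
  proof (rule the_equality)
    show "K \<in> P \<and> K \<noteq> K' \<and> F facet_of K" using K' K F by simp
    show "\<And>K1. K1 \<in> P \<and> K1 \<noteq> K' \<and> F facet_of K1 \<Longrightarrow> K1 = K" by (elim conjE) (rule uniq')
  qed
  show "(neighbor K F, F) \<in> E" "neighbor K F \<noteq> K" "neighbor (neighbor K F) F = K"
    using nK nK' K' K'P by (auto simp: E_iff)
qed

text \<open>The flux parameters depend on the facet alone, and the facet measure ignores the sign of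
  the normal. Only the normal matrix sees the side, and continuity of the normal component makes it
  change by the sign alone.\<close>

lemma neighbor_data:
  assumes e: "(K, F) \<in> E" and v: "vtx \<in> F" and i: "\<not> F \<subseteq> frontier \<Omega>"
  shows "Dn (neighbor K F) F = - Dn K F" "\<delta>_int (neighbor K F) F = \<delta>_int K F" "Q (neighbor K F) F = Q K F"
proof -
  note nb = neighbor_facts[OF e v i]
  let ?K' = "neighbor K F"
  from e have K: "K \<in> P" and F: "F facet_of K" by (auto simp: E_iff)
  from nb have K': "?K' \<in> P" and F': "F facet_of ?K'" by (auto simp: E_iff)
  have on: "outward_normal ?K' F = - outward_normal K F"
    by (rule opposite_outward_normal[OF mesh P_sub[OF K] P_sub[OF K'] nb(2)[symmetric] F F'])
  have fm: "facet_measure ?K' F = facet_measure K F"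
    unfolding facet_measure_def on
    by (rule hyperplane_measure_uminus) (rule norm_mesh_normal[OF mesh P_sub[OF K] F])
  then have fi: "facet_integral ?K' F f = facet_integral K F f" for f by (simp add: facet_integral_eq)
  show "\<delta>_int ?K' F = \<delta>_int K F" "Q ?K' F = Q K F" by (simp_all add: \<delta>_int_def Q_def fi)
  have "dirm K (outward_normal K F) = dirm ?K' (outward_normal K F)"
    unfolding dirm_def
    by (rule mesh_normal_component[OF open_\<Omega> adm mesh P_sub[OF K] P_sub[OF K'] nb(2)[symmetric] F F' nb(4)])
      (simp_all add: \<L>_val[OF K] \<L>_val[OF K'])
  then show "Dn ?K' F = - Dn K F" by (simp add: Dn_def on dirm_minus)
qed

section \<open>The DG form as a sum over facets\<close>

definition facet_flux :: "(real^'n) set \<Rightarrow> (real^'n) set \<Rightarrow> (real^'n \<Rightarrow> real^'l) \<Rightarrow> (real^'n \<Rightarrow> real^'l) \<Rightarrow> real"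
  where "facet_flux K F w v = (if F \<subseteq> frontier \<Omega>
    then \<delta>_int K F * ((1/2) * ((Dn K F *v val K w) \<bullet> val K v)) + (Q K F *v ((1/2) *\<^sub>R val K w)) \<bullet> val K v
    else \<delta>_int K F * ((1/2) * ((Dn K F *v (val K w + val (neighbor K F) w)) \<bullet> val K v))
      + (Q K F *v (val K w - val (neighbor K F) w)) \<bullet> val K v)"

lemma facet_trace:
  assumes e: "(K, F) \<in> E" and x: "x \<in> F"
  shows "w \<in> V\<^sub>h \<Longrightarrow> element_trace K w x = val K w"
    and "element_trace K (normal_matrix \<L> \<nu>) x = dirm K \<nu>"
proof -
  from e have K: "K \<in> P" by (simp add: E_iff)
  obtain C g b where b: "barycentric K C g b" using patch_barycentric[OF K] by blast
  have "x \<in> closure (interior K)"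
    using barycentric.K_subset_closure_interior[OF b] facet_subset[OF e] x by blast
  then show "w \<in> V\<^sub>h \<Longrightarrow> element_trace K w x = val K w"
    and "element_trace K (normal_matrix \<L> \<nu>) x = dirm K \<nu>"
    using Vh_val[OF _ K] dirm_normal_matrix[OF K] by (auto intro: element_trace_eq)
qed

lemma facet_integral_flux:
  assumes e: "(K, F) \<in> E" and w: "w \<in> V\<^sub>h" and v: "v \<in> V\<^sub>h"
  shows "facet_integral K F (\<lambda>x. (\<delta> x *\<^sub>R flux K F w x) \<bullet> element_trace K v x) = facet_flux K F w v"
proof (cases "F \<subseteq> frontier \<Omega>")
  case True
  have "facet_integral K F (\<lambda>x. (\<delta> x *\<^sub>R flux K F w x) \<bullet> element_trace K v x)
      = \<delta>_int K F * ((1/2) * ((Dn K F *v val K w) \<bullet> val K v)) + (Q K F *v ((1/2) *\<^sub>R val K w)) \<bullet> val K v + (Q K F *v 0) \<bullet> 0"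
    by (rule facet_integral_form[OF e])
      (simp add: flux_def Let_def True facet_trace[OF e] w v X_def Dn_def matrix_vector_mult_add_rdistrib inner_add_left
        matrix_vector_mult_scaleR distrib_left)
  then show ?thesis using True by (simp add: facet_flux_def)
next
  case False
  have "facet_integral K F (\<lambda>x. (\<delta> x *\<^sub>R flux K F w x) \<bullet> element_trace K v x)
      = \<delta>_int K F * ((1/2) * ((Dn K F *v (val K w + val (neighbor K F) w)) \<bullet> val K v))
      + (Q K F *v (val K w - val (neighbor K F) w)) \<bullet> val K v + (Q K F *v 0) \<bullet> 0"
  proof (rule facet_integral_form[OF e])
    fix x assume x: "x \<in> F"
    show "(\<delta> x *\<^sub>R flux K F w x) \<bullet> element_trace K v x = \<delta> x * ((1/2) * ((Dn K F *v (val K w + val (neighbor K F) w)) \<bullet> val K v)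
      + (X F x *v (val K w - val (neighbor K F) w)) \<bullet> val K v + (X F x *v 0) \<bullet> 0)"
    proof (cases "vtx \<in> F")
      case vF: True
      note nb = facet_trace[OF neighbor_facts(1)[OF e vF False] x]
      show ?thesis
        by (simp add: flux_def Let_def False facet_trace[OF e x] nb w v X_def Dn_def inner_add_left matrix_vector_mult_scaleR)
    next
      \<comment> \<open>Here \<open>neighbor K F\<close> may be unspecified, but \<delta> vanishes
        on F.\<close>
      case vF: False
      then show ?thesis using facet_off_vertex(1)[OF e vF x] by simp
    qed
  qed
  then show ?thesis using False by (simp add: facet_flux_def)
qed

text \<open>The volume terms vanish, as piecewise constants have zero derivatives inside the
  elements.\<close>

lemma a_eq:
  assumes w: "w \<in> V\<^sub>h" and v: "v \<in> V\<^sub>h"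
  shows "a w v = - (\<Sum>(K, F)\<in>E. facet_flux K F w v)"
proof -
  have "(LINT x:interior K|lebesgue. (\<delta> x *\<^sub>R (\<L> j x *v w x)) \<bullet> partial_deriv j v x) = 0" if K: "K \<in> P" for K j
  proof -
    have "partial_deriv j v x = 0" if x: "x \<in> interior K" for x
    proof -
      have "(v has_derivative (\<lambda>y. 0)) (at x)"
        by (rule has_derivative_transform_within_open[OF has_derivative_const open_interior x])
          (simp add: Vh_val[OF v K])
      then show ?thesis by (simp add: partial_deriv_def frechet_derivative_at[symmetric])
    qed
    then have "(\<lambda>x. indicator (interior K) x *\<^sub>R ((\<delta> x *\<^sub>R (\<L> j x *v w x)) \<bullet> partial_deriv j v x)) = (\<lambda>x. 0)"
      by (auto simp: indicator_def fun_eq_iff)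
    then show ?thesis unfolding set_lebesgue_integral_def by (simp only: integral_zero)
  qed
  moreover have "(\<Sum>F\<in>{F. F facet_of K}. facet_integral K F (\<lambda>x. (\<delta> x *\<^sub>R flux K F w x) \<bullet> element_trace K v x))
      = (\<Sum>F\<in>{F. F facet_of K}. facet_flux K F w v)" if "K \<in> P" for K
    using that by (intro sum.cong refl facet_integral_flux[OF _ w v]) (simp add: E_iff)
  ultimately have "a w v = (\<Sum>K\<in>P. - (\<Sum>F\<in>{F. F facet_of K}. facet_flux K F w v))"
    unfolding a_def by (intro sum.cong refl) (simp only: sum.neutral_const diff_0)
  then show ?thesis by (simp add: sum_negf sum_E)
qed

end

section \<open>The consistency estimate\<close>

text \<open>Interior facets need the first summand, where both flux terms are treated by one Young
  inequality. Boundary facets need the other two, from D + B and from a symmetric remainder. The sum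
  serves both cases.\<close>

definition flux_const :: "real \<Rightarrow> real"
  where "flux_const \<Gamma> = (\<Gamma> / 2 + \<Gamma> * sqrt \<Gamma>)\<^sup>2 / 4 + \<Gamma>\<^sup>2 / 8 + (\<Gamma> + 1) / 2"

lemma young_product: "0 < (\<epsilon>::real) \<Longrightarrow> p * s \<le> \<epsilon> * p\<^sup>2 + s\<^sup>2 / (4 * \<epsilon>)"
proof -
  assume e: "0 < \<epsilon>"
  have "0 \<le> (2 * \<epsilon> * p - s)\<^sup>2 / (4 * \<epsilon>)" using e by simp
  also have "\<dots> = \<epsilon> * p\<^sup>2 + s\<^sup>2 / (4 * \<epsilon>) - p * s"
    using e by (simp add: power2_eq_square field_simps)
  finally show ?thesis by simp
qed

context
  fixes D X :: "real^'l^'l" and \<Gamma> \<epsilon> :: real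
  assumes D: "transpose D = D" and psd: "\<And>y. 0 \<le> (X *v y) \<bullet> y" and X: "onorm ((*v) X) \<le> \<Gamma>" and \<epsilon>: "0 < \<epsilon>"
begin

lemma flux_bound_nonneg: "0 \<le> \<Gamma>"
  using onorm_pos_le[OF matrix_vector_mul_bounded_linear[of X]] X by linarith

lemma form_le: "(X *v u) \<bullet> u \<le> \<Gamma> * (norm u)\<^sup>2"
proof -
  have "(X *v u) \<bullet> u \<le> norm (X *v u) * norm u" by (rule norm_cauchy_schwarz)
  also have "\<dots> \<le> (\<Gamma> * norm u) * norm u"
    using onorm[OF matrix_vector_mul_bounded_linear[of X], of u] mult_right_mono[OF X norm_ge_zero[of u]]
    by (intro mult_right_mono) auto
  finally show ?thesis by (simp add: power2_eq_square)
qed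

lemma form_seminorm_sq: "(form_seminorm X y)\<^sup>2 = (X *v y) \<bullet> y"
  using psd by (simp add: form_seminorm_def)

text \<open>On the boundary D is controlled only together with X, and with the seminorm on the
  second argument. Symmetry of D lets the left side be written as (D + X) u . y / 2 minus half of X
  u . y + X y . u. Here y sits in the seminorm, and the remainder is bounded below because the form
  of X is nonnegative at \<mu> y + u.\<close>

lemma boundary_flux_bound:
  assumes DX: "\<And>y z. ((D + X) *v y) \<bullet> z \<le> \<Gamma> * (norm y * form_seminorm X z)"
  shows "(D *v y) \<bullet> u / 2 - (X *v y) \<bullet> u / 2 \<le> \<epsilon> * (norm u)\<^sup>2 + flux_const \<Gamma> / \<epsilon> * ((X *v y) \<bullet> y)"
proof -
  define s where "s = form_seminorm X y"
  \<comment> \<open>This choice makes (\<Gamma> + 1) |u|^2 equal to \<mu> \<epsilon> |u|^2, so that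
    \<mu> can be cancelled; the 1 keeps \<mu> positive for \<Gamma> = 0.\<close>
  define \<mu> where "\<mu> = (\<Gamma> + 1) / \<epsilon>"
  have \<mu>: "0 < \<mu>" using flux_bound_nonneg \<epsilon> by (simp add: \<mu>_def)
  have "(D *v y) \<bullet> u / 2 - (X *v y) \<bullet> u / 2 = ((D + X) *v u) \<bullet> y / 2 - ((X *v u) \<bullet> y + (X *v y) \<bullet> u) / 2"
    by (simp add: matrix_vector_mult_add_rdistrib inner_add_left symmetric_form_swap[OF D, of y u] add_divide_distrib)
  moreover have "((D + X) *v u) \<bullet> y / 2 \<le> \<epsilon> / 2 * (norm u)\<^sup>2 + \<Gamma>\<^sup>2 / (8 * \<epsilon>) * s\<^sup>2"
  proof -
    have "((D + X) *v u) \<bullet> y / 2 \<le> norm u * (\<Gamma> / 2 * s)" using DX[of u y] by (simp add: s_def mult_ac)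
    also have "\<dots> \<le> (\<epsilon> / 2) * (norm u)\<^sup>2 + (\<Gamma> / 2 * s)\<^sup>2 / (4 * (\<epsilon> / 2))" using \<epsilon> by (intro young_product) simp
    finally show ?thesis using \<epsilon> by (simp add: power_mult_distrib power_divide)
  qed
  moreover have "- ((X *v u) \<bullet> y + (X *v y) \<bullet> u) / 2 \<le> (\<Gamma> + 1) / (2 * \<epsilon>) * s\<^sup>2 + \<epsilon> / 2 * (norm u)\<^sup>2"
  proof -
    have "0 \<le> (X *v (\<mu> *\<^sub>R y + u)) \<bullet> (\<mu> *\<^sub>R y + u)" by (rule psd)
    also have "\<dots> = \<mu> * (\<mu> * s\<^sup>2 + ((X *v u) \<bullet> y + (X *v y) \<bullet> u)) + (X *v u) \<bullet> u"
      by (simp add: s_def form_seminorm_sq matrix_vector_right_distrib matrix_vector_mult_scaleR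
          inner_add_left inner_add_right algebra_simps)
    also have "\<dots> \<le> \<mu> * (\<mu> * s\<^sup>2 + ((X *v u) \<bullet> y + (X *v y) \<bullet> u)) + (\<Gamma> + 1) * (norm u)\<^sup>2"
      using form_le[of u] by (simp add: distrib_right add_increasing2)
    also have "(\<Gamma> + 1) * (norm u)\<^sup>2 = \<mu> * (\<epsilon> * (norm u)\<^sup>2)" using \<epsilon> by (simp add: \<mu>_def)
    finally have "0 \<le> \<mu> * (\<mu> * s\<^sup>2 + ((X *v u) \<bullet> y + (X *v y) \<bullet> u) + \<epsilon> * (norm u)\<^sup>2)" by (simp add: distrib_left)
    then have "0 \<le> \<mu> * s\<^sup>2 + ((X *v u) \<bullet> y + (X *v y) \<bullet> u) + \<epsilon> * (norm u)\<^sup>2"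
      using \<mu> by (simp add: zero_le_mult_iff)
    moreover have "(\<Gamma> + 1) / (2 * \<epsilon>) * s\<^sup>2 = \<mu> * s\<^sup>2 / 2" by (simp add: \<mu>_def)
    moreover have "\<epsilon> / 2 * (norm u)\<^sup>2 = \<epsilon> * (norm u)\<^sup>2 / 2" by simp
    ultimately show ?thesis unfolding minus_divide_left[symmetric] by (simp only:) argo
  qed
  ultimately have "(D *v y) \<bullet> u / 2 - (X *v y) \<bullet> u / 2 \<le> \<epsilon> * (norm u)\<^sup>2 + (\<Gamma>\<^sup>2 / (8 * \<epsilon>) * s\<^sup>2 + (\<Gamma> + 1) / (2 * \<epsilon>) * s\<^sup>2)"
    by linarith
  also have "\<Gamma>\<^sup>2 / (8 * \<epsilon>) * s\<^sup>2 + (\<Gamma> + 1) / (2 * \<epsilon>) * s\<^sup>2 = (\<Gamma>\<^sup>2 / 8 + (\<Gamma> + 1) / 2) / \<epsilon> * s\<^sup>2"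
    using \<epsilon> by (simp add: field_simps)
  also have "\<dots> \<le> flux_const \<Gamma> / \<epsilon> * s\<^sup>2"
    using \<epsilon> by (intro mult_right_mono divide_right_mono) (auto simp: flux_const_def)
  finally show ?thesis by (simp add: s_def form_seminorm_sq)
qed

text \<open>D and X are controlled separately, and the seminorm of u is at most sqrt \<Gamma> |u|.
  Both terms become |u| times the seminorm of y, so one Young inequality suffices. The bounds are
  one-sided; the sign of the X term is reached through - y.\<close>

lemma interior_flux_bound:
  assumes XX: "\<And>y z. (X *v y) \<bullet> z \<le> \<Gamma> * (form_seminorm X y * form_seminorm X z)"
    and DX: "\<And>y z. (D *v y) \<bullet> z \<le> \<Gamma> * (norm y * form_seminorm X z)"
  shows "(D *v y) \<bullet> u / 2 - (X *v y) \<bullet> u \<le> \<epsilon> * (norm u)\<^sup>2 + flux_const \<Gamma> / \<epsilon> * ((X *v y) \<bullet> y)"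
proof -
  define s where "s = form_seminorm X y"
  have s: "0 \<le> s" using psd by (simp add: s_def form_seminorm_def)
  have "form_seminorm X u \<le> sqrt (\<Gamma> * (norm u)\<^sup>2)"
    unfolding form_seminorm_def by (rule real_sqrt_le_mono) (rule form_le)
  then have u: "form_seminorm X u \<le> sqrt \<Gamma> * norm u" by (simp add: real_sqrt_mult)
  have neg: "form_seminorm X (- y) = s" by (simp add: s_def form_seminorm_def vec.neg)
  have "(D *v y) \<bullet> u / 2 \<le> norm u * (\<Gamma> / 2 * s)"
    using DX[of u y] by (simp add: s_def symmetric_form_swap[OF D, of y u] mult_ac)
  moreover have "- ((X *v y) \<bullet> u) \<le> norm u * (\<Gamma> * sqrt \<Gamma> * s)"
  proof -
    have "- ((X *v y) \<bullet> u) \<le> \<Gamma> * (s * form_seminorm X u)" using XX[of "- y" u] by (simp add: neg vec.neg)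
    also have "\<dots> \<le> \<Gamma> * (s * (sqrt \<Gamma> * norm u))"
      using u s flux_bound_nonneg by (intro mult_left_mono)
    finally show ?thesis by (simp add: mult_ac)
  qed
  ultimately have "(D *v y) \<bullet> u / 2 - (X *v y) \<bullet> u \<le> norm u * ((\<Gamma> / 2 + \<Gamma> * sqrt \<Gamma>) * s)"
    by (simp add: algebra_simps)
  also have "\<dots> \<le> \<epsilon> * (norm u)\<^sup>2 + ((\<Gamma> / 2 + \<Gamma> * sqrt \<Gamma>) * s)\<^sup>2 / (4 * \<epsilon>)" by (rule young_product[OF \<epsilon>])
  also have "((\<Gamma> / 2 + \<Gamma> * sqrt \<Gamma>) * s)\<^sup>2 / (4 * \<epsilon>) = ((\<Gamma> / 2 + \<Gamma> * sqrt \<Gamma>)\<^sup>2 / 4) / \<epsilon> * s\<^sup>2"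
    unfolding power_mult_distrib by simp
  also have "\<dots> \<le> flux_const \<Gamma> / \<epsilon> * s\<^sup>2"
    using \<epsilon> flux_bound_nonneg by (intro mult_right_mono divide_right_mono) (auto simp: flux_const_def)
  finally show ?thesis by (simp add: s_def form_seminorm_sq)
qed

end

context tent_setup
begin

text \<open>The share of the side (K, F) in |v|_d^2; a jump across a facet between two elements is
  counted from both sides.\<close>

definition jump_form :: "(real^'n) set \<Rightarrow> (real^'n) set \<Rightarrow> (real^'n \<Rightarrow> real^'l) \<Rightarrow> real"
  where "jump_form K F v = (if F \<subseteq> frontier \<Omega> then (Q K F *v val K v) \<bullet> val K v
    else (Q K F *v (val K v - val (neighbor K F) v)) \<bullet> (val K v - val (neighbor K F) v))"

text \<open>The divergence theorem replaces grad \<delta> by \<delta> times the normals on the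
  facets, so \<open>M\<^sub>1\<close> takes the same facet form as \<open>a\<close> and the two can
  be combined side by side.\<close>

lemma M1_inner:
  assumes v: "v \<in> V\<^sub>h" and u: "u \<in> V\<^sub>h"
  shows "inner_patch (M\<^sub>1 v) u = (\<Sum>(K, F)\<in>E. \<delta>_int K F * ((Dn K F *v val K v) \<bullet> val K u))"
proof -
  have "vol K * (val K (M\<^sub>1 v) \<bullet> val K u) = (\<Sum>F\<in>{F. F facet_of K}. \<delta>_int K F * ((Dn K F *v val K v) \<bullet> val K u))"
    if K: "K \<in> P" for K
  proof -
    have "vol K * (val K (M\<^sub>1 v) \<bullet> val K u) = (dirm K (vol K *\<^sub>R grad\<delta> K) *v val K v) \<bullet> val K u"
      by (simp add: M1_Vh(2)[OF v K] dirm_scale scaleR_matrix_vector_assoc[symmetric])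
    also have "\<dots> = (\<Sum>F\<in>{F. F facet_of K}. \<delta>_int K F * ((Dn K F *v val K v) \<bullet> val K u))"
    proof -
      have "(sum f A *v y) \<bullet> z = (\<Sum>i\<in>A. (f i *v y) \<bullet> z)" for f :: "(real^'n) set \<Rightarrow> real^'l^'l" and A y z
        by (induction A rule: infinite_finite_induct) (auto simp: matrix_vector_mult_add_rdistrib inner_add_left)
      then show ?thesis
        unfolding divergence_theorem[OF K, symmetric] dirm_sum
        by (simp add: dirm_scale Dn_def scaleR_matrix_vector_assoc[symmetric])
    qed
    finally show ?thesis .
  qed
  then show ?thesis unfolding inner_patch_eq[OF M1_Vh(1)[OF v] u] sum_E[symmetric] by (rule sum.cong[OF refl])
qed

lemma M1_symmetric:
  assumes v: "v \<in> V\<^sub>h" and u: "u \<in> V\<^sub>h"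
  shows "inner_patch (M\<^sub>1 v) u = inner_patch (M\<^sub>1 u) v"
  unfolding inner_patch_eq[OF M1_Vh(1)[OF v] u] inner_patch_eq[OF M1_Vh(1)[OF u] v]
  by (intro sum.cong refl)
    (simp add: M1_Vh(2)[OF v] M1_Vh(2)[OF u] symmetric_form_swap[OF dirm_symmetric, of _ _ "val _ v"])

lemma Dn_symmetric: "(K, F) \<in> E \<Longrightarrow> transpose (Dn K F) = Dn K F"
  unfolding Dn_def by (rule dirm_symmetric) (simp add: E_iff)

lemma consistency:
  assumes v: "v \<in> V\<^sub>h" and u: "u \<in> V\<^sub>h"
  shows "a v u + inner_patch (M\<^sub>1 v) u = (\<Sum>(K, F)\<in>E. \<delta>_int K F * ((Dn K F *v val K v) \<bullet> val K u) - facet_flux K F v u)"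
  unfolding a_eq[OF v u] M1_inner[OF v u] by (simp add: sum_subtractf split_def)

text \<open>The two sides of an interior facet have opposite normal matrices, so the central part of the
  flux cancels when the contributions of both sides are added.\<close>

lemma d_eq_jump:
  assumes v: "v \<in> V\<^sub>h"
  shows "d v v = (\<Sum>(K, F)\<in>E. jump_form K F v)"
proof -
  define f where "f = (\<lambda>(K, F). 2 * facet_flux K F v v - \<delta>_int K F * ((Dn K F *v val K v) \<bullet> val K v))"
  define j where "j = (\<lambda>(K, F). jump_form K F v)"
  \<comment> \<open>The sides with a true neighbor in the patch. On all others f and j agree term by
    term: on the boundary of \<Omega> because the D terms cancel, elsewhere because \<delta>
    vanishes.\<close>
  define E' where "E' = {e \<in> E. vtx \<in> snd e \<and> \<not> snd e \<subseteq> frontier \<Omega>}"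
  define nb where "nb = (\<lambda>(K, F). (neighbor K F, F :: (real^'n) set))"
  have E'fin: "E' \<subseteq> E" unfolding E'_def by (rule Collect_restrict)
  have E'iff: "(K, F) \<in> E' \<longleftrightarrow> (K, F) \<in> E \<and> vtx \<in> F \<and> \<not> F \<subseteq> frontier \<Omega>" for K F
    by (simp add: E'_def)
  have "d v v = (\<Sum>e\<in>E. f e)"
    unfolding d_def a_eq[OF v v] M1_inner[OF v v] f_def
    by (simp add: split_def sum_subtractf sum_distrib_left[symmetric])
  also have "\<dots> = (\<Sum>e\<in>E - E'. f e) + (\<Sum>e\<in>E'. f e)"
    by (rule sum.subset_diff[OF E'fin finite_E])
  also have "(\<Sum>e\<in>E - E'. f e) = (\<Sum>e\<in>E - E'. j e)"
  proof (rule sum.cong[OF refl])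
    fix e assume "e \<in> E - E'"
    moreover obtain K F where eq: "e = (K, F)" by (cases e)
    ultimately have e: "e = (K, F)" "(K, F) \<in> E" "vtx \<notin> F \<or> F \<subseteq> frontier \<Omega>" by (simp_all add: E'iff)
    show "f e = j e"
    proof (cases "F \<subseteq> frontier \<Omega>")
      case True
      then show ?thesis
        by (simp add: e(1) f_def j_def facet_flux_def jump_form_def matrix_vector_mult_scaleR)
    next
      case False
      then have "vtx \<notin> F" using e(3) by blast
      then show ?thesis using facet_off_vertex(2,3)[OF e(2)] False
        by (simp add: e(1) f_def j_def facet_flux_def jump_form_def)
    qed
  qed
  also have "(\<Sum>e\<in>E'. f e) = (\<Sum>e\<in>E'. j e)"
  proof -
    have nbE: "nb e \<in> E'" "nb (nb e) = e" if "e \<in> E'" for e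
    proof -
      obtain K F where eq: "e = (K, F)" by (cases e)
      then have e: "(K, F) \<in> E" "vtx \<in> F" "\<not> F \<subseteq> frontier \<Omega>" using that by (simp_all add: E'iff)
      show "nb e \<in> E'" "nb (nb e) = e"
        using neighbor_facts[OF e] e by (simp_all add: eq nb_def E'iff)
    qed
    \<comment> \<open>Exchanging sides permutes E', so it is enough to compare the sums over the two
      sides of each facet.\<close>
    have "bij_betw nb E' E'" by (rule bij_betw_byWitness[where f' = nb]) (auto simp: nbE)
    then have re: "(\<Sum>e\<in>E'. h (nb e)) = (\<Sum>e\<in>E'. h e)" for h :: "_ \<Rightarrow> real" by (rule sum.reindex_bij_betw)
    have "f e + f (nb e) = j e + j (nb e)" if "e \<in> E'" for e
    proof -
      obtain K F where eq: "e = (K, F)" by (cases e)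
      then have e: "e = (K, F)" "(K, F) \<in> E" "vtx \<in> F" "\<not> F \<subseteq> frontier \<Omega>" using that by (simp_all add: E'iff)
      note nd = neighbor_data[OF e(2-4)] neighbor_facts(3)[OF e(2-4)]
      define x y where "x = val K v" and "y = val (neighbor K F) v"
      have sw: "(Dn K F *v y) \<bullet> x = (Dn K F *v x) \<bullet> y" by (rule symmetric_form_swap[OF Dn_symmetric[OF e(2)]])
      have m: "(- Dn K F) *v z = - (Dn K F *v z)" for z by (simp add: vec_eq_iff matrix_vector_mult_def sum_negf)
      have q: "Q K F *v (y - x) = - (Q K F *v (x - y))" by (simp add: matrix_vector_mult_diff_distrib)
      let ?I = "\<delta>_int K F"
      have fe: "f e = ?I * ((Dn K F *v y) \<bullet> x) + 2 * ((Q K F *v (x - y)) \<bullet> x)"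
        unfolding e(1) f_def prod.case facet_flux_def if_not_P[OF e(4)] x_def[symmetric] y_def[symmetric]
        by (simp add: matrix_vector_right_distrib inner_add_left distrib_left)
      have fn: "f (nb e) = - (?I * ((Dn K F *v x) \<bullet> y)) - 2 * ((Q K F *v (x - y)) \<bullet> y)"
        unfolding e(1) f_def nb_def prod.case facet_flux_def if_not_P[OF e(4)] nd x_def[symmetric] y_def[symmetric] q m
        by (simp add: matrix_vector_right_distrib inner_add_left inner_diff_left right_diff_distrib)
      have je: "j e = (Q K F *v (x - y)) \<bullet> (x - y)"
        unfolding e(1) j_def prod.case jump_form_def if_not_P[OF e(4)] x_def[symmetric] y_def[symmetric] ..
      have jn: "j (nb e) = (Q K F *v (x - y)) \<bullet> (x - y)"
        unfolding e(1) j_def nb_def prod.case jump_form_def if_not_P[OF e(4)] nd x_def[symmetric] y_def[symmetric] q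
        by (simp add: inner_diff_right)
      show ?thesis unfolding fe fn je jn sw by (simp add: inner_diff_right)
    qed
    then have "(\<Sum>e\<in>E'. f e + f (nb e)) = (\<Sum>e\<in>E'. j e + j (nb e))" by (rule sum.cong[OF refl])
    then show ?thesis by (simp add: sum.distrib re)
  qed
  also have "(\<Sum>e\<in>E - E'. j e) + (\<Sum>e\<in>E'. j e) = (\<Sum>e\<in>E. j e)"
    by (rule sum.subset_diff[OF E'fin finite_E, symmetric])
  finally show ?thesis by (simp add: j_def)
qed

lemma jump_form_nonneg:
  assumes e: "(K, F) \<in> E"
  shows "0 \<le> jump_form K F v"
proof -
  have "0 \<le> (Q K F *v y) \<bullet> y" for y
    using facet_average_nonneg[OF e, of 0 y y 0 0] X_facts(3)[OF e] by simp
  then show ?thesis by (simp add: jump_form_def)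
qed

lemma d_nonneg: "v \<in> V\<^sub>h \<Longrightarrow> 0 \<le> d v v"
  unfolding d_eq_jump using jump_form_nonneg by (auto intro: sum_nonneg)

text \<open>On an interior facet D v minus the central flux is half of D applied to the jump, so
  only jumps survive: this is consistency. The pointwise flux bounds for fixed \<epsilon> are affine
  in X and can be averaged.\<close>

lemma facet_estimate:
  assumes e: "(K, F) \<in> E" and \<epsilon>: "0 < \<epsilon>"
  shows "\<delta>_int K F * ((Dn K F *v val K v) \<bullet> val K u) - facet_flux K F v u
    \<le> flux_const \<Gamma> / \<epsilon> * jump_form K F v + \<epsilon> * (\<delta>_int K F * (norm (val K u))\<^sup>2)"
proof -
  from e have K: "K \<in> \<T>" and F: "F facet_of K" using P_sub by (auto simp: E_iff)
  note c = fluxc[unfolded flux_conditions_def Let_def]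
  let ?k = "flux_const \<Gamma> / \<epsilon>"
  let ?u = "val K u"
  show ?thesis
  proof (cases "F \<subseteq> frontier \<Omega>")
    case True
    let ?y = "val K v"
    have "0 \<le> \<delta>_int K F * (\<epsilon> * (norm ?u)\<^sup>2 - (Dn K F *v ?y) \<bullet> ?u / 2) + (Q K F *v ((1/2) *\<^sub>R ?y)) \<bullet> ?u + (Q K F *v (?k *\<^sub>R ?y)) \<bullet> ?y"
    proof (rule facet_average_nonneg[OF e])
      fix x assume x: "x \<in> F"
      have Xx: "X F x = B F x" using True by (simp add: X_def)
      have DX: "((Dn K F + X F x) *v y) \<bullet> z \<le> \<Gamma> * (norm y * form_seminorm (X F x) z)" for y z
      proof -
        have "((element_trace K (normal_matrix \<L> (outward_normal K F)) x + B F x) *v y) \<bullet> z \<le> \<Gamma> * (norm y * form_seminorm (B F x) z)"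
          using c K F True x by blast
        then show ?thesis by (simp add: facet_trace(2)[OF e x] Dn_def Xx)
      qed
      have "(Dn K F *v ?y) \<bullet> ?u / 2 - (X F x *v ?y) \<bullet> ?u / 2 \<le> \<epsilon> * (norm ?u)\<^sup>2 + ?k * ((X F x *v ?y) \<bullet> ?y)"
        by (rule boundary_flux_bound[OF Dn_symmetric[OF e] X_facts(3)[OF e x] X_facts(2)[OF e x] \<epsilon> DX])
      then show "0 \<le> \<epsilon> * (norm ?u)\<^sup>2 - (Dn K F *v ?y) \<bullet> ?u / 2 + (X F x *v ((1/2) *\<^sub>R ?y)) \<bullet> ?u + (X F x *v (?k *\<^sub>R ?y)) \<bullet> ?y"
        unfolding matrix_vector_mult_scaleR inner_scaleR_left by linarith
    qed
    then show ?thesis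
      unfolding facet_flux_def jump_form_def if_P[OF True] matrix_vector_mult_scaleR inner_scaleR_left
      by (simp add: algebra_simps)
  next
    case False
    let ?y = "val K v - val (neighbor K F) v"
    have "0 \<le> \<delta>_int K F * (\<epsilon> * (norm ?u)\<^sup>2 - (Dn K F *v ?y) \<bullet> ?u / 2) + (Q K F *v ?y) \<bullet> ?u + (Q K F *v (?k *\<^sub>R ?y)) \<bullet> ?y"
    proof (rule facet_average_nonneg[OF e])
      fix x assume x: "x \<in> F"
      have Xx: "X F x = S F x" using False by (simp add: X_def)
      note q = bspec[OF conjunct2[OF mp[OF spec[OF bspec[OF conjunct2[OF c] K], of F] conjI[OF F False]]] x]
      have DX: "(Dn K F *v y) \<bullet> z \<le> \<Gamma> * (norm y * form_seminorm (X F x) z)" for y z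
      proof -
        have "(element_trace K (normal_matrix \<L> (outward_normal K F)) x *v y) \<bullet> z \<le> \<Gamma> * (norm y * form_seminorm (S F x) z)"
          by (rule spec[OF spec[OF conjunct2[OF conjunct2[OF conjunct2[OF q]]]]])
        then show ?thesis by (simp add: facet_trace(2)[OF e x] Dn_def Xx)
      qed
      have XX: "(X F x *v y) \<bullet> z \<le> \<Gamma> * (form_seminorm (X F x) y * form_seminorm (X F x) z)" for y z
        unfolding Xx by (rule spec[OF spec[OF conjunct1[OF conjunct2[OF conjunct2[OF q]]]]])
      have "(Dn K F *v ?y) \<bullet> ?u / 2 - (X F x *v ?y) \<bullet> ?u \<le> \<epsilon> * (norm ?u)\<^sup>2 + ?k * ((X F x *v ?y) \<bullet> ?y)"
        by (rule interior_flux_bound[OF Dn_symmetric[OF e] X_facts(3)[OF e x] X_facts(2)[OF e x] \<epsilon> XX DX])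
      then show "0 \<le> \<epsilon> * (norm ?u)\<^sup>2 - (Dn K F *v ?y) \<bullet> ?u / 2 + (X F x *v ?y) \<bullet> ?u + (X F x *v (?k *\<^sub>R ?y)) \<bullet> ?y"
        unfolding matrix_vector_mult_scaleR inner_scaleR_left by linarith
    qed
    moreover have "\<delta>_int K F * ((Dn K F *v val K v) \<bullet> ?u) - facet_flux K F v u = \<delta>_int K F * ((Dn K F *v ?y) \<bullet> ?u / 2) - (Q K F *v ?y) \<bullet> ?u"
      unfolding facet_flux_def if_not_P[OF False]
      by (simp add: matrix_vector_right_distrib matrix_vector_mult_diff_distrib inner_add_left inner_diff_left field_simps)
    ultimately show ?thesis
      unfolding jump_form_def if_not_P[OF False] matrix_vector_mult_scaleR inner_scaleR_left
      by (simp add: right_diff_distrib mult_ac)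
  qed
qed

text \<open>The factor of \<open>\<delta>_int_bound\<close> summed over the
  \<open>CARD('n) + 1\<close> facets of a simplex.\<close>

definition trace_const :: real
  where "trace_const = real (CARD('n) + 1) * (2 * \<bar>\<sigma>\<bar> / c')"

lemma consistency_estimate:
  assumes v: "v \<in> V\<^sub>h" and u: "u \<in> V\<^sub>h" and \<epsilon>: "0 < \<epsilon>"
  shows "a v u + inner_patch (M\<^sub>1 v) u \<le> flux_const \<Gamma> / \<epsilon> * d v v + \<epsilon> * trace_const * inner_patch u u"
proof -
  have "a v u + inner_patch (M\<^sub>1 v) u \<le> (\<Sum>(K, F)\<in>E. flux_const \<Gamma> / \<epsilon> * jump_form K F v + \<epsilon> * (\<delta>_int K F * (norm (val K u))\<^sup>2))"
    unfolding consistency[OF v u] by (intro sum_mono) (use facet_estimate[OF _ \<epsilon>] in auto)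
  also have "\<dots> = flux_const \<Gamma> / \<epsilon> * d v v + \<epsilon> * (\<Sum>(K, F)\<in>E. \<delta>_int K F * (norm (val K u))\<^sup>2)"
    unfolding d_eq_jump[OF v] by (simp add: split_def sum.distrib sum_distrib_left)
  also have "(\<Sum>(K, F)\<in>E. \<delta>_int K F * (norm (val K u))\<^sup>2) \<le> (\<Sum>(K, F)\<in>E. (2 * \<bar>\<sigma>\<bar> / c' * vol K) * (norm (val K u))\<^sup>2)"
  proof (rule sum_mono)
    fix e assume "e \<in> E"
    moreover obtain K F where eq: "e = (K, F)" by (cases e)
    ultimately have e: "(K, F) \<in> E" by simp
    show "(case e of (K, F) \<Rightarrow> \<delta>_int K F * (norm (val K u))\<^sup>2)
        \<le> (case e of (K, F) \<Rightarrow> (2 * \<bar>\<sigma>\<bar> / c' * vol K) * (norm (val K u))\<^sup>2)"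
      unfolding eq prod.case by (rule mult_right_mono[OF \<delta>_int_bound[OF e]]) simp
  qed
  also have "\<dots> = (\<Sum>K\<in>P. \<Sum>F\<in>{F. F facet_of K}. (2 * \<bar>\<sigma>\<bar> / c' * vol K) * (norm (val K u))\<^sup>2)"
    by (rule sum_E[symmetric])
  also have "\<dots> = (\<Sum>K\<in>P. trace_const * (vol K * (val K u \<bullet> val K u)))"
    by (intro sum.cong refl) (simp add: finite_facets trace_const_def power2_norm_eq_inner)
  also have "\<dots> = trace_const * inner_patch u u"
    by (simp add: inner_patch_eq[OF u u] sum_distrib_left)
  finally show ?thesis using \<epsilon> by (simp add: mult.assoc)
qed

end

section \<open>The kernel of the symmetric part and stability\<close>

context tent_setup
begin

section \<open>Bilinearity and representation of functionals\<close>

lemma Vh_diff: "v \<in> V\<^sub>h \<Longrightarrow> w \<in> V\<^sub>h \<Longrightarrow> (\<lambda>x. v x - w x) \<in> V\<^sub>h"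
  using Vh_lincomb(1)[of v w 1 "-1"] by simp

lemma inner_patch_diff:
  "u \<in> V\<^sub>h \<Longrightarrow> v \<in> V\<^sub>h \<Longrightarrow> w \<in> V\<^sub>h \<Longrightarrow> inner_patch (\<lambda>x. u x - v x) w = inner_patch u w - inner_patch v w"
  using inner_patch_lincomb[of u v w 1 "-1"] by simp

lemma facet_flux_lincomb_right:
  assumes e: "(K, F) \<in> E" and u: "u \<in> V\<^sub>h" and v: "v \<in> V\<^sub>h"
  shows "facet_flux K F w (\<lambda>x. s *\<^sub>R u x + t *\<^sub>R v x) = s * facet_flux K F w u + t * facet_flux K F w v"
proof -
  have "val K (\<lambda>x. s *\<^sub>R u x + t *\<^sub>R v x) = s *\<^sub>R val K u + t *\<^sub>R val K v"
    using Vh_lincomb(2)[OF u v] e by (simp add: E_iff)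
  then show ?thesis by (simp add: facet_flux_def inner_add_right distrib_left mult_ac)
qed

lemma a_lincomb_right:
  assumes u: "u \<in> V\<^sub>h" and v: "v \<in> V\<^sub>h" and w: "w \<in> V\<^sub>h"
  shows "a w (\<lambda>x. s *\<^sub>R u x + t *\<^sub>R v x) = s * a w u + t * a w v"
proof -
  have "(\<Sum>(K, F)\<in>E. facet_flux K F w (\<lambda>x. s *\<^sub>R u x + t *\<^sub>R v x)) = (\<Sum>(K, F)\<in>E. s * facet_flux K F w u + t * facet_flux K F w v)"
    by (rule sum.cong[OF refl]) (auto simp: facet_flux_lincomb_right[OF _ u v])
  then show ?thesis
    unfolding a_eq[OF w Vh_lincomb(1)[OF u v]] a_eq[OF w u] a_eq[OF w v]
    by (simp add: split_def sum.distrib sum_distrib_left)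
qed

lemma facet_flux_lincomb_left:
  assumes e: "(K, F) \<in> E" and u: "u \<in> V\<^sub>h" and v: "v \<in> V\<^sub>h"
  shows "facet_flux K F (\<lambda>x. s *\<^sub>R u x + t *\<^sub>R v x) w = s * facet_flux K F u w + t * facet_flux K F v w"
proof -
  let ?c = "\<lambda>x. s *\<^sub>R u x + t *\<^sub>R v x"
  from e have K: "K \<in> P" by (simp add: E_iff)
  have vK: "val K ?c = s *\<^sub>R val K u + t *\<^sub>R val K v" by (rule Vh_lincomb(2)[OF u v K])
  consider "F \<subseteq> frontier \<Omega>" | "\<not> F \<subseteq> frontier \<Omega>" "vtx \<in> F" | "\<not> F \<subseteq> frontier \<Omega>" "vtx \<notin> F" by blast
  then show ?thesis
  proof cases
    case 1
    then show ?thesis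
      by (simp add: facet_flux_def vK matrix_vector_right_distrib matrix_vector_mult_scaleR inner_add_left algebra_simps)
  next
    case 2
    have "neighbor K F \<in> P" using neighbor_facts(1)[OF e 2(2,1)] by (simp add: E_iff)
    then have "val (neighbor K F) ?c = s *\<^sub>R val (neighbor K F) u + t *\<^sub>R val (neighbor K F) v"
      by (rule Vh_lincomb(2)[OF u v])
    with 2 show ?thesis
      by (simp add: facet_flux_def vK matrix_vector_right_distrib matrix_vector_mult_diff_distrib
          matrix_vector_mult_scaleR inner_add_left inner_diff_left algebra_simps)
  next
    case 3
    then show ?thesis using facet_off_vertex(2,3)[OF e 3(2)] by (simp add: facet_flux_def)
  qed
qed

lemma a_lincomb_left:
  assumes u: "u \<in> V\<^sub>h" and v: "v \<in> V\<^sub>h" and w: "w \<in> V\<^sub>h"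
  shows "a (\<lambda>x. s *\<^sub>R u x + t *\<^sub>R v x) w = s * a u w + t * a v w"
proof -
  have "(\<Sum>(K, F)\<in>E. facet_flux K F (\<lambda>x. s *\<^sub>R u x + t *\<^sub>R v x) w) = (\<Sum>(K, F)\<in>E. s * facet_flux K F u w + t * facet_flux K F v w)"
    by (rule sum.cong[OF refl]) (auto simp: facet_flux_lincomb_left[OF _ u v])
  then show ?thesis
    unfolding a_eq[OF Vh_lincomb(1)[OF u v] w] a_eq[OF u w] a_eq[OF v w]
    by (simp add: split_def sum.distrib sum_distrib_left)
qed

definition unit_fun :: "(real^'n) set \<times> 'l \<Rightarrow> real^'n \<Rightarrow> real^'l"
  where "unit_fun k = pw (\<lambda>K. if K = fst k then axis (snd k) 1 else 0)"

lemma unit_fun_Vh: "unit_fun k \<in> V\<^sub>h" by (simp add: unit_fun_def pw_Vh)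

lemma inner_patch_unit_fun:
  assumes "u \<in> V\<^sub>h" "K \<in> P"
  shows "inner_patch u (unit_fun (K, i)) = vol K * val K u $ i"
proof -
  have "inner_patch u (unit_fun (K, i)) = (\<Sum>K'\<in>P. if K' = K then vol K * val K u $ i else 0)"
    unfolding inner_patch_eq[OF assms(1) unit_fun_Vh]
    by (intro sum.cong refl) (simp add: unit_fun_def val_pw inner_axis)
  then show ?thesis using assms(2) finite_P by simp
qed

lemma linear_functional_zero:
  assumes lin: "\<And>s t u v. u \<in> V\<^sub>h \<Longrightarrow> v \<in> V\<^sub>h \<Longrightarrow> \<psi> (\<lambda>x. s *\<^sub>R u x + t *\<^sub>R v x) = s * \<psi> u + t * \<psi> v"
    and z: "\<And>k. k \<in> P \<times> UNIV \<Longrightarrow> \<psi> (unit_fun k) = (0::real)" and v: "v \<in> V\<^sub>h"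
  shows "\<psi> v = 0"
proof -
  \<comment> \<open>The partial sums of the expansion of v in the basis \<open>unit_fun\<close>;
    linearity of \<psi> over finite sums is obtained by induction on J.\<close>
  define w where "w J x = (\<Sum>k\<in>J. val (fst k) v $ snd k *\<^sub>R unit_fun k x)" for J x
  have zero: "(\<lambda>x. 0) \<in> V\<^sub>h" by (rule VhI(1)[where y = "\<lambda>K. 0"]) auto
  have "\<psi> (\<lambda>x. 0 *\<^sub>R 0 + 0 *\<^sub>R 0) = 0 * \<psi> (\<lambda>x. 0) + 0 * \<psi> (\<lambda>x. 0)" by (rule lin[OF zero zero])
  then have l0: "\<psi> (\<lambda>x. 0) = 0" by simp
  have ind: "w J \<in> V\<^sub>h \<and> \<psi> (w J) = 0" if "finite J" "J \<subseteq> P \<times> UNIV" for J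
    using that
  proof induction
    case empty
    have "w {} = (\<lambda>x. 0)" by (simp add: w_def fun_eq_iff)
    then show ?case using zero l0 by simp
  next
    case (insert k J)
    have eq: "w (insert k J) = (\<lambda>x. val (fst k) v $ snd k *\<^sub>R unit_fun k x + 1 *\<^sub>R w J x)"
      using insert.hyps by (simp add: w_def fun_eq_iff)
    have wJ: "w J \<in> V\<^sub>h" "\<psi> (w J) = 0" using insert by auto
    have "w (insert k J) \<in> V\<^sub>h" unfolding eq by (rule Vh_lincomb(1)[OF unit_fun_Vh wJ(1)])
    moreover have "\<psi> (unit_fun k) = 0" using insert.prems by (intro z) simp
    then have "\<psi> (w (insert k J)) = 0" unfolding eq lin[OF unit_fun_Vh wJ(1)] using wJ(2) by simp
    ultimately show ?case ..
  qed
  have fin: "finite (P \<times> (UNIV :: 'l set))" using finite_P by simp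
  note w = ind[OF fin subset_refl]
  have "w (P \<times> UNIV) = v"
  proof (rule Vh_ext[OF conjunct1[OF w] v])
    fix K assume K: "K \<in> P"
    have "w (P \<times> UNIV) x = val K v" if x: "x \<in> interior K" for x
    proof -
      have "w (P \<times> UNIV) x = (\<Sum>K'\<in>P. \<Sum>i\<in>UNIV. val K' v $ i *\<^sub>R unit_fun (K', i) x)"
        unfolding w_def by (simp add: sum.cartesian_product split_def)
      also have "\<dots> = (\<Sum>K'\<in>P. if K' = K then \<Sum>i\<in>UNIV. val K v $ i *\<^sub>R axis i 1 else 0)"
        by (intro sum.cong refl) (auto simp: unit_fun_def pw_interior[OF K x])
      also have "\<dots> = (\<Sum>i\<in>UNIV. val K v $ i *\<^sub>R axis i 1)" using K finite_P by simp
      also have "\<dots> = val K v" using basis_expansion[of "val K v"] by (simp add: scalar_mult_eq_scaleR)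
      finally show ?thesis .
    qed
    then show "val K (w (P \<times> UNIV)) = val K v" using interior_ne[OF K] by (intro val_eqI)
  qed
  with w show ?thesis by simp
qed

text \<open>The basis \<open>unit_fun\<close> is orthogonal with squared norms \<open>vol K\<close>,
  so the representative can be written down. Existence and uniqueness resolve the THE in
  \<open>A\<^sub>h\<close> and \<open>A\<^sub>h_adjoint\<close>.\<close>

lemma riesz:
  assumes lin: "\<And>s t u v. u \<in> V\<^sub>h \<Longrightarrow> v \<in> V\<^sub>h \<Longrightarrow> \<psi> (\<lambda>x. s *\<^sub>R u x + t *\<^sub>R v x) = s * \<psi> u + t * (\<psi> v :: real)"
  shows "\<exists>!u. u \<in> V\<^sub>h \<and> (\<forall>v\<in>V\<^sub>h. inner_patch u v = \<psi> v)"
proof (rule ex_ex1I)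
  define u where "u = pw (\<lambda>K. \<chi> i. \<psi> (unit_fun (K, i)) / vol K)"
  have u: "u \<in> V\<^sub>h" by (simp add: u_def pw_Vh)
  have "inner_patch u v - \<psi> v = 0" if v: "v \<in> V\<^sub>h" for v
  proof (rule linear_functional_zero[of "\<lambda>v. inner_patch u v - \<psi> v", OF _ _ v])
    fix s t :: real and w z assume wz: "w \<in> V\<^sub>h" "z \<in> V\<^sub>h"
    show "inner_patch u (\<lambda>x. s *\<^sub>R w x + t *\<^sub>R z x) - \<psi> (\<lambda>x. s *\<^sub>R w x + t *\<^sub>R z x)
        = s * (inner_patch u w - \<psi> w) + t * (inner_patch u z - \<psi> z)"
      using inner_patch_lincomb[OF wz u, of s t] lin[OF wz, of s t]
      by (simp add: inner_patch_commute[of u] right_diff_distrib)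
  next
    fix k :: "(real^'n) set \<times> 'l" assume "k \<in> P \<times> UNIV"
    moreover obtain K i where k: "k = (K, i)" by (cases k)
    ultimately have K: "K \<in> P" by simp
    show "inner_patch u (unit_fun k) - \<psi> (unit_fun k) = 0"
      unfolding k inner_patch_unit_fun[OF u K] using vol_pos[OF K] by (simp add: u_def val_pw[OF K])
  qed
  then show "\<exists>u. u \<in> V\<^sub>h \<and> (\<forall>v\<in>V\<^sub>h. inner_patch u v = \<psi> v)" using u by auto
next
  fix u w assume "u \<in> V\<^sub>h \<and> (\<forall>v\<in>V\<^sub>h. inner_patch u v = \<psi> v)" "w \<in> V\<^sub>h \<and> (\<forall>v\<in>V\<^sub>h. inner_patch w v = \<psi> v)"
  then show "u = w" by (intro Vh_eqI) auto
qed

lemma Ah: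
  assumes w: "w \<in> V\<^sub>h"
  shows "A\<^sub>h w \<in> V\<^sub>h" and "v \<in> V\<^sub>h \<Longrightarrow> inner_patch (A\<^sub>h w) v = a w v"
proof -
  have "\<exists>!u. u \<in> V\<^sub>h \<and> (\<forall>v\<in>V\<^sub>h. inner_patch u v = a w v)"
    by (rule riesz) (rule a_lincomb_right[OF _ _ w])
  note the = theI'[OF this, folded A\<^sub>h_def]
  show "A\<^sub>h w \<in> V\<^sub>h" by (rule conjunct1[OF the])
  show "v \<in> V\<^sub>h \<Longrightarrow> inner_patch (A\<^sub>h w) v = a w v" by (rule bspec[OF conjunct2[OF the]])
qed

lemma Ah_adjoint:
  assumes w: "w \<in> V\<^sub>h"
  shows "A\<^sub>h_adjoint w \<in> V\<^sub>h" and "v \<in> V\<^sub>h \<Longrightarrow> inner_patch (A\<^sub>h_adjoint w) v = a v w"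
proof -
  have eq: "inner_patch w (A\<^sub>h v) = a v w" if "v \<in> V\<^sub>h" for v
    using Ah(2)[OF that w] by (simp add: inner_patch_commute)
  have "\<exists>!u. u \<in> V\<^sub>h \<and> (\<forall>v\<in>V\<^sub>h. inner_patch u v = inner_patch w (A\<^sub>h v))"
    by (rule riesz) (simp add: eq a_lincomb_left[OF _ _ w] Vh_lincomb(1))
  note the = theI'[OF this, folded A\<^sub>h_adjoint_def]
  show "A\<^sub>h_adjoint w \<in> V\<^sub>h" by (rule conjunct1[OF the])
  show "inner_patch (A\<^sub>h_adjoint w) v = a v w" if v: "v \<in> V\<^sub>h"
    using bspec[OF conjunct2[OF the] v] eq[OF v] by simp
qed

lemma M1_lincomb:
  assumes u: "u \<in> V\<^sub>h" and v: "v \<in> V\<^sub>h" and w: "w \<in> V\<^sub>h"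
  shows "inner_patch (M\<^sub>1 (\<lambda>x. s *\<^sub>R u x + t *\<^sub>R v x)) w = s * inner_patch (M\<^sub>1 u) w + t * inner_patch (M\<^sub>1 v) w"
  unfolding M1_symmetric[OF Vh_lincomb(1)[OF u v] w] M1_symmetric[OF u w] M1_symmetric[OF v w]
    inner_patch_commute[of "M\<^sub>1 w"] by (rule inner_patch_lincomb[OF u v M1_Vh(1)[OF w]])

lemma d_lincomb:
  assumes "u \<in> V\<^sub>h" "v \<in> V\<^sub>h" "w \<in> V\<^sub>h"
  shows "d (\<lambda>x. s *\<^sub>R u x + t *\<^sub>R v x) w = s * d u w + t * d v w"
  unfolding d_def a_lincomb_left[OF assms] a_lincomb_right[OF assms] M1_lincomb[OF assms] by (simp add: algebra_simps)

lemma d_commute: "u \<in> V\<^sub>h \<Longrightarrow> v \<in> V\<^sub>h \<Longrightarrow> d u v = d v u"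
  unfolding d_def using M1_symmetric[of u v] by simp

section \<open>The kernel of the symmetric part\<close>

definition sym_op :: "(real^'n \<Rightarrow> real^'l) \<Rightarrow> real^'n \<Rightarrow> real^'l"
  where "sym_op v x = A\<^sub>h v x + A\<^sub>h_adjoint v x + M\<^sub>1 v x"

lemma sym_op:
  assumes v: "v \<in> V\<^sub>h"
  shows "sym_op v \<in> V\<^sub>h" and "w \<in> V\<^sub>h \<Longrightarrow> inner_patch (sym_op v) w = - d v w"
proof -
  let ?s = "\<lambda>x. 1 *\<^sub>R A\<^sub>h v x + 1 *\<^sub>R A\<^sub>h_adjoint v x"
  have s: "?s \<in> V\<^sub>h" by (rule Vh_lincomb(1)[OF Ah(1)[OF v] Ah_adjoint(1)[OF v]])
  have eq: "sym_op v = (\<lambda>x. 1 *\<^sub>R ?s x + 1 *\<^sub>R M\<^sub>1 v x)" by (simp add: sym_op_def fun_eq_iff)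
  show "sym_op v \<in> V\<^sub>h" unfolding eq by (rule Vh_lincomb(1)[OF s M1_Vh(1)[OF v]])
  show "inner_patch (sym_op v) w = - d v w" if w: "w \<in> V\<^sub>h"
    unfolding eq inner_patch_lincomb[OF s M1_Vh(1)[OF v] w] inner_patch_lincomb[OF Ah(1)[OF v] Ah_adjoint(1)[OF v] w]
    by (simp add: Ah(2)[OF v w] Ah_adjoint(2)[OF v w] d_def)
qed

text \<open>The operator is selfadjoint, so its kernel is the orthogonal complement of its range,
  tested on the images of a basis. These are finitely many conditions, as
  \<open>finite_projection\<close> requires.\<close>

lemma Kh_iff: "v \<in> K\<^sub>h \<longleftrightarrow> v \<in> V\<^sub>h \<and> (\<forall>k\<in>P \<times> UNIV. inner_patch (sym_op (unit_fun k)) v = 0)"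
proof -
  have "(\<forall>x. sym_op v x = 0) \<longleftrightarrow> (\<forall>k\<in>P \<times> UNIV. inner_patch (sym_op (unit_fun k)) v = 0)" if v: "v \<in> V\<^sub>h"
  proof
    assume "\<forall>x. sym_op v x = 0"
    then have "inner_patch (sym_op v) (unit_fun k) = 0" for k by (simp add: inner_patch_def set_lebesgue_integral_def)
    then show "\<forall>k\<in>P \<times> UNIV. inner_patch (sym_op (unit_fun k)) v = 0"
      using sym_op(2)[OF v unit_fun_Vh] sym_op(2)[OF unit_fun_Vh v] d_commute[OF v unit_fun_Vh] by simp
  next
    assume z: "\<forall>k\<in>P \<times> UNIV. inner_patch (sym_op (unit_fun k)) v = 0"
    have "inner_patch (sym_op v) (sym_op v) = 0"
    proof (rule linear_functional_zero[of "inner_patch (sym_op v)", OF _ _ sym_op(1)[OF v]])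
      fix s t :: real and w u assume wu: "w \<in> V\<^sub>h" "u \<in> V\<^sub>h"
      show "inner_patch (sym_op v) (\<lambda>x. s *\<^sub>R w x + t *\<^sub>R u x) = s * inner_patch (sym_op v) w + t * inner_patch (sym_op v) u"
        using inner_patch_lincomb[OF wu sym_op(1)[OF v], of s t] by (simp add: inner_patch_commute[of "sym_op v"])
    next
      show "inner_patch (sym_op v) (unit_fun k) = 0" if "k \<in> P \<times> UNIV" for k
        using bspec[OF z that] sym_op(2)[OF v unit_fun_Vh] sym_op(2)[OF unit_fun_Vh v] d_commute[OF v unit_fun_Vh] by simp
    qed
    then have "sym_op v = (\<lambda>x. 0)" by (rule inner_patch_definite[OF sym_op(1)[OF v]])
    then show "\<forall>x. sym_op v x = 0" by simp
  qed
  then show ?thesis unfolding K\<^sub>h_def sym_op_def[symmetric] by blast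
qed

lemma Kh_d: "v \<in> K\<^sub>h \<Longrightarrow> w \<in> V\<^sub>h \<Longrightarrow> d v w = 0"
proof -
  assume v: "v \<in> K\<^sub>h" and w: "w \<in> V\<^sub>h"
  then have vV: "v \<in> V\<^sub>h" and "\<forall>x. sym_op v x = 0" unfolding K\<^sub>h_def sym_op_def by auto
  then have "inner_patch (sym_op v) w = 0" by (simp add: inner_patch_def set_lebesgue_integral_def)
  then show "d v w = 0" using sym_op(2)[OF vV w] by simp
qed

text \<open>The projection \<open>p\<close> of \<open>v\<close> onto the span of the \<open>e k\<close>: membership in the span is replaced by
  orthogonality to everything that is orthogonal to the \<open>e k\<close>.\<close>

lemma finite_projection:
  assumes "finite J" "\<And>k. k \<in> J \<Longrightarrow> e k \<in> V\<^sub>h" "v \<in> V\<^sub>h"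
  shows "\<exists>p\<in>V\<^sub>h. (\<forall>z\<in>V\<^sub>h. (\<forall>k\<in>J. inner_patch (e k) z = 0) \<longrightarrow> inner_patch p z = 0) \<and>
    (\<forall>k\<in>J. inner_patch (e k) (\<lambda>x. v x - p x) = 0)"
  using assms
proof (induction J arbitrary: v rule: finite_induct)
  case empty
  have "(\<lambda>x. 0) \<in> V\<^sub>h" by (rule VhI(1)[where y = "\<lambda>K. 0"]) auto
  then show ?case by (intro bexI[of _ "\<lambda>x. 0"]) (simp_all add: inner_patch_def set_lebesgue_integral_def)
next
  case (insert j J)
  have ej: "e j \<in> V\<^sub>h" and eJ: "\<And>k. k \<in> J \<Longrightarrow> e k \<in> V\<^sub>h" using insert.prems by auto
  obtain p where p: "p \<in> V\<^sub>h" "\<And>z. z \<in> V\<^sub>h \<Longrightarrow> (\<forall>k\<in>J. inner_patch (e k) z = 0) \<Longrightarrow> inner_patch p z = 0"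
      "\<And>k. k \<in> J \<Longrightarrow> inner_patch (e k) (\<lambda>x. v x - p x) = 0"
    using insert.IH[OF eJ insert.prems(2)] by blast
  obtain p' where p': "p' \<in> V\<^sub>h" "\<And>z. z \<in> V\<^sub>h \<Longrightarrow> (\<forall>k\<in>J. inner_patch (e k) z = 0) \<Longrightarrow> inner_patch p' z = 0"
      "\<And>k. k \<in> J \<Longrightarrow> inner_patch (e k) (\<lambda>x. e j x - p' x) = 0"
    using insert.IH[OF eJ ej] by blast
  define q where "q = (\<lambda>x. e j x - p' x)"
  have q: "q \<in> V\<^sub>h" unfolding q_def by (rule Vh_diff[OF ej p'(1)])
  define r where "r = (\<lambda>x. v x - p x)"
  have r: "r \<in> V\<^sub>h" unfolding r_def by (rule Vh_diff[OF insert.prems(2) p(1)])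
  \<comment> \<open>The coefficient of a Gram-Schmidt step. If q = 0 the quotient is 0 by
    convention, and orthogonality to q is trivial.\<close>
  define t where "t = inner_patch r q / inner_patch q q"
  define p2 where "p2 = (\<lambda>x. 1 *\<^sub>R p x + t *\<^sub>R q x)"
  have p2: "p2 \<in> V\<^sub>h" unfolding p2_def by (rule Vh_lincomb(1)[OF p(1) q])
  have r2eq: "(\<lambda>x. v x - p2 x) = (\<lambda>x. 1 *\<^sub>R r x + (- t) *\<^sub>R q x)" by (simp add: p2_def r_def fun_eq_iff)
  have r2: "(\<lambda>x. v x - p2 x) \<in> V\<^sub>h" unfolding r2eq by (rule Vh_lincomb(1)[OF r q])
  have r2i: "inner_patch w (\<lambda>x. v x - p2 x) = inner_patch w r - t * inner_patch w q" if "w \<in> V\<^sub>h" for w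
    using inner_patch_lincomb[OF r q that, of 1 "- t"] unfolding r2eq by (simp add: inner_patch_commute[of w])
  have perpJ: "inner_patch (e k) (\<lambda>x. v x - p2 x) = 0" if "k \<in> J" for k
    using r2i[OF eJ[OF that]] p(3)[OF that] p'(3)[OF that] by (simp add: r_def q_def)
  have perpq: "inner_patch q (\<lambda>x. v x - p2 x) = 0"
  proof (cases "inner_patch q q = 0")
    case True
    then have "q = (\<lambda>x. 0)" by (rule inner_patch_definite[OF q])
    then show ?thesis by (simp add: inner_patch_def set_lebesgue_integral_def)
  next
    case False
    then show ?thesis by (simp add: r2i[OF q] t_def inner_patch_commute[of q r])
  qed
  have perpj: "inner_patch (e j) (\<lambda>x. v x - p2 x) = 0"
    using inner_patch_diff[OF ej p'(1) r2] perpq p'(2)[OF r2] perpJ by (simp add: q_def)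
  show ?case
  proof (intro bexI[OF _ p2] conjI ballI impI)
    fix z assume z: "z \<in> V\<^sub>h" "\<forall>k\<in>insert j J. inner_patch (e k) z = 0"
    then have "inner_patch q z = 0" unfolding q_def inner_patch_diff[OF ej p'(1) z(1)] using p'(2)[OF z(1)] by simp
    then show "inner_patch p2 z = 0" unfolding p2_def inner_patch_lincomb[OF p(1) q z(1)] using p(2)[OF z(1)] z(2) by simp
  next
    fix k assume "k \<in> insert j J"
    then show "inner_patch (e k) (\<lambda>x. v x - p2 x) = 0" using perpj perpJ by blast
  qed
qed

text \<open>\<open>K\<^sub>h\<close> is the orthogonal complement of the range of the selfadjoint operator
  \<open>A\<^sub>h + A\<^sub>h\<^sup>t + M\<^sub>1\<close>, so projecting onto this range splits off the component in \<open>K\<^sub>h\<close>.\<close>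

lemma kernel_decomposition:
  assumes v: "v \<in> V\<^sub>h"
  obtains p where "p \<in> K\<^sub>h_perp" "(\<lambda>x. v x - p x) \<in> K\<^sub>h"
proof -
  have fin: "finite (P \<times> (UNIV :: 'l set))" using finite_P by simp
  have "\<exists>p\<in>V\<^sub>h. (\<forall>z\<in>V\<^sub>h. (\<forall>k\<in>P \<times> UNIV. inner_patch (sym_op (unit_fun k)) z = 0) \<longrightarrow> inner_patch p z = 0) \<and>
      (\<forall>k\<in>P \<times> UNIV. inner_patch (sym_op (unit_fun k)) (\<lambda>x. v x - p x) = 0)"
    by (rule finite_projection[OF fin _ v]) (rule sym_op(1)[OF unit_fun_Vh])
  then obtain p where p: "p \<in> V\<^sub>h \<and> (\<forall>z\<in>V\<^sub>h. (\<forall>k\<in>P \<times> UNIV. inner_patch (sym_op (unit_fun k)) z = 0) \<longrightarrow> inner_patch p z = 0) \<and>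
      (\<forall>k\<in>P \<times> UNIV. inner_patch (sym_op (unit_fun k)) (\<lambda>x. v x - p x) = 0)"
    unfolding Bex_def by (rule exE)
  note p = conjunct1[OF p] conjunct1[OF conjunct2[OF p]] conjunct2[OF conjunct2[OF p]]
  have "inner_patch p z = 0" if "z \<in> K\<^sub>h" for z
    using that p(2) unfolding Kh_iff by simp
  then have "p \<in> K\<^sub>h_perp" unfolding K\<^sub>h_perp_def using p(1) by simp
  moreover have "(\<lambda>x. v x - p x) \<in> K\<^sub>h" using Kh_iff Vh_diff[OF v p(1)] p(3) by simp
  ultimately show thesis by (rule that)
qed

text \<open>For v in the kernel d v v = 0, so \<open>consistency_estimate\<close> leaves \<epsilon>
  times a constant for every \<epsilon> > 0; applied to w and to - w it yields equality. Thus the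
  kernel of the symmetric part is annihilated by \<open>A\<^sub>h + M\<^sub>1\<close>
  itself.\<close>

lemma kernel_consistency:
  assumes v: "v \<in> K\<^sub>h" and w: "w \<in> V\<^sub>h"
  shows "a v w + inner_patch (M\<^sub>1 v) w = 0"
proof -
  have vV: "v \<in> V\<^sub>h" using v by (simp add: K\<^sub>h_def)
  have le: "a v w + inner_patch (M\<^sub>1 v) w \<le> 0" if w: "w \<in> V\<^sub>h" for w
  proof (rule field_le_epsilon)
    fix e :: real assume e: "0 < e"
    define k where "k = trace_const * inner_patch w w"
    define \<epsilon> where "\<epsilon> = e / (\<bar>k\<bar> + 1)"
    have \<epsilon>: "0 < \<epsilon>" using e by (simp add: \<epsilon>_def)
    have "a v w + inner_patch (M\<^sub>1 v) w \<le> \<epsilon> * k"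
      using consistency_estimate[OF vV w \<epsilon>] Kh_d[OF v vV] by (simp add: k_def mult.assoc)
    also have "\<dots> \<le> \<epsilon> * (\<bar>k\<bar> + 1)" using \<epsilon> by (intro mult_left_mono) auto
    also have "\<dots> = e" by (simp add: \<epsilon>_def)
    finally show "a v w + inner_patch (M\<^sub>1 v) w \<le> 0 + e" by simp
  qed
  have m: "(\<lambda>x. 0 *\<^sub>R w x + (- 1) *\<^sub>R w x) \<in> V\<^sub>h" by (rule Vh_lincomb(1)[OF w w])
  have "a v (\<lambda>x. 0 *\<^sub>R w x + (- 1) *\<^sub>R w x) + inner_patch (M\<^sub>1 v) (\<lambda>x. 0 *\<^sub>R w x + (- 1) *\<^sub>R w x) = - (a v w + inner_patch (M\<^sub>1 v) w)"
    using a_lincomb_right[OF w w vV, of 0 "-1"] inner_patch_lincomb[OF w w M1_Vh(1)[OF vV], of 0 "-1"]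
    by (simp add: inner_patch_commute[of "M\<^sub>1 v"])
  with le[OF m] le[OF w] show ?thesis by linarith
qed

section \<open>Increments, the bound on \<kappa> and stability of a step\<close>

definition AM :: "(real^'n \<Rightarrow> real^'l) \<Rightarrow> real^'n \<Rightarrow> real^'l"
  where "AM v x = A\<^sub>h v x + M\<^sub>1 v x"

lemma AM:
  assumes v: "v \<in> V\<^sub>h"
  shows "AM v \<in> V\<^sub>h" and "w \<in> V\<^sub>h \<Longrightarrow> inner_patch (AM v) w = a v w + inner_patch (M\<^sub>1 v) w"
proof -
  have eq: "AM v = (\<lambda>x. 1 *\<^sub>R A\<^sub>h v x + 1 *\<^sub>R M\<^sub>1 v x)" by (simp add: AM_def fun_eq_iff)
  show "AM v \<in> V\<^sub>h" unfolding eq by (rule Vh_lincomb(1)[OF Ah(1)[OF v] M1_Vh(1)[OF v]])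
  show "inner_patch (AM v) w = a v w + inner_patch (M\<^sub>1 v) w" if w: "w \<in> V\<^sub>h"
    unfolding eq inner_patch_lincomb[OF Ah(1)[OF v] M1_Vh(1)[OF v] w] by (simp add: Ah(2)[OF v w])
qed

lemma increment_eq: "increment \<tau> v = M_inv \<tau> (AM v)"
  by (simp add: increment_def AM_def[abs_def])

lemma increment:
  assumes v: "v \<in> V\<^sub>h" and \<tau>: "\<tau> \<in> {0..1}"
  shows "increment \<tau> v \<in> V\<^sub>h" and "M \<tau> (increment \<tau> v) = AM v"
  unfolding increment_eq using M_inv[OF AM(1)[OF v] \<tau>] by auto

lemma increment_kernel:
  assumes v: "v \<in> V\<^sub>h" and p: "p \<in> V\<^sub>h" and z: "(\<lambda>x. v x - p x) \<in> K\<^sub>h"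
  shows "increment \<tau> v = increment \<tau> p" and "d v v = d p p"
proof -
  let ?z = "\<lambda>x. v x - p x"
  have zV: "?z \<in> V\<^sub>h" using z by (simp add: K\<^sub>h_def)
  have veq: "v = (\<lambda>x. 1 *\<^sub>R ?z x + 1 *\<^sub>R p x)" by (simp add: fun_eq_iff)
  have "AM v = AM p"
  proof (rule Vh_eqI[OF AM(1)[OF v] AM(1)[OF p]])
    fix w assume w: "w \<in> V\<^sub>h"
    have "a v w = a ?z w + a p w" "inner_patch (M\<^sub>1 v) w = inner_patch (M\<^sub>1 ?z) w + inner_patch (M\<^sub>1 p) w"
      using a_lincomb_left[OF zV p w, of 1 1] M1_lincomb[OF zV p w, of 1 1] veq by auto
    then show "inner_patch (AM v) w = inner_patch (AM p) w"
      using kernel_consistency[OF z w] AM(2)[OF v w] AM(2)[OF p w] by simp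
  qed
  then show "increment \<tau> v = increment \<tau> p" by (simp add: increment_eq)
  have "d v w = d p w" if w: "w \<in> V\<^sub>h" for w
    using d_lincomb[OF zV p w, of 1 1] Kh_d[OF z w] veq by simp
  then show "d v v = d p p" using d_commute[OF v p] v p by simp
qed

lemma M_form:
  assumes "u \<in> V\<^sub>h" "w \<in> V\<^sub>h"
  shows "inner_patch (M \<tau> u) w = (\<Sum>K\<in>P. vol K * ((Mmat \<tau> K *v val K u) \<bullet> val K w))"
  unfolding inner_patch_eq[OF M_Vh(1)[OF assms(1)] assms(2)]
  by (intro sum.cong refl) (simp add: M_Vh(2)[OF assms(1)])

lemma M_form_coercive:
  assumes u: "u \<in> V\<^sub>h" and \<tau>: "\<tau> \<in> {0..1}"
  shows "m0 * inner_patch u u \<le> inner_patch (M \<tau> u) u"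
proof -
  have "m0 * inner_patch u u = (\<Sum>K\<in>P. vol K * (m0 * (norm (val K u))\<^sup>2))"
    unfolding inner_patch_eq[OF u u] by (simp add: sum_distrib_left power2_norm_eq_inner mult_ac)
  also have "\<dots> \<le> inner_patch (M \<tau> u) u"
    unfolding M_form[OF u u] by (intro sum_mono mult_left_mono Mmat_coercive[OF _ \<tau>]) auto
  finally show ?thesis .
qed

lemma inner_patch_nonneg: "0 \<le> inner_patch u u"
  unfolding inner_patch_def set_lebesgue_integral_def by (intro integral_nonneg_AE AE_I2) simp

lemma M_norm_sq:
  assumes u: "u \<in> V\<^sub>h" and \<tau>: "\<tau> \<in> {0..1}" and ne: "P \<noteq> {}"
  shows "(M_norm \<tau> u)\<^sup>2 = inner_patch (M \<tau> u) u" "0 \<le> inner_patch (M \<tau> u) u"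
proof -
  obtain K where "K \<in> P" using ne by blast
  then have "0 \<le> m0 * inner_patch u u" using m0_pos inner_patch_nonneg by (simp add: less_imp_le)
  then show "0 \<le> inner_patch (M \<tau> u) u" using M_form_coercive[OF u \<tau>] by linarith
  then show "(M_norm \<tau> u)\<^sup>2 = inner_patch (M \<tau> u) u" by (simp add: M_norm_def)
qed

text \<open>Equals 2 \<open>flux_const \<Gamma>\<close> / \<epsilon> for the \<epsilon> chosen in
  \<open>increment_bound\<close>.\<close>

definition stab_const :: real
  where "stab_const = 4 * flux_const \<Gamma> * (trace_const + 1) / m0"

text \<open>Testing the equation \<open>M \<tau> u = AM v\<close> with u itself makes the energy of
  u the quantity bounded in \<open>consistency_estimate\<close>; coercivity absorbs the term with
  |u|^2.\<close>

lemma increment_bound: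
  assumes v: "v \<in> V\<^sub>h" and \<tau>: "\<tau> \<in> {0..1}" and ne: "P \<noteq> {}"
  shows "inner_patch (M \<tau> (increment \<tau> v)) (increment \<tau> v) \<le> stab_const * d v v"
proof -
  obtain K where K: "K \<in> P" using ne by blast
  have m: "0 < m0" by (rule m0_pos[OF K])
  have t: "0 \<le> trace_const" using c'_pos[OF K] by (simp add: trace_const_def)
  define u where "u = increment \<tau> v"
  have u: "u \<in> V\<^sub>h" "M \<tau> u = AM v" using increment[OF v \<tau>] by (auto simp: u_def)
  \<comment> \<open>By coercivity the term with \<epsilon> is then at most half the energy of u,
    whence the factor 2 below; the 1 keeps the denominator positive when \<sigma> = 0.\<close>
  define \<epsilon> where "\<epsilon> = m0 / (2 * (trace_const + 1))"
  have \<epsilon>: "0 < \<epsilon>" using m t by (simp add: \<epsilon>_def)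
  have "inner_patch (M \<tau> u) u \<le> flux_const \<Gamma> / \<epsilon> * d v v + \<epsilon> * trace_const * inner_patch u u"
    unfolding u(2) AM(2)[OF v u(1)] by (rule consistency_estimate[OF v u(1) \<epsilon>])
  also have "\<epsilon> * trace_const * inner_patch u u \<le> m0 / 2 * inner_patch u u"
  proof (rule mult_right_mono[OF _ inner_patch_nonneg])
    have "\<epsilon> * trace_const \<le> \<epsilon> * (trace_const + 1)" using \<epsilon> by (intro mult_left_mono) auto
    also have "\<epsilon> * (trace_const + 1) = m0 / 2"
    proof -
      have "m0 / (2 * x) * x = m0 / 2" if "x \<noteq> 0" for x :: real using that by simp
      from this[of "trace_const + 1"] show ?thesis using t unfolding \<epsilon>_def by linarith
    qed
    finally show "\<epsilon> * trace_const \<le> m0 / 2" .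
  qed
  also have "m0 / 2 * inner_patch u u \<le> inner_patch (M \<tau> u) u / 2" using M_form_coercive[OF u(1) \<tau>] by simp
  finally have "inner_patch (M \<tau> u) u \<le> 2 * (flux_const \<Gamma> / \<epsilon>) * d v v" by linarith
  also have "2 * (flux_const \<Gamma> / \<epsilon>) = stab_const" using m t by (simp add: \<epsilon>_def stab_const_def)
  finally show ?thesis by (simp add: u_def)
qed

lemma d_seminorm_sq: "v \<in> V\<^sub>h \<Longrightarrow> (d_seminorm v)\<^sup>2 = d v v"
  unfolding d_seminorm_def using d_nonneg by simp

lemma \<kappa>_le:
  assumes ne: "P \<noteq> {}"
  shows "\<kappa> \<le> ennreal \<bar>stab_const\<bar>"
  unfolding \<kappa>_def
proof (intro SUP_least)
  fix \<tau> v assume \<tau>: "\<tau> \<in> {0..1::real}" and v: "v \<in> K\<^sub>h_perp - {\<lambda>x. 0}"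
  then have vV: "v \<in> V\<^sub>h" by (simp add: K\<^sub>h_perp_def)
  have sq: "(M_norm \<tau> (increment \<tau> v))\<^sup>2 = inner_patch (M \<tau> (increment \<tau> v)) (increment \<tau> v)"
    by (rule M_norm_sq(1)[OF increment(1)[OF vV \<tau>] \<tau> ne])
  have dn: "0 \<le> d v v" by (rule d_nonneg[OF vV])
  have le: "(M_norm \<tau> (increment \<tau> v))\<^sup>2 \<le> \<bar>stab_const\<bar> * d v v"
    unfolding sq using increment_bound[OF vV \<tau> ne] mult_right_mono[OF abs_ge_self[of stab_const] dn] by linarith
  show "ennreal ((M_norm \<tau> (increment \<tau> v))\<^sup>2) / ennreal ((d_seminorm v)\<^sup>2) \<le> ennreal \<bar>stab_const\<bar>"
  proof (cases "d v v = 0")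
    \<comment> \<open>The norm of the increment vanishes with d v v, and 0 / 0 = 0 in
      \<open>ennreal\<close>.\<close>
    case True
    then have "(M_norm \<tau> (increment \<tau> v))\<^sup>2 = 0" using le by simp
    then show ?thesis by simp
  next
    case False
    then show ?thesis
      unfolding d_seminorm_sq[OF vV] using le dn by (subst divide_ennreal) (auto simp: pos_divide_le_eq)
  qed
qed

text \<open>\<kappa> only concerns vectors of \<open>K\<^sub>h_perp\<close>; the component in
  \<open>K\<^sub>h\<close> changes neither side and is removed. A real k above \<kappa> is allowed
  so that k can be \<kappa> itself or the number of subtents.\<close>

lemma increment_\<kappa>:
  assumes v: "v \<in> V\<^sub>h" and \<tau>: "\<tau> \<in> {0..1}" and ne: "P \<noteq> {}" and k: "\<kappa> \<le> ennreal k" "0 \<le> k"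
  shows "inner_patch (M \<tau> (increment \<tau> v)) (increment \<tau> v) \<le> k * d v v"
proof -
  obtain p where p: "p \<in> K\<^sub>h_perp" "(\<lambda>x. v x - p x) \<in> K\<^sub>h" using kernel_decomposition[OF v] .
  have pV: "p \<in> V\<^sub>h" using p(1) by (simp add: K\<^sub>h_perp_def)
  note eq = increment_kernel[OF v pV p(2)]
  let ?u = "increment \<tau> p"
  have uV: "?u \<in> V\<^sub>h" by (rule increment(1)[OF pV \<tau>])
  have "inner_patch (M \<tau> ?u) ?u \<le> k * d p p"
  proof (cases "d p p = 0")
    \<comment> \<open>The quotient says nothing here; the a priori bound already makes the left side
      at most 0.\<close>
    case True
    then show ?thesis using increment_bound[OF pV \<tau> ne] by simp
  next
    case False
    then have dp: "0 < d p p" using d_nonneg[OF pV] by simp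
    have "p \<noteq> (\<lambda>x. 0)"
    proof
      assume p0: "p = (\<lambda>x. 0)"
      have "d (\<lambda>x. 0 *\<^sub>R p x + 0 *\<^sub>R p x) p = 0" unfolding d_lincomb[OF pV pV pV] by simp
      moreover have "(\<lambda>x. 0 *\<^sub>R p x + 0 *\<^sub>R p x) = p" by (simp add: p0)
      ultimately show False using dp by simp
    qed
    then have pm: "p \<in> K\<^sub>h_perp - {\<lambda>x. 0}" using p(1) by simp
    have "ennreal ((M_norm \<tau> ?u)\<^sup>2) / ennreal ((d_seminorm p)\<^sup>2) \<le> \<kappa>"
      unfolding \<kappa>_def by (rule SUP_upper2[OF \<tau>], rule SUP_upper[OF pm])
    also note k(1)
    finally have "(M_norm \<tau> ?u)\<^sup>2 / d p p \<le> k"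
      unfolding d_seminorm_sq[OF pV] using dp k(2) by (subst (asm) divide_ennreal) auto
    then show ?thesis using dp M_norm_sq(1)[OF uV \<tau> ne] by (simp add: pos_divide_le_eq)
  qed
  then show ?thesis by (simp only: eq)
qed

text \<open>As M is affine in time, passing from M(t) to M(t + h) contributes - h (M_1 v, v). The
  increment is taken with M at the end time t + h, so the cross term is 2 h (a(v, v) + (M_1 v, v)).
  Together these are - h d(v, v).\<close>

lemma energy_identity:
  assumes v: "v \<in> V\<^sub>h" and \<tau>: "t + h \<in> {0..1}"
  shows "inner_patch (M (t + h) (\<lambda>x. v x + h *\<^sub>R increment (t + h) v x)) (\<lambda>x. v x + h *\<^sub>R increment (t + h) v x)
    = inner_patch (M t v) v - h * d v v + h\<^sup>2 * inner_patch (M (t + h) (increment (t + h) v)) (increment (t + h) v)"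
proof -
  define u where "u = increment (t + h) v"
  have u: "u \<in> V\<^sub>h" "M (t + h) u = AM v" using increment[OF v \<tau>] by (auto simp: u_def)
  let ?w = "\<lambda>x. 1 *\<^sub>R v x + h *\<^sub>R u x"
  have w: "?w \<in> V\<^sub>h" by (rule Vh_lincomb(1)[OF v u(1)])
  have "inner_patch (M (t + h) ?w) ?w = (\<Sum>K\<in>P. vol K * ((Mmat (t + h) K *v val K v) \<bullet> val K v)
      + 2 * h * (vol K * ((Mmat (t + h) K *v val K u) \<bullet> val K v)) + h\<^sup>2 * (vol K * ((Mmat (t + h) K *v val K u) \<bullet> val K u)))"
    unfolding M_form[OF w w]
  proof (rule sum.cong[OF refl])
    fix K assume K: "K \<in> P"
    show "vol K * ((Mmat (t + h) K *v val K ?w) \<bullet> val K ?w) = vol K * ((Mmat (t + h) K *v val K v) \<bullet> val K v)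
      + 2 * h * (vol K * ((Mmat (t + h) K *v val K u) \<bullet> val K v)) + h\<^sup>2 * (vol K * ((Mmat (t + h) K *v val K u) \<bullet> val K u))"
      unfolding Vh_lincomb(2)[OF v u(1) K]
      using symmetric_form_swap[OF Mmat_symmetric[OF K], of "t + h" "val K v" "val K u"]
      by (simp add: matrix_vector_right_distrib matrix_vector_mult_scaleR inner_add_left inner_add_right algebra_simps power2_eq_square)
  qed
  also have "\<dots> = inner_patch (M (t + h) v) v + 2 * h * inner_patch (M (t + h) u) v + h\<^sup>2 * inner_patch (M (t + h) u) u"
    by (simp only: sum.distrib M_form[OF v v] M_form[OF u(1) v] M_form[OF u(1) u(1)] sum_distrib_left)
  also have "inner_patch (M (t + h) v) v = inner_patch (M t v) v - h * inner_patch (M\<^sub>1 v) v"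
  proof -
    have "M (t + h) v = (\<lambda>x. 1 *\<^sub>R M t v x + (- h) *\<^sub>R M\<^sub>1 v x)" by (simp add: M_def fun_eq_iff scaleR_add_left)
    then show ?thesis using inner_patch_lincomb[OF M_Vh(1)[OF v] M1_Vh(1)[OF v] v, of 1 t "- h"] by simp
  qed
  also have "inner_patch (M (t + h) u) v = a v v + inner_patch (M\<^sub>1 v) v" unfolding u(2) by (rule AM(2)[OF v v])
  finally have "inner_patch (M (t + h) ?w) ?w = inner_patch (M t v) v - h * d v v + h\<^sup>2 * inner_patch (M (t + h) u) u"
    by (simp add: d_def algebra_simps)
  then show ?thesis by (simp add: u_def)
qed

text \<open>Both schemes are instances: t = 0 and h = \<tau> with k = \<kappa> for the single step,
  t = m / r and h = 1 / r with k = r for a subtent.\<close>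

lemma step_stable:
  assumes v: "v \<in> V\<^sub>h" and t: "t \<in> {0..1}" and \<tau>: "t + h \<in> {0..1}" and h: "0 \<le> h" and ne: "P \<noteq> {}"
    and k: "\<kappa> \<le> ennreal k" "0 \<le> k" "h * k \<le> 1"
  shows "M_norm (t + h) (\<lambda>x. v x + h *\<^sub>R increment (t + h) v x) \<le> M_norm t v"
proof -
  have "h\<^sup>2 * inner_patch (M (t + h) (increment (t + h) v)) (increment (t + h) v) \<le> h\<^sup>2 * (k * d v v)"
    by (intro mult_left_mono increment_\<kappa>[OF v \<tau> ne k(1,2)]) simp
  also have "\<dots> = h * ((h * k) * d v v)" by (simp add: power2_eq_square)
  also have "\<dots> \<le> h * (1 * d v v)" by (intro mult_left_mono mult_right_mono k(3) d_nonneg[OF v] h)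
  finally show ?thesis
    unfolding M_norm_def by (intro real_sqrt_le_mono) (simp add: energy_identity[OF v \<tau>])
qed

lemma step_Vh:
  assumes v: "v \<in> V\<^sub>h" and \<tau>: "\<tau> \<in> {0..1}"
  shows "(\<lambda>x. v x + h *\<^sub>R increment \<tau> v x) \<in> V\<^sub>h"
  using Vh_lincomb(1)[OF v increment(1)[OF v \<tau>], of 1 h] by simp

lemma \<kappa>_real:
  assumes ne: "P \<noteq> {}"
  obtains k where "0 \<le> k" "\<kappa> = ennreal k"
proof -
  have "\<kappa> \<noteq> top" using \<kappa>_le[OF ne] by (auto simp: top_unique)
  then show thesis using that by (cases \<kappa>) auto
qed

lemma R_sat_stable:
  assumes v: "v \<in> V\<^sub>h" and \<tau>: "\<tau> \<in> {0..1}" and ne: "P \<noteq> {}" and c: "ennreal \<tau> \<le> 1 / \<kappa>"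
  shows "M_norm \<tau> (R_sat \<tau> v) \<le> M_norm 0 v"
proof -
  obtain k where k: "0 \<le> k" "\<kappa> = ennreal k" using \<kappa>_real[OF ne] .
  \<comment> \<open>If \<kappa> = 0 then 1 / \<kappa> is infinite and restricts nothing, but the
    product is 0.\<close>
  have "\<tau> * k \<le> 1"
  proof (cases "k = 0")
    case False
    then have "1 / \<kappa> = ennreal (1 / k)" using k divide_ennreal[of 1 k] by simp
    then have "\<tau> \<le> 1 / k" using c k by simp
    then show ?thesis using False k(1) by (simp add: field_simps)
  qed simp
  then have "M_norm (0 + \<tau>) (\<lambda>x. v x + \<tau> *\<^sub>R increment (0 + \<tau>) v x) \<le> M_norm 0 v"
    using \<tau> k by (intro step_stable[OF v _ _ _ ne]) auto
  then show ?thesis by (simp add: R_sat_def[abs_def])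
qed

lemma R_sat_iterated_stable:
  assumes v: "v \<in> V\<^sub>h" and ne: "P \<noteq> {}" and r: "1 \<le> r" and c: "\<kappa> \<le> of_nat r"
  shows "M_norm 1 (R_sat_iterated r v) \<le> M_norm 0 v"
proof -
  have kr: "\<kappa> \<le> ennreal (real r)" using c by (simp add: ennreal_of_nat_eq_real_of_nat)
  have "fold (R_sat_subtent r) [1..<m+1] v \<in> V\<^sub>h \<and> M_norm (real m / real r) (fold (R_sat_subtent r) [1..<m+1] v) \<le> M_norm 0 v"
    if "m \<le> r" for m
    using that
  proof (induction m)
    case 0
    then show ?case using v by simp
  next
    case (Suc m)
    define w where "w = fold (R_sat_subtent r) [1..<m+1] v"
    have w: "w \<in> V\<^sub>h" "M_norm (real m / real r) w \<le> M_norm 0 v" using Suc by (auto simp: w_def)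
    have eq: "fold (R_sat_subtent r) [1..<Suc m + 1] v = R_sat_subtent r (m + 1) w"
      by (simp add: w_def)
    \<comment> \<open>Subtents are counted from 1: number m + 1 uses M at the start of number m + 2,
      that is, at its own end time (m + 1) / r.\<close>
    have time: "subtent_time r (m + 1 + 1) = real m / real r + 1 / real r"
      by (simp add: subtent_time_def add_divide_distrib[symmetric])
    have Suc_time: "real (Suc m) / real r = real m / real r + 1 / real r"
      by (simp add: add_divide_distrib[symmetric])
    have t1: "real m / real r + 1 / real r \<in> {0..1}" using Suc.prems r unfolding Suc_time[symmetric] by simp
    have t0: "real m / real r \<in> {0..1}" using Suc.prems r by simp
    have step: "R_sat_subtent r (m + 1) w = (\<lambda>x. w x + (1 / real r) *\<^sub>R increment (real m / real r + 1 / real r) w x)"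
      by (simp add: fun_eq_iff R_sat_subtent_def time[simplified])
    have "M_norm (real m / real r + 1 / real r) (R_sat_subtent r (m + 1) w) \<le> M_norm (real m / real r) w"
      unfolding step using r by (intro step_stable[OF w(1) t0 t1 _ ne kr]) auto
    moreover have "R_sat_subtent r (m + 1) w \<in> V\<^sub>h" unfolding step by (rule step_Vh[OF w(1) t1])
    ultimately show ?case unfolding eq Suc_time using w(2) by linarith
  qed
  from this[of r] show ?thesis using r by (simp add: R_sat_iterated_def)
qed

end

theorem proposition4p21:
  fixes \<Omega> :: "(real^'n) set"
    and \<L> :: "'n \<Rightarrow> real^'n \<Rightarrow> real^'l^'l"
    and \<G> :: "real^'n \<Rightarrow> real^'l^'l"
    and c' \<sigma> \<Gamma> :: real
  assumes "open \<Omega>" and "bounded \<Omega>"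
    and "admissible_coefficients \<Omega> \<L> \<G>"
    and "wave_speed \<Omega> \<L> \<G> < c'"
  shows "\<exists>C>0. \<forall>\<T> vtx \<phi>b \<phi>t S B.
    conforming_mesh \<Omega> \<T> \<and> shape_regular \<sigma> \<T> \<and>
    (\<forall>j. elementwise_constant \<T> (\<L> j)) \<and> elementwise_constant \<T> \<G> \<and>
    mesh_vertex \<T> vtx \<and> causal_tent c' \<T> vtx \<phi>b \<phi>t \<and>
    flux_conditions \<Gamma> \<Omega> \<L> \<T> S B \<longrightarrow>
    (let \<kappa> = tent_dg.\<kappa> \<Omega> \<L> \<G> \<T> vtx \<phi>b \<phi>t S B;
         V\<^sub>h = tent_dg.V\<^sub>h \<T> vtx;
         M_norm = tent_dg.M_norm \<L> \<G> \<T> vtx \<phi>b \<phi>t;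
         R_sat = tent_dg.R_sat \<Omega> \<L> \<G> \<T> vtx \<phi>b \<phi>t S B;
         R_sat_iterated = tent_dg.R_sat_iterated \<Omega> \<L> \<G> \<T> vtx \<phi>b \<phi>t S B
     in \<kappa> \<le> ennreal C \<and>
        (\<forall>\<tau>\<in>{0..1}. ennreal \<tau> \<le> 1 / \<kappa> \<longrightarrow>
           (\<forall>v\<in>V\<^sub>h. M_norm \<tau> (R_sat \<tau> v) \<le> M_norm 0 v)) \<and>
        (\<forall>r::nat. r \<ge> 1 \<and> \<kappa> \<le> of_nat r \<longrightarrow>
           (\<forall>v\<in>V\<^sub>h. M_norm 1 (R_sat_iterated r v) \<le> M_norm 0 v)))"
proof -
  obtain g0 where g0: "g0 > 0" "\<forall>x\<in>\<Omega>. \<forall>e. (\<G> x *v e) \<bullet> e \<ge> g0 * (norm e)\<^sup>2"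
    using assms(3) unfolding admissible_coefficients_def by blast
  \<comment> \<open>\<open>stab_const\<close> written out in data that are fixed before mesh and
    tent are quantified; the added 1 makes C positive.\<close>
  define C where "C = \<bar>4 * flux_const \<Gamma> * (real (CARD('n) + 1) * (2 * \<bar>\<sigma>\<bar> / c') + 1)
    / ((1 - wave_speed \<Omega> \<L> \<G> / c') * g0)\<bar> + 1"
  show ?thesis
  proof (intro exI[of _ C] conjI allI impI)
    show "0 < C" unfolding C_def by (rule add_nonneg_pos) simp_all
    fix \<T> vtx \<phi>b \<phi>t S B
    assume h: "conforming_mesh \<Omega> \<T> \<and> shape_regular \<sigma> \<T> \<and>
      (\<forall>j. elementwise_constant \<T> (\<L> j)) \<and> elementwise_constant \<T> \<G> \<and>
      mesh_vertex \<T> vtx \<and> causal_tent c' \<T> vtx \<phi>b \<phi>t \<and> flux_conditions \<Gamma> \<Omega> \<L> \<T> S B"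
    interpret tent_setup \<Omega> \<L> \<G> \<T> vtx \<phi>b \<phi>t S B c' \<sigma> \<Gamma> g0
      using assms h g0 by unfold_locales simp_all
    \<comment> \<open>The vertex of the tent belongs to some element; a nonempty patch yields c' > 0
      and m0 > 0.\<close>
    have ne: "P \<noteq> {}" using h by (auto simp: mesh_vertex_def patch_def)
    have "\<bar>stab_const\<bar> \<le> C" by (simp add: C_def stab_const_def trace_const_def m0_def)
    then have "\<kappa> \<le> ennreal C" using \<kappa>_le[OF ne] ennreal_leI order_trans by blast
    then show "let \<kappa> = \<kappa>; V\<^sub>h = V\<^sub>h; M_norm = M_norm; R_sat = R_sat; R_sat_iterated = R_sat_iterated
      in \<kappa> \<le> ennreal C \<and>
        (\<forall>\<tau>\<in>{0..1}. ennreal \<tau> \<le> 1 / \<kappa> \<longrightarrow>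
           (\<forall>v\<in>V\<^sub>h. M_norm \<tau> (R_sat \<tau> v) \<le> M_norm 0 v)) \<and>
        (\<forall>r::nat. r \<ge> 1 \<and> \<kappa> \<le> of_nat r \<longrightarrow>
           (\<forall>v\<in>V\<^sub>h. M_norm 1 (R_sat_iterated r v) \<le> M_norm 0 v))"
      unfolding Let_def using R_sat_stable[OF _ _ ne] R_sat_iterated_stable[OF _ ne] by blast
  qed
qed

end
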